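(* Consider the Gaussian white noise model with $A$ the convolution operator $Af=a*f$, where the convolution filter $a$ is a 1-periodic function in $L_2([0,1]^d)$ with expansion $a=\sum_{j\in\{0,1,\ldots\}^d}\sum_{k\in K_j}b_{jk}\phi_{jk}$, the functions $\phi_{jk}$ being singular functions of $A$ with singular values given by the $b_{jk}$ up to constant factors. Let $$\mathcal{F}=\Big\{\sum_{j_1=0,\ldots,j_d=0}^\infty\sum_{k\in K_j}\theta_{jk}\phi_{jk}:(\theta_{jk})\in\Theta\Big\},\qquad \Theta=\Big\{\theta:\sum_{j_1=0,\ldots,j_d=0}^\infty\sum_{k\in K_j}a_{jk}^2\theta_{jk}^2\le L^2\Big\},$$ where $L>0$. Assume that $$C_0|j|^s\le a_{jk}\le C_1|j|^s\qquad (j\ne0)$$ for some $s>0$ and $C_0,C_1>0$, and that $$C_2|j|^{-q}\le b_{jk}\le C_3|j|^{-q}\qquad(j\ne0)$$ for some $q\ge0$ and $C_2,C_3>0$, with $a_{jk},b_{jk}>0$ for $j=0$. Then $$\limsup_{n\to\infty}n^{2s/(2s+2q+d)}\sup_{f\in\mathcal{F}}E_f\|\hat f-f\|_2^2<\infty,$$ where $\hat f$ is the $\delta$-net estimator (with $\delta=n^{-s/(2s+2q+d)}$, over the net described in the context). Also, $$\liminf_{n\to\infty}n^{2s/(2s+2q+d)}\inf_{\hat g}\sup_{f\in\mathcal{F}}E_f\|\hat g-f\|_2^2>0,$$ where the infimum is taken over all estimators $\hat g$.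
   Context: Notation. For a multi-index $j\in\{0,1,\ldots\}^d$, $|j|=j_1+\cdots+j_d$ and $K_j=\{k\in\{0,1\}^d:k_i=0\text{ when }j_i=0\}$. For $k\in K_j$, $$\phi_{jk}(x)=\prod_{i=1}^d\sqrt2\,[(1-k_i)\cos(2\pi j_ix_i)+k_i\sin(2\pi j_ix_i)],\qquad x\in[0,1]^d,$$ a basis for 1-periodic functions in $L_2([0,1]^d)$. $Af=a*f$ is the (periodic) convolution $a*f(x)=\int a(x-y)f(y)\,dy$ of functions on $[0,1]^d$, viewed as an operator on $L_2([0,1]^d)$; $\|\cdot\|_2$ is the $L_2([0,1]^d)$ norm. That $\phi_{jk}$ are singular functions of $A$ with singular values given by $b_{jk}$ up to constant factors means $A^*A\phi_{jk}=\beta_{jk}^2\phi_{jk}$ with $c\,b_{jk}\le\beta_{jk}\le c'b_{jk}$ for constants $c,c'>0$ not depending on $j,k$. Gaussian white noise model: one observes $dY_n(y)=(Af)(y)\,dy+n^{-1/2}dW(y)$ on $\mathbf{Y}=[0,1]^d$, i.e. $\int h\,dY_n=\int h\,(Af)+n^{-1/2}\int h\,dW$ for $h\in L_2(\mathbf{Y})$, where $(\int h_1dW,\int h_2dW)$ is mean-zero Gaussian with variances $\|h_1\|_2^2,\|h_2\|_2^2$ and covariance $\int h_1h_2$. $E_f$ is expectation under $f$; estimators are measurable functions of the observed process. $\delta$-net estimator: $\hat f=\arg\min_{\phi\in\mathcal{F}_\delta}\gamma_n(\phi)$, where $\gamma_n(g)=-2\int(Qg)\,dY_n+\|g\|_2^2$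 and $Q=(A^{-1})^*$ is the adjoint of the inverse of $A$ (so $\int fg=\int(Af)(Qg)$). The net $\mathcal{F}_\delta=\{\sum_{j,k}\theta_{jk}\phi_{jk}:\theta\in\Theta_\delta\}$ is a finite $\delta$-net of $\mathcal{F}$ in $L_2$ (each $f\in\mathcal{F}$ is within $L_2$-distance $\delta$ of an element of $\mathcal{F}_\delta$) such that every $\theta\in\Theta_\delta$ has $\theta_{jk}=0$ for $j\notin\{0,\ldots,M\}^d$, with $M\asymp\delta^{-1/s}$, and $\log(\#\mathcal{F}_\delta)\le C\delta^{-d/s}$ with $C$ not depending on $\delta$. *)

theory Defs
  imports "HOL-Probability.Probability"
begin

section \<open>The space of square integrable functions on the unit cube\<close>

text \<open>
  Elements of \<open>L\<^sub>2([0,1]\<^sup>d)\<close> are represented by functions on the whole space, of which only the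
  values on the cube matter; functions that agree almost everywhere on the cube are not identified.
\<close>

definition cube :: "(real ^ 'd::finite) measure" where
  "cube = restrict_space lborel (cbox 0 1)"

definition L2 :: "(real ^ 'd::finite \<Rightarrow> real) set" where
  "L2 = {f \<in> borel_measurable cube. integrable cube (\<lambda>x. (f x)\<^sup>2)}"

definition L2_inner :: "(real ^ 'd::finite \<Rightarrow> real) \<Rightarrow> (real ^ 'd \<Rightarrow> real) \<Rightarrow> real" where
  "L2_inner f g = (\<integral>x. f x * g x \<partial>cube)"

definition L2_norm :: "(real ^ 'd::finite \<Rightarrow> real) \<Rightarrow> real" where
  "L2_norm f = sqrt (L2_inner f f)"

text \<open>
  Since \<open>L\<^sub>2\<close> is separable, its Borel sets are generated by the open balls.
\<close>

definition L2_borel :: "(real ^ 'd::finite \<Rightarrow> real) measure" where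
  "L2_borel = sigma L2 {{u \<in> L2. L2_norm (\<lambda>x. u x - g x) < r} | g r. g \<in> L2}"

text \<open>
  Operators that are possibly only densely defined are treated as graphs. For \<open>G\<close> the graph of
  \<open>T\<close>, the converse of \<open>G\<close> is the graph of the inverse of \<open>T\<close>, and \<open>op_adjoint G\<close> is the graph of
  the adjoint of \<open>T\<close> (with values determined up to null sets).
\<close>

definition op_graph ::
  "((real ^ 'd::finite \<Rightarrow> real) \<Rightarrow> (real ^ 'd \<Rightarrow> real)) \<Rightarrow>
   ((real ^ 'd \<Rightarrow> real) \<times> (real ^ 'd \<Rightarrow> real)) set" where
  "op_graph T = {(f, T f) | f. f \<in> L2}"

definition op_adjoint ::
  "((real ^ 'd::finite \<Rightarrow> real) \<times> (real ^ 'd \<Rightarrow> real)) set \<Rightarrow>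
   ((real ^ 'd \<Rightarrow> real) \<times> (real ^ 'd \<Rightarrow> real)) set" where
  "op_adjoint G =
     {(u, v). u \<in> L2 \<and> v \<in> L2 \<and> (\<forall>(f, g) \<in> G. L2_inner g u = L2_inner f v)}"


section \<open>The trigonometric basis\<close>

definition mabs :: "nat ^ 'd::finite \<Rightarrow> nat" where
  "mabs j = (\<Sum>i\<in>UNIV. j $ i)"

definition K :: "nat ^ 'd::finite \<Rightarrow> (nat ^ 'd) set" where
  "K j = {k. \<forall>i. k $ i \<in> {0, 1} \<and> (j $ i = 0 \<longrightarrow> k $ i = 0)}"

definition jk_index :: "((nat ^ 'd::finite) \<times> (nat ^ 'd)) set" where
  "jk_index = (SIGMA j:UNIV. K j)"

text \<open>
  The factor \<open>sqrt 2\<close> is also present in the coordinates with \<open>j $ i = 0\<close>, so these functions are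
  orthogonal with squared norms between \<open>1\<close> and \<open>2\<^sup>d\<close>, but not all normalised.
\<close>

definition phi :: "nat ^ 'd::finite \<Rightarrow> nat ^ 'd \<Rightarrow> real ^ 'd \<Rightarrow> real" where
  "phi j k x = (\<Prod>i\<in>UNIV. sqrt 2 *
     ((1 - real (k $ i)) * cos (2 * pi * real (j $ i) * x $ i)
      + real (k $ i) * sin (2 * pi * real (j $ i) * x $ i)))"

definition L2_expansion ::
  "(real ^ 'd::finite \<Rightarrow> real) \<Rightarrow> (nat ^ 'd \<Rightarrow> nat ^ 'd \<Rightarrow> real) \<Rightarrow> bool" where
  "L2_expansion f \<theta> \<longleftrightarrow> f \<in> L2 \<and>
     ((\<lambda>S. L2_norm (\<lambda>x. f x - (\<Sum>(j, k)\<in>S. \<theta> j k * phi j k x))) \<longlongrightarrow> 0)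
       (finite_subsets_at_top jk_index)"

definition ellipsoid ::
  "(nat ^ 'd::finite \<Rightarrow> nat ^ 'd \<Rightarrow> real) \<Rightarrow> real \<Rightarrow> (nat ^ 'd \<Rightarrow> nat ^ 'd \<Rightarrow> real) set" where
  "ellipsoid w L = {\<theta>.
     (\<lambda>(j, k). (w j k)\<^sup>2 * (\<theta> j k)\<^sup>2) summable_on jk_index \<and>
     (\<Sum>\<^sub>\<infinity>(j, k)\<in>jk_index. (w j k)\<^sup>2 * (\<theta> j k)\<^sup>2) \<le> L\<^sup>2}"

definition fun_class ::
  "(nat ^ 'd::finite \<Rightarrow> nat ^ 'd \<Rightarrow> real) \<Rightarrow> real \<Rightarrow> (real ^ 'd \<Rightarrow> real) set" where
  "fun_class w L = {f. \<exists>\<theta>\<in>ellipsoid w L. L2_expansion f \<theta>}"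


section \<open>The convolution operator\<close>

definition periodic1 :: "(real ^ 'd::finite \<Rightarrow> real) \<Rightarrow> bool" where
  "periodic1 a \<longleftrightarrow> (\<forall>x i. a (x + axis i 1) = a x)"

definition conv :: "(real ^ 'd::finite \<Rightarrow> real) \<Rightarrow> (real ^ 'd \<Rightarrow> real) \<Rightarrow> real ^ 'd \<Rightarrow> real" where
  "conv a f x = (\<integral>y. a (x - y) * f y \<partial>cube)"

text \<open>
  The basis functions are singular functions of \<open>T\<close>, with singular values \<open>\<beta>\<close> that are given by
  \<open>b\<close> up to constant factors; the membership says \<open>T\<^sup>* (T (phi j k)) = \<beta>\<^sup>2 phi j k\<close>.
\<close>

definition singular_upto ::
  "((real ^ 'd::finite \<Rightarrow> real) \<Rightarrow> (real ^ 'd \<Rightarrow> real)) \<Rightarrow>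
   (nat ^ 'd \<Rightarrow> nat ^ 'd \<Rightarrow> real) \<Rightarrow> bool" where
  "singular_upto T b \<longleftrightarrow> (\<exists>\<beta>. \<exists>c>0. \<exists>c'>0. \<forall>j. \<forall>k\<in>K j.
     (T (phi j k), \<lambda>x. (\<beta> j k)\<^sup>2 * phi j k x) \<in> op_adjoint (op_graph T) \<and>
     c * b j k \<le> \<beta> j k \<and> \<beta> j k \<le> c' * b j k)"

text \<open>
  The adjoint of the inverse: \<open>L2_inner f g = L2_inner (T f) (inv_adjoint T g)\<close> for all \<open>f\<close>.
\<close>

definition inv_adjoint ::
  "((real ^ 'd::finite \<Rightarrow> real) \<Rightarrow> (real ^ 'd \<Rightarrow> real)) \<Rightarrow>
   (real ^ 'd \<Rightarrow> real) \<Rightarrow> (real ^ 'd \<Rightarrow> real)" where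
  "inv_adjoint T g = (SOME h. (g, h) \<in> op_adjoint ((op_graph T)\<inverse>))"


section \<open>The Gaussian white noise model\<close>

definition centered_normal :: "'w measure \<Rightarrow> ('w \<Rightarrow> real) \<Rightarrow> real \<Rightarrow> bool" where
  "centered_normal P X v \<longleftrightarrow> X \<in> borel_measurable P \<and>
     distr P borel X =
       (if v = 0 then return borel 0 else density lborel (normal_density 0 (sqrt v)))"

text \<open>
  \<open>W h\<close> is the integral of \<open>h\<close> with respect to white noise. Joint normality of a pair is expressed
  by the normality of all its linear combinations. The covariances make \<open>W\<close> almost surely linear,
  so that all finite families, not only pairs, are jointly normal.
\<close>

definition white_noise :: "'w measure \<Rightarrow> ((real ^ 'd::finite \<Rightarrow> real) \<Rightarrow> 'w \<Rightarrow> real) \<Rightarrow> bool" where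
  "white_noise P W \<longleftrightarrow> prob_space P \<and>
     (\<forall>h1\<in>L2. \<forall>h2\<in>L2. \<forall>c1 c2.
        centered_normal P (\<lambda>\<omega>. c1 * W h1 \<omega> + c2 * W h2 \<omega>)
          (c1\<^sup>2 * (L2_norm h1)\<^sup>2 + 2 * c1 * c2 * L2_inner h1 h2 + c2\<^sup>2 * (L2_norm h2)\<^sup>2))"

abbreviation path_space :: "((real ^ 'd::finite \<Rightarrow> real) \<Rightarrow> real) measure" where
  "path_space \<equiv> (\<Pi>\<^sub>M h\<in>L2. borel)"

definition obs ::
  "((real ^ 'd::finite \<Rightarrow> real) \<Rightarrow> (real ^ 'd \<Rightarrow> real)) \<Rightarrow>
   ((real ^ 'd \<Rightarrow> real) \<Rightarrow> 'w \<Rightarrow> real) \<Rightarrow> nat \<Rightarrow> (real ^ 'd \<Rightarrow> real) \<Rightarrow> 'w \<Rightarrow>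
   (real ^ 'd \<Rightarrow> real) \<Rightarrow> real" where
  "obs T W n f \<omega> = (\<lambda>h\<in>L2. L2_inner h (T f) + W h \<omega> / sqrt (real n))"

definition estimators ::
  "(((real ^ 'd::finite \<Rightarrow> real) \<Rightarrow> real) \<Rightarrow> (real ^ 'd \<Rightarrow> real)) set" where
  "estimators = path_space \<rightarrow>\<^sub>M L2_borel"

definition risk ::
  "((real ^ 'd::finite \<Rightarrow> real) \<Rightarrow> (real ^ 'd \<Rightarrow> real)) \<Rightarrow>
   'w measure \<Rightarrow> ((real ^ 'd \<Rightarrow> real) \<Rightarrow> 'w \<Rightarrow> real) \<Rightarrow> nat \<Rightarrow>
   (((real ^ 'd \<Rightarrow> real) \<Rightarrow> real) \<Rightarrow> (real ^ 'd \<Rightarrow> real)) \<Rightarrow> (real ^ 'd \<Rightarrow> real) \<Rightarrow> ennreal" where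
  "risk T P W n g f =
     (\<integral>\<^sup>+\<omega>. ennreal ((L2_norm (\<lambda>x. g (obs T W n f \<omega>) x - f x))\<^sup>2) \<partial>P)"


section \<open>The delta-net estimator\<close>

definition trig_poly :: "nat \<Rightarrow> (nat ^ 'd::finite \<Rightarrow> nat ^ 'd \<Rightarrow> real) \<Rightarrow> real ^ 'd \<Rightarrow> real" where
  "trig_poly M \<theta> x = (\<Sum>j | \<forall>i. j $ i \<le> M. \<Sum>k\<in>K j. \<theta> j k * phi j k x)"

text \<open>
  The net at level \<open>\<delta>\<close> is \<open>trig_poly (M \<delta>) ` \<Theta> \<delta>\<close>. The constants do not depend on \<open>\<delta>\<close>.
\<close>

definition delta_nets ::
  "real \<Rightarrow> (real ^ 'd::finite \<Rightarrow> real) set \<Rightarrow> (real \<Rightarrow> nat) \<Rightarrow>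
   (real \<Rightarrow> (nat ^ 'd \<Rightarrow> nat ^ 'd \<Rightarrow> real) set) \<Rightarrow> bool" where
  "delta_nets s F M \<Theta> \<longleftrightarrow> (\<exists>c1>0. \<exists>c2>0. \<exists>C. \<forall>\<delta>\<in>{0<..1}.
     finite (trig_poly (M \<delta>) ` \<Theta> \<delta>) \<and>
     (\<forall>f\<in>F. \<exists>g\<in>trig_poly (M \<delta>) ` \<Theta> \<delta>. L2_norm (\<lambda>x. f x - g x) \<le> \<delta>) \<and>
     (\<forall>\<theta>\<in>\<Theta> \<delta>. \<forall>j k. (\<exists>i. j $ i > M \<delta>) \<longrightarrow> \<theta> j k = 0) \<and>
     c1 * \<delta> powr (- 1 / s) \<le> real (M \<delta>) \<and> real (M \<delta>) \<le> c2 * \<delta> powr (- 1 / s) \<and>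
     ln (real (card (trig_poly (M \<delta>) ` \<Theta> \<delta>))) \<le> C * \<delta> powr (- real CARD('d) / s))"

definition contrast ::
  "((real ^ 'd::finite \<Rightarrow> real) \<Rightarrow> (real ^ 'd \<Rightarrow> real)) \<Rightarrow>
   ((real ^ 'd \<Rightarrow> real) \<Rightarrow> real) \<Rightarrow> (real ^ 'd \<Rightarrow> real) \<Rightarrow> real" where
  "contrast T y g = - 2 * y (inv_adjoint T g) + (L2_norm g)\<^sup>2"

definition net_estimator ::
  "((real ^ 'd::finite \<Rightarrow> real) \<Rightarrow> (real ^ 'd \<Rightarrow> real)) \<Rightarrow> (real ^ 'd \<Rightarrow> real) set \<Rightarrow>
   (((real ^ 'd \<Rightarrow> real) \<Rightarrow> real) \<Rightarrow> (real ^ 'd \<Rightarrow> real)) \<Rightarrow> bool" where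
  "net_estimator T N g \<longleftrightarrow> g \<in> estimators \<and>
     (\<forall>y\<in>space path_space. is_arg_min (contrast T y) (\<lambda>h. h \<in> N) (g y))"

end

theory Submission
  imports Defs
begin

text \<open>
  Upper bound: minimality of the contrast at the net estimator bounds its squared error by the
  squared distance of \<open>f\<close> to the net plus a noise increment. The standard deviation of
  the increment is controlled by the smallest singular value on the frequencies of the net (of order
  \<open>\<delta> powr (q / s)\<close>), and the maximum over the net costs the logarithm of its cardinality.

  Lower bound: Assouad's argument on a cube of sign vectors with frequencies of order
  \<open>n powr (1 / (2 * s + 2 * q + d))\<close>, with the Cameron-Martin formula for white noise as the
  change of measure.

  The adjoint of the inverse of the convolution is only determined up to the orthogonal complement of its
  range; that this complement is trivial rests on the completeness of the trigonometric
  functions, which is derived from the Stone-Weierstrass theorem on the torus.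
\<close>

section \<open>Square integrable functions on the cube\<close>

text \<open>The rate is a balance. Noise costs the largest \<open>1 / \<beta>\<close> squared on the
  net times the logarithm of its cardinality, divided by \<open>n\<close>. Up to constants this is
  \<open>\<delta> powr (- (2 * q + d) / s) / n\<close>, which for the given \<open>\<delta>\<close>
  equals \<open>\<delta>\<^sup>2\<close>. In the lower bound \<open>m powr d\<close> signs of
  squared size about \<open>m powr (- (2 * s + d))\<close> just fit into the ellipsoid. Each carries
  information of order \<open>n * m powr (- (2 * s + 2 * q + d))\<close>, bounded for the chosen
  \<open>m\<close>, and together they force an error of order \<open>m powr (- 2 * s)\<close>. The
  obstacle is probabilistic: white noise is given only through normality of pairs, with neither
  joint laws nor independence, while an estimator may look at a path over the uncountable index set
  \<open>L2\<close>. Joint laws are recovered from integrals of cosines of linear combinations;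
  almost sure linearity turns a combination of many noise variables into a single one, and equality
  on cylinder sets then identifies the laws of whole paths.\<close>

lemma space_cube [simp]: "space (cube :: (real ^ 'd::finite) measure) = cbox 0 1"
  by (simp add: cube_def space_restrict_space)

lemma emeasure_cube_space: "emeasure (cube :: (real ^ 'd::finite) measure) (cbox 0 1) = 1"
proof -
  have "emeasure lborel (cbox 0 1 :: (real ^ 'd) set) = ennreal (\<Prod>b\<in>Basis. (1 - 0 :: real ^ 'd) \<bullet> b)"
    by (rule emeasure_lborel_cbox) (auto simp: Basis_vec_def inner_axis)
  also have "(\<Prod>b\<in>Basis. (1 - 0 :: real ^ 'd) \<bullet> b) = 1"
    by (rule prod.neutral) (auto simp: Basis_vec_def inner_axis)
  finally show ?thesis
    by (simp add: cube_def emeasure_restrict_space)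
qed

interpretation cube: prob_space "cube :: (real ^ 'd::finite) measure"
  by standard (simp add: emeasure_cube_space)

lemma measurable_cube:
  "f \<in> borel_measurable borel \<Longrightarrow> f \<in> borel_measurable (cube :: (real ^ 'd::finite) measure)"
  unfolding cube_def by (intro measurable_restrict_space1) simp

lemma measurable_cube_indicator:
  "A \<in> sets borel \<Longrightarrow> (indicator A :: _ \<Rightarrow> real) \<in> borel_measurable (cube :: (real ^ 'd::finite) measure)"
  by (intro measurable_cube) simp

lemma L2_measurable: "f \<in> L2 \<Longrightarrow> f \<in> borel_measurable cube"
  by (simp add: L2_def)

lemma L2_mult_integrable:
  assumes "f \<in> L2" "g \<in> L2"
  shows "integrable cube (\<lambda>x. f x * g x)"
proof (rule Bochner_Integration.integrable_bound)
  show "integrable cube (\<lambda>x. (f x)\<^sup>2 + (g x)\<^sup>2)"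
    using assms by (auto simp: L2_def)
  show "(\<lambda>x. f x * g x) \<in> borel_measurable cube"
    using assms by (auto simp: L2_def)
  have "\<bar>a * b\<bar> \<le> a\<^sup>2 + b\<^sup>2" for a b :: real
    using sum_squares_bound[of "\<bar>a\<bar>" "\<bar>b\<bar>"] abs_ge_zero[of "a * b"]
    unfolding abs_mult power2_abs by linarith
  then show "AE x in cube. norm (f x * g x) \<le> norm ((f x)\<^sup>2 + (g x)\<^sup>2)"
    by auto
qed

lemma L2_integrable: "f \<in> L2 \<Longrightarrow> integrable cube f"
proof -
  assume "f \<in> L2"
  moreover have "(\<lambda>x. 1) \<in> L2"
    by (auto simp: L2_def)
  ultimately show ?thesis
    using L2_mult_integrable[of f "\<lambda>x. 1"] by simp
qed

lemma L2_add: "f \<in> L2 \<Longrightarrow> g \<in> L2 \<Longrightarrow> (\<lambda>x. f x + g x) \<in> L2"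
  using L2_mult_integrable[of f g] by (auto simp: L2_def power2_sum mult.assoc)

lemma L2_cmult: "f \<in> L2 \<Longrightarrow> (\<lambda>x. c * f x) \<in> L2"
  by (auto simp: L2_def power_mult_distrib)

lemma L2_diff: "f \<in> L2 \<Longrightarrow> g \<in> L2 \<Longrightarrow> (\<lambda>x. f x - g x) \<in> L2"
  using L2_add[of f "\<lambda>x. (-1) * g x"] L2_cmult[of g "-1"] by simp

lemma L2_zero: "(\<lambda>x. 0) \<in> L2"
  by (auto simp: L2_def)

lemma L2_sum: "(\<And>i. i \<in> I \<Longrightarrow> f i \<in> L2) \<Longrightarrow> (\<lambda>x. \<Sum>i\<in>I. f i x) \<in> L2"
  by (induction I rule: infinite_finite_induct) (auto simp: L2_zero intro: L2_add)

lemma L2_bounded: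
  assumes "f \<in> borel_measurable cube" "\<And>x. x \<in> cbox 0 1 \<Longrightarrow> \<bar>f x\<bar> \<le> B"
  shows "f \<in> L2"
proof -
  have "integrable cube (\<lambda>x. (f x)\<^sup>2)"
  proof (rule cube.integrable_const_bound[where B = "B\<^sup>2"])
    show "AE x in cube. norm ((f x)\<^sup>2) \<le> B\<^sup>2"
      using assms(2) power_mono[OF assms(2) abs_ge_zero, of _ 2] by (auto intro!: AE_I2)
  qed (use assms in auto)
  then show ?thesis
    using assms by (simp add: L2_def)
qed

lemma L2_inner_commute: "L2_inner f g = L2_inner g f"
  by (simp add: L2_inner_def mult.commute)

lemma L2_inner_add_left:
  "f \<in> L2 \<Longrightarrow> g \<in> L2 \<Longrightarrow> h \<in> L2 \<Longrightarrow> L2_inner (\<lambda>x. f x + g x) h = L2_inner f h + L2_inner g h"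
  by (simp add: L2_inner_def distrib_right L2_mult_integrable)

lemma L2_inner_diff_left:
  "f \<in> L2 \<Longrightarrow> g \<in> L2 \<Longrightarrow> h \<in> L2 \<Longrightarrow> L2_inner (\<lambda>x. f x - g x) h = L2_inner f h - L2_inner g h"
  by (simp add: L2_inner_def left_diff_distrib L2_mult_integrable)

lemma L2_inner_cmult_left: "L2_inner (\<lambda>x. c * f x) h = c * L2_inner f h"
  by (simp add: L2_inner_def mult.assoc)

lemma L2_inner_sum_left:
  assumes "\<And>i. i \<in> I \<Longrightarrow> f i \<in> L2" "h \<in> L2"
  shows "L2_inner (\<lambda>x. \<Sum>i\<in>I. f i x) h = (\<Sum>i\<in>I. L2_inner (f i) h)"
  using assms by (simp add: L2_inner_def sum_distrib_right L2_mult_integrable)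

lemma L2_inner_add_right:
  "f \<in> L2 \<Longrightarrow> g \<in> L2 \<Longrightarrow> h \<in> L2 \<Longrightarrow> L2_inner h (\<lambda>x. f x + g x) = L2_inner h f + L2_inner h g"
  using L2_inner_add_left by (simp add: L2_inner_commute[of h])

lemma L2_inner_diff_right:
  "f \<in> L2 \<Longrightarrow> g \<in> L2 \<Longrightarrow> h \<in> L2 \<Longrightarrow> L2_inner h (\<lambda>x. f x - g x) = L2_inner h f - L2_inner h g"
  using L2_inner_diff_left by (simp add: L2_inner_commute[of h])

lemma L2_inner_cmult_right: "L2_inner h (\<lambda>x. c * f x) = c * L2_inner h f"
  using L2_inner_cmult_left by (simp add: L2_inner_commute[of h])

lemma L2_inner_sum_right:
  assumes "\<And>i. i \<in> I \<Longrightarrow> f i \<in> L2" "h \<in> L2"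
  shows "L2_inner h (\<lambda>x. \<Sum>i\<in>I. f i x) = (\<Sum>i\<in>I. L2_inner h (f i))"
  using L2_inner_sum_left[OF assms] by (simp add: L2_inner_commute[of h])

lemma L2_inner_self_nonneg: "0 \<le> L2_inner f f"
  by (simp add: L2_inner_def)

lemma L2_norm_nonneg: "0 \<le> L2_norm f"
  by (simp add: L2_norm_def L2_inner_self_nonneg)

lemma L2_norm_square: "(L2_norm f)\<^sup>2 = L2_inner f f"
  by (simp add: L2_norm_def L2_inner_self_nonneg)

lemma L2_norm_square_diff:
  assumes "f \<in> L2" "g \<in> L2"
  shows "(L2_norm (\<lambda>x. f x - g x))\<^sup>2 = (L2_norm f)\<^sup>2 - 2 * L2_inner f g + (L2_norm g)\<^sup>2"
  using assms L2_inner_commute[of f g]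
  by (simp add: L2_norm_square L2_inner_diff_left L2_inner_diff_right L2_diff)

lemma L2_norm_minus_commute: "L2_norm (\<lambda>x. f x - g x) = L2_norm (\<lambda>x. g x - f x)"
  by (simp add: L2_norm_def L2_inner_def algebra_simps)

text \<open>Parallelogram law for \<open>f - h\<close> and \<open>g - h\<close>, with the squared
  norm of their sum dropped. It stands in for the triangle inequality without any square
  root.\<close>

lemma L2_norm_diff_square_le:
  assumes "f \<in> L2" "g \<in> L2" "h \<in> L2"
  shows "(L2_norm (\<lambda>x. f x - g x))\<^sup>2 \<le>
    2 * (L2_norm (\<lambda>x. f x - h x))\<^sup>2 + 2 * (L2_norm (\<lambda>x. h x - g x))\<^sup>2"
proof -
  let ?p = "\<lambda>x. f x - h x" and ?r = "\<lambda>x. g x - h x"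
  have pr: "?p \<in> L2" "?r \<in> L2"
    using assms by (auto intro: L2_diff)
  have "(\<lambda>x. f x - g x) = (\<lambda>x. ?p x - ?r x)"
    by auto
  then have "(L2_norm (\<lambda>x. f x - g x))\<^sup>2 = (L2_norm ?p)\<^sup>2 - 2 * L2_inner ?p ?r + (L2_norm ?r)\<^sup>2"
    using L2_norm_square_diff[OF pr] by simp
  moreover have "0 \<le> L2_inner (\<lambda>x. ?p x + ?r x) (\<lambda>x. ?p x + ?r x)"
    by (rule L2_inner_self_nonneg)
  then have "0 \<le> (L2_norm ?p)\<^sup>2 + 2 * L2_inner ?p ?r + (L2_norm ?r)\<^sup>2"
    unfolding L2_inner_add_left[OF pr L2_add[OF pr]] L2_inner_add_right[OF pr pr(1)]
      L2_inner_add_right[OF pr pr(2)] L2_norm_square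
    using L2_inner_commute[of ?p ?r] by linarith
  ultimately show ?thesis
    unfolding L2_norm_minus_commute[of h g] by linarith
qed

lemma L2_norm_eq_0_iff:
  assumes "f \<in> L2"
  shows "L2_norm f = 0 \<longleftrightarrow> (AE x in cube. f x = 0)"
  using assms integral_nonneg_eq_0_iff_AE[of cube "\<lambda>x. f x * f x"]
  by (auto simp: L2_norm_def L2_inner_def L2_mult_integrable)

lemma L2_inner_AE_zero: "AE x in cube. f x = 0 \<Longrightarrow> g \<in> L2 \<Longrightarrow> f \<in> L2 \<Longrightarrow> L2_inner f g = 0"
  unfolding L2_inner_def by (rule integral_eq_zero_AE) auto

text \<open>The generating balls make each distance \<open>L2_norm (\<lambda>x. u x - g x)\<close>
  measurable in \<open>u\<close>, and polarization writes the inner product with \<open>h\<close>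
  through the distances of \<open>u\<close> to \<open>0\<close> and to \<open>h\<close>.\<close>

lemma L2_inner_borel_measurable:
  assumes "h \<in> L2"
  shows "(\<lambda>u. L2_inner u h) \<in> borel_measurable L2_borel"
proof -
  have sp: "space (L2_borel :: (real ^ 'a \<Rightarrow> real) measure) = L2"
    unfolding L2_borel_def by (rule space_measure_of) auto
  have nm: "(\<lambda>u. L2_norm (\<lambda>x. u x - g x)) \<in> borel_measurable L2_borel"
    if "g \<in> L2" for g :: "real ^ 'a \<Rightarrow> real"
  proof (rule borel_measurableI_less)
    fix r :: real
    have "{u \<in> L2. L2_norm (\<lambda>x. u x - g x) < r} \<in> sets L2_borel"
      unfolding L2_borel_def using that by (subst sets_measure_of) (auto intro!: sigma_sets.Basic)
    then show "{u \<in> space L2_borel. L2_norm (\<lambda>x. u x - g x) < r} \<in> sets L2_borel"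
      by (simp add: sp)
  qed
  have "(\<lambda>u. ((L2_norm (\<lambda>x. u x - 0))\<^sup>2 + (L2_norm h)\<^sup>2 - (L2_norm (\<lambda>x. u x - h x))\<^sup>2) / 2)
    \<in> borel_measurable L2_borel"
    using nm[OF assms] nm[OF L2_zero] by measurable
  then show ?thesis
    by (rule measurable_cong[THEN iffD1, rotated]) (simp add: sp L2_norm_square_diff assms)
qed

section \<open>Periodic functions and product integrals\<close>

definition int_vec :: "int ^ 'd::finite \<Rightarrow> real ^ 'd" where
  "int_vec m = (\<chi> i. of_int (m $ i))"

text \<open>Half-open, so that every point has exactly one integer translate in it; with the closed
  cube the boundary points would be counted several times.\<close>

definition half_open_cube :: "(real ^ 'd::finite) set" where
  "half_open_cube = {x. \<forall>i. 0 \<le> x $ i \<and> x $ i < 1}"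

lemma periodic1_int_vec:
  fixes a :: "real ^ 'd::finite \<Rightarrow> real"
  assumes "periodic1 a"
  shows "a (x + int_vec m) = a x"
proof -
  have one: "a (x + of_int k *\<^sub>R axis i 1) = a x" for x i and k :: int
  proof (induction k rule: int_induct[where k = 0])
    case base
    then show ?case by simp
  next
    case (step1 k)
    have "a (x + of_int (k + 1) *\<^sub>R axis i 1) = a ((x + of_int k *\<^sub>R axis i 1) + axis i 1)"
      by (simp add: algebra_simps)
    then show ?case
      using assms step1 by (simp add: periodic1_def)
  next
    case (step2 k)
    have "a ((x + of_int (k - 1) *\<^sub>R axis i 1) + axis i 1) = a (x + of_int k *\<^sub>R axis i 1)"
      by (simp add: algebra_simps)
    then show ?case
      using assms step2 by (simp add: periodic1_def)
  qed
  have fin: "a (x + (\<Sum>i\<in>S. of_int (m $ i) *\<^sub>R axis i 1)) = a x" if "finite S" for S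
    using that
  proof induction
    case (insert i S)
    have "a (x + (\<Sum>i\<in>insert i S. of_int (m $ i) *\<^sub>R axis i 1)) =
        a ((x + (\<Sum>i\<in>S. of_int (m $ i) *\<^sub>R axis i 1)) + of_int (m $ i) *\<^sub>R axis i 1)"
      using insert.hyps by (simp add: algebra_simps)
    then show ?case
      using one insert.IH by simp
  qed simp
  have "int_vec m = (\<Sum>i\<in>UNIV. of_int (m $ i) *\<^sub>R axis i 1)"
    by (simp add: vec_eq_iff int_vec_def axis_def if_distrib[where f = "\<lambda>x. _ * x"] cong: if_cong)
  then show ?thesis
    using fin[of UNIV] by simp
qed

lemma measurable_vec_nth [measurable]:
  "(\<lambda>x. x $ i) \<in> borel_measurable (borel :: (real ^ 'd::finite) measure)"
  by (intro borel_measurable_continuous_onI continuous_intros)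

lemma measurable_half_open_cube [measurable]:
  "half_open_cube \<in> sets (borel :: (real ^ 'd::finite) measure)"
  unfolding half_open_cube_def by measurable

lemma mem_half_open_cube_diff_iff:
  "x - int_vec m \<in> half_open_cube \<longleftrightarrow> m = (\<chi> i. \<lfloor>x $ i\<rfloor>)"
proof -
  have "0 \<le> t - of_int k \<and> t - of_int k < 1 \<longleftrightarrow> k = \<lfloor>t\<rfloor>" for t :: real and k
    unfolding eq_commute[of k "\<lfloor>t\<rfloor>"] floor_eq_iff by auto
  then show ?thesis
    by (simp add: half_open_cube_def vec_eq_iff int_vec_def)
qed

lemma mem_half_open_cube_add_iff:
  "x + int_vec m \<in> half_open_cube \<longleftrightarrow> m = (\<chi> i. - \<lfloor>x $ i\<rfloor>)"
proof -
  have "x + int_vec m = x - int_vec (- m)"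
    by (simp add: int_vec_def vec_eq_iff)
  moreover have "- m = (\<chi> i. \<lfloor>x $ i\<rfloor>) \<longleftrightarrow> m = (\<chi> i. - \<lfloor>x $ i\<rfloor>)"
    by (simp add: vec_eq_iff) (metis minus_minus)
  ultimately show ?thesis
    using mem_half_open_cube_diff_iff[of x "- m"] by simp
qed

text \<open>The closed and the half-open cube differ only inside \<open>cbox 0 1 - box 0 1\<close>,
  a null set, so the passage is free for every \<open>h\<close>.\<close>

lemma nn_integral_cube:
  fixes h :: "real ^ 'd::finite \<Rightarrow> ennreal"
  shows "(\<integral>\<^sup>+x. h x \<partial>cube) = (\<integral>\<^sup>+x. h x * indicator half_open_cube x \<partial>lborel)"
proof -
  have "emeasure lborel (cbox 0 1 - box 0 1 :: (real ^ 'd) set) =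
      emeasure lborel (cbox 0 1 :: (real ^ 'd) set) - emeasure lborel (box 0 1 :: (real ^ 'd) set)"
    by (rule emeasure_Diff) (auto simp: emeasure_lborel_box_eq box_subset_cbox)
  also have "\<dots> = 0"
    by (simp add: emeasure_lborel_box_eq emeasure_lborel_cbox_eq)
  finally have "cbox 0 1 - box 0 1 \<in> null_sets (lborel :: (real ^ 'd) measure)"
    by auto
  then have "AE x in lborel. x \<notin> (cbox 0 1 - box 0 1 :: (real ^ 'd) set)"
    by (rule AE_not_in)
  then have "AE x in lborel. indicator (cbox 0 1) x = (indicator half_open_cube (x :: real ^ 'd) :: ennreal)"
    by (rule AE_mp) (auto intro!: AE_I2 simp: indicator_def half_open_cube_def mem_box_cart less_imp_le)
  then have "(\<integral>\<^sup>+x. h x * indicator (cbox 0 1) x \<partial>lborel) =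
      (\<integral>\<^sup>+x. h x * indicator half_open_cube x \<partial>lborel)"
    by (intro nn_integral_cong_AE) (auto elim: eventually_mono)
  then show ?thesis
    by (simp add: cube_def nn_integral_restrict_space)
qed

lemma nn_integral_lborel_translate:
  fixes h :: "'a::euclidean_space \<Rightarrow> ennreal"
  assumes "h \<in> borel_measurable borel"
  shows "(\<integral>\<^sup>+x. h (x + v) \<partial>lborel) = (\<integral>\<^sup>+x. h x \<partial>lborel)"
proof -
  have "(\<integral>\<^sup>+x. h x \<partial>lborel) = (\<integral>\<^sup>+x. h x \<partial>distr lborel borel ((+) v))"
    by (simp add: lborel_distr_plus)
  also have "\<dots> = (\<integral>\<^sup>+x. h (x + v) \<partial>lborel)"
    using assms by (simp add: nn_integral_distr add.commute)
  finally show ?thesis ..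
qed

text \<open>
  Both sides are cut into pieces by the tiling of the space with the integer translates of the
  half-open cube; each piece is moved back by its translation.
\<close>

lemma nn_integral_cube_shift:
  fixes h :: "real ^ 'd::finite \<Rightarrow> ennreal"
  assumes [measurable]: "h \<in> borel_measurable borel" and per: "\<And>x m. h (x + int_vec m) = h x"
  shows "(\<integral>\<^sup>+x. h (x + v) \<partial>cube) = (\<integral>\<^sup>+x. h x \<partial>cube)"
proof -
  let ?H = "indicator half_open_cube :: real ^ 'd \<Rightarrow> ennreal"
  have tile1: "(\<integral>\<^sup>+m. ?H (x + int_vec m) \<partial>count_space UNIV) = 1" for x :: "real ^ 'd"
  proof -
    have "(\<integral>\<^sup>+m. ?H (x + int_vec m) \<partial>count_space UNIV) =
        (\<integral>\<^sup>+m. indicator {\<chi> i. - \<lfloor>x $ i\<rfloor>} m \<partial>count_space UNIV)"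
      by (intro nn_integral_cong) (simp add: indicator_def mem_half_open_cube_add_iff)
    then show ?thesis by simp
  qed
  have tile2: "(\<integral>\<^sup>+m. ?H (x - int_vec m) \<partial>count_space UNIV) = 1" for x :: "real ^ 'd"
  proof -
    have "(\<integral>\<^sup>+m. ?H (x - int_vec m) \<partial>count_space UNIV) =
        (\<integral>\<^sup>+m. indicator {\<chi> i. \<lfloor>x $ i\<rfloor>} m \<partial>count_space UNIV)"
      by (intro nn_integral_cong) (simp add: indicator_def mem_half_open_cube_diff_iff)
    then show ?thesis by simp
  qed
  have per': "h (x - int_vec m) = h x" for x m
    using per[of "x - int_vec m" m] by simp
  have "(\<integral>\<^sup>+x. h (x + v) \<partial>cube) = (\<integral>\<^sup>+x. h (x + v) * ?H ((x + v) - v) \<partial>lborel)"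
    by (simp add: nn_integral_cube)
  also have "\<dots> = (\<integral>\<^sup>+x. h x * ?H (x - v) \<partial>lborel)"
    by (rule nn_integral_lborel_translate[where h = "\<lambda>x. h x * ?H (x - v)"]) measurable
  also have "\<dots> = (\<integral>\<^sup>+x. (\<integral>\<^sup>+m. h x * ?H (x - v) * ?H (x + int_vec m) \<partial>count_space UNIV) \<partial>lborel)"
    by (simp add: nn_integral_cmult tile1)
  also have "\<dots> = (\<integral>\<^sup>+m. (\<integral>\<^sup>+x. h x * ?H (x - v) * ?H (x + int_vec m) \<partial>lborel) \<partial>count_space UNIV)"
    by (rule nn_integral_count_space_nn_integral) measurable
  also have "\<dots> = (\<integral>\<^sup>+m. (\<integral>\<^sup>+x. h x * ?H x * ?H (x - v - int_vec m) \<partial>lborel) \<partial>count_space UNIV)"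
  proof (rule nn_integral_cong)
    fix m :: "int ^ 'd"
    have "(\<integral>\<^sup>+x. h x * ?H (x - v) * ?H (x + int_vec m) \<partial>lborel) =
        (\<integral>\<^sup>+x. h (x + int_vec m - int_vec m) * ?H ((x + int_vec m) - int_vec m - v) * ?H (x + int_vec m) \<partial>lborel)"
      by simp
    also have "\<dots> = (\<integral>\<^sup>+x. h (x - int_vec m) * ?H (x - int_vec m - v) * ?H x \<partial>lborel)"
      by (rule nn_integral_lborel_translate
          [where h = "\<lambda>x. h (x - int_vec m) * ?H (x - int_vec m - v) * ?H x"]) measurable
    finally show "(\<integral>\<^sup>+x. h x * ?H (x - v) * ?H (x + int_vec m) \<partial>lborel) =
        (\<integral>\<^sup>+x. h x * ?H x * ?H (x - v - int_vec m) \<partial>lborel)"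
      by (simp add: per' algebra_simps)
  qed
  also have "\<dots> = (\<integral>\<^sup>+x. (\<integral>\<^sup>+m. h x * ?H x * ?H (x - v - int_vec m) \<partial>count_space UNIV) \<partial>lborel)"
    by (rule nn_integral_count_space_nn_integral[symmetric]) measurable
  also have "\<dots> = (\<integral>\<^sup>+x. h x \<partial>cube)"
    by (simp add: nn_integral_cmult tile2 nn_integral_cube)
  finally show ?thesis .
qed

section \<open>Reflection of the cube in its centre\<close>

lemma measurable_cube_reflect:
  "(\<lambda>x. 1 - x) \<in> cube \<rightarrow>\<^sub>M (cube :: (real ^ 'd::finite) measure)"
  unfolding cube_def by (intro measurable_restrict_space3) (auto simp: mem_box_cart)

text \<open>The affine map \<open>1 - x\<close> preserves Lebesgue measure and maps the cube onto
  itself, so functions on the cube can be reflected without a periodic extension. This is what lets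
  the adjoint of a convolution be expressed by the same convolution.\<close>

lemma distr_cube_reflect:
  "distr cube cube (\<lambda>x. 1 - x) = (cube :: (real ^ 'd::finite) measure)"
proof (rule measure_eqI)
  fix A :: "(real ^ 'd) set"
  assume "A \<in> sets (distr cube cube (\<lambda>x. 1 - x))"
  then have A: "A \<in> sets borel" "A \<subseteq> cbox 0 1"
    by (auto simp: cube_def sets_restrict_space)
  have lb: "lborel = distr lborel borel (\<lambda>x :: real ^ 'd. 1 - x)"
    using lborel_affine[of "-1" "1 :: real ^ 'd"] by (simp add: density_1)
  have "emeasure (distr cube cube (\<lambda>x. 1 - x)) A = emeasure cube ((\<lambda>x. 1 - x) -` A \<inter> cbox 0 1)"
    using A by (subst emeasure_distr[OF measurable_cube_reflect]) (auto simp: cube_def sets_restrict_space)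
  also have "(\<lambda>x. 1 - x) -` A \<inter> cbox 0 1 = (\<lambda>x. 1 - x) -` A"
    using A(2) by (auto simp: mem_box_cart subset_eq)
  also have "emeasure cube ((\<lambda>x. 1 - x) -` A) = emeasure lborel ((\<lambda>x :: real ^ 'd. 1 - x) -` A)"
    unfolding cube_def using A(2)
    by (subst emeasure_restrict_space) (auto simp: mem_box_cart subset_eq)
  also have "\<dots> = emeasure (distr lborel borel (\<lambda>x :: real ^ 'd. 1 - x)) A"
    using A by (subst emeasure_distr) auto
  also have "\<dots> = emeasure cube A"
    using A by (simp add: lb[symmetric] cube_def emeasure_restrict_space)
  finally show "emeasure (distr cube cube (\<lambda>x. 1 - x)) A = emeasure cube A" .
qed simp

lemma integral_cube_reflect:
  fixes f :: "real ^ 'd::finite \<Rightarrow> real"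
  assumes "f \<in> borel_measurable cube"
  shows "(\<integral>x. f (1 - x) \<partial>cube) = (\<integral>x. f x \<partial>cube)"
  using integral_distr[OF measurable_cube_reflect assms] by (simp add: distr_cube_reflect)

lemma nn_integral_cube_reflect:
  fixes h :: "real ^ 'd::finite \<Rightarrow> ennreal"
  assumes "h \<in> borel_measurable cube"
  shows "(\<integral>\<^sup>+x. h (1 - x) \<partial>cube) = (\<integral>\<^sup>+x. h x \<partial>cube)"
  using nn_integral_distr[OF measurable_cube_reflect, of h] assms by (simp add: distr_cube_reflect)

lemma L2_reflect: "f \<in> L2 \<Longrightarrow> (\<lambda>x. f (1 - x)) \<in> L2"
  using integrable_distr_eq[OF measurable_cube_reflect, of "\<lambda>x. (f x)\<^sup>2"]
    measurable_compose[OF measurable_cube_reflect]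
  by (auto simp: L2_def distr_cube_reflect)

text \<open>Membership in \<open>L2\<close> only gives measurability on the cube. Periodicity writes
  \<open>a\<close> as its restriction to the cube composed with the coordinatewise fractional part,
  a Borel map into the cube.\<close>

lemma periodic1_measurable:
  fixes a :: "real ^ 'd::finite \<Rightarrow> real"
  assumes "periodic1 a" "a \<in> borel_measurable cube"
  shows "a \<in> borel_measurable borel"
proof -
  let ?r = "\<lambda>x :: real ^ 'd. x - int_vec (\<chi> i. \<lfloor>x $ i\<rfloor>)"
  have "?r = (\<lambda>x. \<chi> i. x $ i - of_int \<lfloor>x $ i\<rfloor>)"
    by (auto simp: int_vec_def vec_eq_iff)
  moreover have "(\<lambda>x :: real ^ 'd. \<chi> i. x $ i - of_int \<lfloor>x $ i\<rfloor>) \<in> borel_measurable borel"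
    by (subst borel_measurable_euclidean_space) (auto simp: Basis_vec_def inner_axis)
  ultimately have m: "?r \<in> borel_measurable borel"
    by simp
  have "?r \<in> borel \<rightarrow>\<^sub>M cube"
    unfolding cube_def
  proof (rule measurable_restrict_space2)
    show "?r \<in> borel \<rightarrow>\<^sub>M lborel"
      using m by simp
    have "?r x \<in> half_open_cube" for x
      by (simp add: mem_half_open_cube_diff_iff)
    then show "?r \<in> space borel \<rightarrow> cbox 0 1"
      by (auto simp: half_open_cube_def mem_box_cart less_imp_le)
  qed
  then have "(\<lambda>x. a (?r x)) \<in> borel_measurable borel"
    by (rule measurable_compose[OF _ assms(2)])
  moreover have "a (?r x) = a x" for x
    using periodic1_int_vec[OF assms(1), of "?r x" "\<chi> i. \<lfloor>x $ i\<rfloor>"] by simp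
  ultimately show ?thesis
    by simp
qed

section \<open>Integrals of products of one-variable functions\<close>

lemma integral_lborel_prod:
  fixes f :: "'a::euclidean_space \<Rightarrow> real \<Rightarrow> real"
  assumes "\<And>b. b \<in> Basis \<Longrightarrow> integrable lborel (f b)"
  shows "(\<integral>x. (\<Prod>b\<in>Basis. f b (x \<bullet> b)) \<partial>lborel) = (\<Prod>b\<in>Basis. \<integral>x. f b x \<partial>lborel)"
proof -
  interpret product_sigma_finite "\<lambda>_ :: 'a. lborel :: real measure"
    by standard
  have [measurable]: "f b \<in> borel_measurable borel" if "b \<in> Basis" for b
    using borel_measurable_integrable[OF assms[OF that]] by simp
  have "(\<integral>x. (\<Prod>b\<in>Basis. f b (x \<bullet> b)) \<partial>lborel) =
      (\<integral>x. (\<Prod>b\<in>Basis. f b ((\<Sum>b\<in>Basis. x b *\<^sub>R b) \<bullet> b)) \<partial>(\<Pi>\<^sub>M b\<in>Basis. lborel))"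
    by (subst lborel_eq, subst integral_distr) auto
  also have "\<dots> = (\<integral>x. (\<Prod>b\<in>Basis. f b (x b)) \<partial>(\<Pi>\<^sub>M b\<in>Basis. lborel))"
    by simp
  also have "\<dots> = (\<Prod>b\<in>Basis. \<integral>x. f b x \<partial>lborel)"
    using assms by (intro product_integral_prod) auto
  finally show ?thesis .
qed

lemma integral_cube_prod:
  fixes f :: "'d::finite \<Rightarrow> real \<Rightarrow> real"
  assumes "\<And>i. continuous_on UNIV (f i)"
  shows "(\<integral>x. (\<Prod>i\<in>UNIV. f i (x $ i)) \<partial>cube) = (\<Prod>i\<in>UNIV. \<integral>x. indicator {0..1} x * f i x \<partial>lborel)"
proof -
  let ?g = "\<lambda>i x. indicator {0..1} x * f i x"
  \<comment> \<open>The product measure is indexed by basis vectors, the functions by coordinates;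
    \<open>THE i. b = axis i 1\<close> translates the first index into the second.\<close>
  have B: "(\<Prod>b\<in>(Basis :: (real ^ 'd) set). F (THE i. b = axis i 1)) = (\<Prod>i\<in>UNIV. F i)" for F :: "'d \<Rightarrow> real"
  proof -
    have b: "(Basis :: (real ^ 'd) set) = (\<lambda>i. axis i 1) ` UNIV"
      by (auto simp: Basis_vec_def)
    have inj: "inj (\<lambda>i. axis i 1 :: real ^ 'd)"
      by (auto simp: inj_on_def axis_eq_axis)
    show ?thesis
      unfolding b by (subst prod.reindex[OF inj]) (simp add: axis_eq_axis)
  qed
  have "(\<integral>x. (\<Prod>i\<in>UNIV. f i (x $ i)) \<partial>cube) =
      (\<integral>x. indicator (cbox 0 1) x * (\<Prod>i\<in>UNIV. f i (x $ i)) \<partial>lborel)"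
    by (simp add: cube_def integral_restrict_space)
  also have "\<dots> = (\<integral>x. (\<Prod>i\<in>UNIV. ?g i (x $ i)) \<partial>lborel)"
  proof (intro Bochner_Integration.integral_cong refl)
    fix x :: "real ^ 'd"
    have "indicator (cbox 0 1) x = (\<Prod>i\<in>UNIV. indicator {0..1} (x $ i) :: real)"
      by (auto simp: indicator_def mem_box_cart)
    then show "indicator (cbox 0 1) x * (\<Prod>i\<in>UNIV. f i (x $ i)) = (\<Prod>i\<in>UNIV. ?g i (x $ i))"
      by (simp add: prod.distrib)
  qed
  also have "\<dots> = (\<integral>x. (\<Prod>b\<in>(Basis :: (real ^ 'd) set). ?g (THE i. b = axis i 1) (x \<bullet> b)) \<partial>lborel)"
  proof (intro Bochner_Integration.integral_cong refl)
    fix x :: "real ^ 'd"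
    have "(\<Prod>b\<in>(Basis :: (real ^ 'd) set). ?g (THE i. b = axis i 1) (x \<bullet> b)) =
       (\<Prod>b\<in>(Basis :: (real ^ 'd) set). ?g (THE i. b = axis i 1) (x $ (THE i. b = axis i 1)))"
      by (intro prod.cong refl) (auto simp: Basis_vec_def axis_eq_axis inner_axis)
    then show "(\<Prod>i\<in>UNIV. ?g i (x $ i)) = (\<Prod>b\<in>(Basis :: (real ^ 'd) set). ?g (THE i. b = axis i 1) (x \<bullet> b))"
      using B[of "\<lambda>i. ?g i (x $ i)"] by simp
  qed
  also have "\<dots> = (\<Prod>b\<in>(Basis :: (real ^ 'd) set). \<integral>x. ?g (THE i. b = axis i 1) x \<partial>lborel)"
  proof (intro integral_lborel_prod)
    fix b :: "real ^ 'd"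
    show "integrable lborel (?g (THE i. b = axis i 1))"
      using borel_integrable_atLeastAtMost'[of 0 1 "f (THE i. b = axis i 1)"] assms
      by (auto simp: set_integrable_def intro: continuous_on_subset)
  qed
  also have "\<dots> = (\<Prod>i\<in>UNIV. \<integral>x. ?g i x \<partial>lborel)"
    by (rule B[of "\<lambda>i. \<integral>x. ?g i x \<partial>lborel"])
  finally show ?thesis .
qed

section \<open>Orthogonality of the trigonometric basis\<close>

text \<open>A sine is a cosine with phase \<open>pi / 2\<close>. Treating both values of
  \<open>k $ i\<close> as one shifted cosine leaves a single product formula for all later
  computations.\<close>

lemma phi_eq_cos:
  assumes "k \<in> K j"
  shows "phi j k x = (\<Prod>i\<in>UNIV. sqrt 2 * cos (2 * pi * real (j $ i) * x $ i - real (k $ i) * (pi / 2)))"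
  unfolding phi_def
proof (rule prod.cong)
  fix i
  have "k $ i = 0 \<or> k $ i = 1"
    using assms by (auto simp: K_def)
  then show "sqrt 2 * ((1 - real (k $ i)) * cos (2 * pi * real (j $ i) * x $ i) +
        real (k $ i) * sin (2 * pi * real (j $ i) * x $ i)) =
      sqrt 2 * cos (2 * pi * real (j $ i) * x $ i - real (k $ i) * (pi / 2))"
    by (auto simp: cos_diff)
qed simp

lemma continuous_phi: "continuous_on UNIV (phi j k)"
  unfolding phi_def by (intro continuous_intros)

lemma phi_L2: "phi j k \<in> L2"
proof -
  obtain B where "\<And>x. x \<in> cbox 0 1 \<Longrightarrow> norm (phi j k x) \<le> B"
    using compact_imp_bounded[OF compact_continuous_image[OF
        continuous_on_subset[OF continuous_phi subset_UNIV] compact_cbox]]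
    unfolding bounded_iff by fast
  then show ?thesis
    by (intro L2_bounded[where B = B] measurable_cube borel_measurable_continuous_onI continuous_phi)
      auto
qed

lemma integral_cos_period:
  "(\<integral>x. indicator {0..1} x * cos (2 * pi * of_int m * x + t) \<partial>lborel) = (if m = 0 then cos t else 0)"
proof (cases "m = 0")
  case False
  have "(\<integral>x. cos (2 * pi * of_int m * x + t) * indicator {0..1} x \<partial>lborel) =
      sin (2 * pi * of_int m * 1 + t) / (2 * pi * of_int m) -
      sin (2 * pi * of_int m * 0 + t) / (2 * pi * of_int m)"
    using False
    by (intro integral_FTC_Icc_real) (auto intro!: derivative_eq_intros continuous_intros)
  then show ?thesis
    using False sin_int_2pin[of m] cos_int_2pin[of m] by (simp add: mult.commute sin_add mult.left_commute)
qed (simp add: mult.commute)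

text \<open>The product is a sum of two cosines with frequencies \<open>j - j'\<close> and
  \<open>j + j'\<close>. The first survives only for \<open>j = j'\<close>, with the value
  \<open>cos\<close> of \<open>0\<close> or of plus or minus \<open>pi / 2\<close>; the second
  survives only when both frequencies vanish, which produces the \<open>2\<close>.\<close>

lemma integral_trig_product:
  assumes "k \<le> 1" "k' \<le> 1" "j = 0 \<Longrightarrow> k = 0" "j' = 0 \<Longrightarrow> k' = 0"
  shows "(\<integral>x. indicator {0..1} x *
      ((sqrt 2 * cos (2 * pi * real j * x - real k * (pi / 2))) *
       (sqrt 2 * cos (2 * pi * real j' * x - real k' * (pi / 2)))) \<partial>lborel) =
    (if j = j' \<and> k = k' then (if j = 0 then 2 else 1) else 0)" (is "?I = _")
proof -
  let ?f = "\<lambda>m t x. indicator {0..1} x * cos (2 * pi * of_int m * x + t)"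
  have int: "integrable lborel (?f m t)" for m t
    using borel_integrable_atLeastAtMost'[of 0 1 "\<lambda>x. cos (2 * pi * of_int m * x + t)"]
    by (simp add: set_integrable_def continuous_intros)
  have "?I = (\<integral>x. ?f (int j - int j') ((real k' - real k) * (pi / 2)) x +
        ?f (int j + int j') (- (real k + real k') * (pi / 2)) x \<partial>lborel)"
  proof (intro Bochner_Integration.integral_cong refl)
    fix x :: real
    let ?a = "2 * pi * real j * x - real k * (pi / 2)" and ?b = "2 * pi * real j' * x - real k' * (pi / 2)"
    have "(sqrt 2 * cos ?a) * (sqrt 2 * cos ?b) = cos (?a - ?b) + cos (?a + ?b)"
    proof -
      have "(sqrt 2 * cos ?a) * (sqrt 2 * cos ?b) = (sqrt 2 * sqrt 2) * (cos ?a * cos ?b)"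
        by (simp only: ac_simps)
      also have "\<dots> = cos (?a - ?b) + cos (?a + ?b)"
        unfolding cos_times_cos[of ?a ?b] by simp
      finally show ?thesis .
    qed
    also have "?a - ?b = 2 * pi * of_int (int j - int j') * x + (real k' - real k) * (pi / 2)"
      by (simp add: field_simps)
    also have "?a + ?b = 2 * pi * of_int (int j + int j') * x + (- (real k + real k') * (pi / 2))"
      by (simp add: field_simps)
    finally show "indicator {0..1} x * ((sqrt 2 * cos ?a) * (sqrt 2 * cos ?b)) =
      ?f (int j - int j') ((real k' - real k) * (pi / 2)) x +
        ?f (int j + int j') (- (real k + real k') * (pi / 2)) x"
      by (simp only: distrib_left)
  qed
  also have "\<dots> = (if j = j' then cos ((real k' - real k) * (pi / 2)) else 0) +
      (if j = 0 \<and> j' = 0 then cos (- (real k + real k') * (pi / 2)) else 0)"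
    by (subst Bochner_Integration.integral_add[OF int int]) (simp only: integral_cos_period, simp)
  also have "\<dots> = (if j = j' \<and> k = k' then (if j = 0 then 2 else 1) else 0)"
  proof -
    have "k = 0 \<or> k = 1" "k' = 0 \<or> k' = 1"
      using assms by auto
    then show ?thesis
      using assms by auto
  qed
  finally show ?thesis .
qed

text \<open>By product integration one coordinate that differs annihilates the whole product. Each
  coordinate with \<open>j $ i = 0\<close> contributes \<open>2\<close>, the square of the constant
  function \<open>sqrt 2\<close>.\<close>

lemma phi_inner:
  fixes j j' :: "nat ^ 'd::finite"
  assumes "k \<in> K j" "k' \<in> K j'"
  shows "L2_inner (phi j k) (phi j' k') =
    (if j = j' \<and> k = k' then (\<Prod>i\<in>UNIV. if j $ i = 0 then 2 else 1) else 0)"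
proof -
  let ?c = "\<lambda>j k i t. sqrt 2 * cos (2 * pi * real (j $ i) * t - real (k $ i) * (pi / 2))"
  have "L2_inner (phi j k) (phi j' k') =
      (\<integral>x. (\<Prod>i\<in>UNIV. (\<lambda>t. ?c j k i t * ?c j' k' i t) (x $ i)) \<partial>cube)"
    unfolding L2_inner_def using assms by (simp add: phi_eq_cos prod.distrib)
  also have "\<dots> = (\<Prod>i\<in>UNIV. \<integral>x. indicator {0..1} x * (?c j k i x * ?c j' k' i x) \<partial>lborel)"
    by (rule integral_cube_prod) (intro continuous_intros)
  also have "\<dots> = (\<Prod>i\<in>UNIV. if j $ i = j' $ i \<and> k $ i = k' $ i then (if j $ i = 0 then 2 else 1) else 0)"
  proof (intro prod.cong refl)
    fix i
    have "k $ i \<in> {0, 1}" "j $ i = 0 \<Longrightarrow> k $ i = 0" "k' $ i \<in> {0, 1}" "j' $ i = 0 \<Longrightarrow> k' $ i = 0"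
      using assms by (auto simp: K_def)
    then show "(\<integral>x. indicator {0..1} x * (?c j k i x * ?c j' k' i x) \<partial>lborel) =
        (if j $ i = j' $ i \<and> k $ i = k' $ i then (if j $ i = 0 then 2 else 1) else 0)"
      by (intro integral_trig_product) auto
  qed
  also have "\<dots> = (if j = j' \<and> k = k' then (\<Prod>i\<in>UNIV. if j $ i = 0 then 2 else 1) else 0)"
  proof (cases "j = j' \<and> k = k'")
    case False
    then obtain i where "\<not> (j $ i = j' $ i \<and> k $ i = k' $ i)"
      by (auto simp: vec_eq_iff)
    then have "\<exists>i\<in>UNIV. (if j $ i = j' $ i \<and> k $ i = k' $ i then (if j $ i = 0 then 2 else 1) else 0) = (0::real)"
      by (intro bexI[of _ i]) auto
    then have "(\<Prod>i\<in>UNIV. if j $ i = j' $ i \<and> k $ i = k' $ i then (if j $ i = 0 then 2 else 1) else 0) = (0::real)"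
      by (subst prod_zero_iff) auto
    then show ?thesis
      using False by auto
  qed simp
  finally show ?thesis .
qed

section \<open>Completeness of the trigonometric basis\<close>

text \<open>The real trigonometric polynomials in amplitude and phase form: allowing every phase
  \<open>t\<close> covers sines, and closure under products is then one application of the addition
  theorem.\<close>

inductive_set trig_sums :: "(real ^ 'd::finite \<Rightarrow> real) set" where
  base: "(\<lambda>x. c * cos (2 * pi * (int_vec m \<bullet> x) + t)) \<in> trig_sums"
| add: "f \<in> trig_sums \<Longrightarrow> g \<in> trig_sums \<Longrightarrow> (\<lambda>x. f x + g x) \<in> trig_sums"

lemma trig_sums_mult_base:
  assumes "g \<in> trig_sums"
  shows "(\<lambda>x. c * cos (2 * pi * (int_vec m \<bullet> x) + t) * g x) \<in> trig_sums"
  using assms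
proof induction
  case (base c' m' t')
  have "(\<lambda>x. c * cos (2 * pi * (int_vec m \<bullet> x) + t) * (c' * cos (2 * pi * (int_vec m' \<bullet> x) + t'))) =
    (\<lambda>x. (c * c' / 2) * cos (2 * pi * (int_vec (m - m') \<bullet> x) + (t - t')) +
         (c * c' / 2) * cos (2 * pi * (int_vec (m + m') \<bullet> x) + (t + t')))"
  proof
    fix x
    have i: "int_vec (m - m') = int_vec m - int_vec m'" "int_vec (m + m') = int_vec m + int_vec m'"
      by (auto simp: int_vec_def vec_eq_iff)
    have "cos (2 * pi * (int_vec m \<bullet> x) + t) * cos (2 * pi * (int_vec m' \<bullet> x) + t') =
      (cos (2 * pi * (int_vec (m - m') \<bullet> x) + (t - t')) + cos (2 * pi * (int_vec (m + m') \<bullet> x) + (t + t'))) / 2"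
      by (subst cos_times_cos) (simp add: i inner_diff_left inner_add_left algebra_simps)
    then show "c * cos (2 * pi * (int_vec m \<bullet> x) + t) * (c' * cos (2 * pi * (int_vec m' \<bullet> x) + t')) =
      (c * c' / 2) * cos (2 * pi * (int_vec (m - m') \<bullet> x) + (t - t')) +
         (c * c' / 2) * cos (2 * pi * (int_vec (m + m') \<bullet> x) + (t + t'))"
      by (simp add: field_simps)
  qed
  then show ?case
    by (simp only:) (intro trig_sums.intros)
next
  case (add f g)
  then show ?case
    using trig_sums.add[OF add.IH] by (simp add: distrib_left)
qed

lemma trig_sums_mult: "f \<in> trig_sums \<Longrightarrow> g \<in> trig_sums \<Longrightarrow> (\<lambda>x. f x * g x) \<in> trig_sums"
proof (induction rule: trig_sums.induct)
  case (add f f')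
  then show ?case
    using trig_sums.add[OF add.IH(1)[OF add.prems] add.IH(2)[OF add.prems]] by (simp add: distrib_right)
qed (rule trig_sums_mult_base)

lemma trig_sums_const: "(\<lambda>x :: real ^ 'd::finite. c) \<in> trig_sums"
proof -
  have "int_vec 0 = (0 :: real ^ 'd)"
    by (simp add: int_vec_def vec_eq_iff)
  then show ?thesis
    using trig_sums.base[of c "0 :: int ^ 'd" 0] by simp
qed

lemma trig_sums_sum:
  "finite I \<Longrightarrow> (\<And>i. i \<in> I \<Longrightarrow> f i \<in> trig_sums) \<Longrightarrow> (\<lambda>x. \<Sum>i\<in>I. f i x) \<in> trig_sums"
  by (induction I rule: finite_induct) (auto intro: trig_sums_const trig_sums.add)

text \<open>The standard embedding of the torus in a Euclidean space. It glues opposite faces of the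
  cube, and polynomials in its coordinates are trigonometric sums, so polynomial approximation on
  its compact image applies.\<close>

definition torus_map :: "real ^ 'd::finite \<Rightarrow> (real ^ 'd) \<times> (real ^ 'd)" where
  "torus_map x = (\<chi> i. cos (2 * pi * x $ i), \<chi> i. sin (2 * pi * x $ i))"

lemma continuous_torus_map: "continuous_on S torus_map"
  unfolding torus_map_def by (intro continuous_intros continuous_on_vec_lambda)

lemma measurable_torus_map [measurable]:
  "torus_map \<in> borel_measurable (cube :: (real ^ 'd::finite) measure)"
  by (intro measurable_cube borel_measurable_continuous_onI continuous_torus_map)

lemma trig_sums_coordinate:
  "(\<lambda>x. cos (2 * pi * x $ i)) \<in> trig_sums" "(\<lambda>x. sin (2 * pi * x $ i)) \<in> trig_sums"
proof -
  have "int_vec (axis i 1) = axis i 1"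
    by (simp add: int_vec_def vec_eq_iff axis_def)
  then have "(\<lambda>x. cos (2 * pi * x $ i + t)) \<in> trig_sums" for t
    using trig_sums.base[of 1 "axis i 1" t] by (simp add: inner_axis')
  from this[of 0] this[of "- (pi / 2)"]
  show "(\<lambda>x. cos (2 * pi * x $ i)) \<in> trig_sums" "(\<lambda>x. sin (2 * pi * x $ i)) \<in> trig_sums"
    by (simp_all add: cos_diff)
qed

lemma trig_sums_polynomial:
  assumes "real_polynomial_function p"
  shows "(\<lambda>x. p (torus_map x)) \<in> trig_sums"
  using assms
proof induction
  case (linear f)
  then interpret bounded_linear f .
  have "(\<lambda>x. f (torus_map x)) = (\<lambda>x. \<Sum>b\<in>Basis. (torus_map x \<bullet> b) * f b)"
  proof
    fix x
    have "f (torus_map x) = f (\<Sum>b\<in>Basis. (torus_map x \<bullet> b) *\<^sub>R b)"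
      by (simp only: euclidean_representation)
    then show "f (torus_map x) = (\<Sum>b\<in>Basis. (torus_map x \<bullet> b) * f b)"
      by (simp only: sum scaleR) simp
  qed
  moreover have "(\<lambda>x. (torus_map x \<bullet> b) * f b) \<in> trig_sums" if "b \<in> Basis" for b
  proof (rule trig_sums_mult[OF _ trig_sums_const])
    show "(\<lambda>x. torus_map x \<bullet> b) \<in> trig_sums"
      using that trig_sums_coordinate
      by (auto simp: Basis_prod_def Basis_vec_def torus_map_def inner_axis)
  qed
  ultimately show ?case
    by (auto intro!: trig_sums_sum)
next
  case (add f g)
  then show ?case by (intro trig_sums.add)
qed (auto intro: trig_sums_const trig_sums_mult)

lemma L2_mult_bounded_integrable:
  assumes "u \<in> L2" "f \<in> borel_measurable cube" "\<And>x. x \<in> cbox 0 1 \<Longrightarrow> \<bar>f x\<bar> \<le> B"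
  shows "integrable cube (\<lambda>x. u x * f x)"
  using L2_mult_integrable[OF assms(1) L2_bounded[OF assms(2,3)]] .

lemma cos_product_L2:
  "(\<lambda>x. cos (2 * pi * (\<Sum>i\<in>I. of_int (m $ i) * x $ i) + t) *
      (\<Prod>i\<in>J. cos (2 * pi * real (n i) * x $ i - real (k i) * (pi / 2)))) \<in> L2"
proof (rule L2_bounded)
  show "(\<lambda>x. cos (2 * pi * (\<Sum>i\<in>I. of_int (m $ i) * x $ i) + t) *
      (\<Prod>i\<in>J. cos (2 * pi * real (n i) * x $ i - real (k i) * (pi / 2)))) \<in> borel_measurable cube"
    by (intro measurable_cube borel_measurable_continuous_onI continuous_intros)
  fix x :: "real ^ 'a"
  have "\<bar>\<Prod>i\<in>J. cos (2 * pi * real (n i) * x $ i - real (k i) * (pi / 2))\<bar> \<le> 1"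
    unfolding abs_prod by (rule prod_le_1) auto
  then show "\<bar>cos (2 * pi * (\<Sum>i\<in>I. of_int (m $ i) * x $ i) + t) *
      (\<Prod>i\<in>J. cos (2 * pi * real (n i) * x $ i - real (k i) * (pi / 2)))\<bar> \<le> 1"
    unfolding abs_mult by (intro mult_le_one) auto
qed

text \<open>
  The addition theorem is used in one coordinate after the other to turn
  \<open>cos (2 * pi * (int_vec m \<bullet> x) + t)\<close> into a sum of products.
\<close>

lemma orthogonal_cos_product:
  fixes u :: "real ^ 'd::finite \<Rightarrow> real" and m :: "int ^ 'd"
  assumes u: "u \<in> L2" and orth: "\<And>j k. k \<in> K j \<Longrightarrow> L2_inner u (phi j k) = 0"
    and "finite I"
  shows "(\<And>i. k i \<le> 1) \<Longrightarrow> L2_inner u (\<lambda>x. cos (2 * pi * (\<Sum>i\<in>I. of_int (m $ i) * x $ i) + t) *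
      (\<Prod>i\<in>- I. cos (2 * pi * real (nat \<bar>m $ i\<bar>) * x $ i - real (k i) * (pi / 2)))) = 0"
  using \<open>finite I\<close>
proof (induction I arbitrary: k t)
  case empty
  let ?j = "\<chi> i. nat \<bar>m $ i\<bar>" and ?k = "\<chi> i. k i"
  show ?case
  proof (cases "?k \<in> K ?j")
    case True
    have "(\<Prod>i\<in>UNIV. cos (2 * pi * real (nat \<bar>m $ i\<bar>) * x $ i - real (k i) * (pi / 2))) =
        inverse (sqrt 2 ^ CARD('d)) * phi ?j ?k x" for x
      using phi_eq_cos[OF True, of x] by (simp add: prod.distrib prod_constant field_simps)
    then show ?thesis
      using orth[OF True] by (simp add: L2_inner_cmult_right mult.assoc[symmetric])
  next
    case False
    then obtain i where "\<not> (k i \<in> {0, 1} \<and> (nat \<bar>m $ i\<bar> = 0 \<longrightarrow> k i = 0))"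
      by (auto simp: K_def)
    \<comment> \<open>A sine factor of frequency zero vanishes identically. Hence the induction may
      use all \<open>k\<close> with values in \<open>{0, 1}\<close>, even those outside
      \<open>K ?j\<close>.\<close>
    then have "k i = 1" "m $ i = 0"
      using empty.prems[of i] by auto
    then have zero: "(\<Prod>i\<in>UNIV. cos (2 * pi * real (nat \<bar>m $ i\<bar>) * x $ i - real (k i) * (pi / 2))) = 0" for x
      by (subst prod_zero_iff) (auto intro!: exI[of _ i])
    show ?thesis
      by (simp only: Compl_empty_eq zero) (simp add: L2_inner_def)
  qed
next
  case (insert a I)
  let ?F = "\<lambda>J k x. \<Prod>i\<in>J. cos (2 * pi * real (nat \<bar>m $ i\<bar>) * x $ i - real (k i) * (pi / 2))"
  let ?Y = "\<lambda>I t (x :: real ^ 'd). cos (2 * pi * (\<Sum>i\<in>I. of_int (m $ i) * x $ i) + t)"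
  have split: "- I = insert a (- insert a I)"
    using insert.hyps by auto
  have upd: "?F (- insert a I) (k(a := c)) x = ?F (- insert a I) k x" for c x
    by (rule prod.cong) auto
  have F: "?F (- I) (k(a := c)) x =
      cos (2 * pi * real (nat \<bar>m $ a\<bar>) * x $ a - real c * (pi / 2)) * ?F (- insert a I) k x" for c x
    unfolding split by (subst prod.insert) (auto simp: upd[symmetric])
  \<comment> \<open>Addition theorem in coordinate \<open>a\<close>, with \<open>- sin y\<close>
    written as \<open>cos (y + pi / 2)\<close> so that both terms have the form of the induction
    hypothesis; \<open>sgn\<close> repairs the sign lost by passing to
    \<open>nat \<bar>m $ a\<bar>\<close>.\<close>
  have eq: "?Y (insert a I) t x * ?F (- insert a I) k x =
      ?Y I t x * ?F (- I) (k(a := 0)) x +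
      of_int (sgn (m $ a)) * (?Y I (t + pi / 2) x * ?F (- I) (k(a := 1)) x)" for x
  proof -
    let ?y = "2 * pi * (\<Sum>i\<in>I. of_int (m $ i) * x $ i) + t" and ?z = "2 * pi * (of_int (m $ a) * x $ a)"
    have "?Y (insert a I) t x = cos (?y + ?z)"
      using insert.hyps by (simp add: algebra_simps)
    also have "\<dots> = cos ?y * cos ?z + cos (?y + pi / 2) * sin ?z"
      by (simp add: cos_add)
    also have "cos ?z = cos (2 * pi * real (nat \<bar>m $ a\<bar>) * x $ a)"
      by (cases "m $ a \<ge> 0") (auto simp: mult.assoc)
    also have "sin ?z = of_int (sgn (m $ a)) * sin (2 * pi * real (nat \<bar>m $ a\<bar>) * x $ a)"
      by (cases "m $ a" "0 :: int" rule: linorder_cases) (auto simp: mult.assoc)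
    finally show ?thesis
      unfolding F by (simp add: cos_diff algebra_simps)
  qed
  have "L2_inner u (\<lambda>x. ?Y I t x * ?F (- I) (k(a := 0)) x) = 0"
    "L2_inner u (\<lambda>x. ?Y I (t + pi / 2) x * ?F (- I) (k(a := 1)) x) = 0"
    by (rule insert.IH, use insert.prems in simp)+
  then show ?case
    unfolding eq L2_inner_add_right[OF cos_product_L2 L2_cmult[OF cos_product_L2] u] L2_inner_cmult_right
    by simp
qed

section \<open>From trigonometric sums to indicators of Borel sets\<close>

lemma orthogonal_trig_sums:
  assumes "g \<in> trig_sums" and u: "u \<in> L2" and orth: "\<And>j k. k \<in> K j \<Longrightarrow> L2_inner u (phi j k) = 0"
  shows "g \<in> L2 \<and> L2_inner u g = 0"
  using assms(1)
proof induction
  case (base c m t)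
  have "int_vec m \<bullet> x = (\<Sum>i\<in>UNIV. of_int (m $ i) * x $ i)" for x
    by (simp add: inner_vec_def int_vec_def)
  then show ?case
    using orthogonal_cos_product[OF u orth finite, where I = UNIV and k = "\<lambda>_. 0" and m = m and t = t]
      cos_product_L2[where I = UNIV and m = m and t = t and J = "{}"]
    by (auto simp: L2_inner_cmult_right intro: L2_cmult)
next
  case (add f g)
  then show ?case
    using u by (auto simp: L2_inner_add_right intro: L2_add)
qed

text \<open>Approximate \<open>F\<close> within \<open>e\<close> by a polynomial on the compact
  image of the cube. As \<open>u\<close> is orthogonal to the resulting trigonometric sum, the
  integral is at most \<open>e\<close> times the integral of \<open>\<bar>u\<bar>\<close>, for every
  \<open>e > 0\<close>.\<close>

lemma orthogonal_continuous:
  fixes u :: "real ^ 'd::finite \<Rightarrow> real"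
  assumes u: "u \<in> L2" and orth: "\<And>j k. k \<in> K j \<Longrightarrow> L2_inner u (phi j k) = 0"
    and F: "continuous_on UNIV F"
  shows "(\<integral>x. u x * F (torus_map x) \<partial>cube) = 0"
proof -
  let ?c = "\<integral>x. \<bar>u x\<bar> \<partial>cube"
  let ?S = "torus_map ` cbox 0 (1 :: real ^ 'd)"
  have comp: "compact ?S"
    by (intro compact_continuous_image continuous_torus_map compact_cbox)
  have mF: "(\<lambda>x. F (torus_map x)) \<in> borel_measurable cube"
    by (intro measurable_cube borel_measurable_continuous_onI
        continuous_on_compose2[OF F continuous_torus_map]) auto
  obtain B where "\<And>x. x \<in> cbox 0 1 \<Longrightarrow> \<bar>F (torus_map x)\<bar> \<le> B"
    using compact_imp_bounded[OF compact_continuous_image[OF continuous_on_subset[OF F subset_UNIV] comp]]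
    unfolding bounded_iff by auto
  then have FL2: "(\<lambda>x. F (torus_map x)) \<in> L2"
    by (rule L2_bounded[OF mF])
  have "\<bar>L2_inner u (\<lambda>x. F (torus_map x))\<bar> \<le> e * ?c" if "e > 0" for e
  proof -
    obtain p where p: "real_polynomial_function p" "\<And>z. z \<in> ?S \<Longrightarrow> \<bar>F z - p z\<bar> < e"
      using Stone_Weierstrass_real_polynomial_function[OF comp continuous_on_subset[OF F subset_UNIV] \<open>e > 0\<close>]
      by metis
    have pL2: "(\<lambda>x. p (torus_map x)) \<in> L2" and p0: "L2_inner u (\<lambda>x. p (torus_map x)) = 0"
      using orthogonal_trig_sums[OF trig_sums_polynomial[OF p(1)] u orth] by auto
    have "L2_inner u (\<lambda>x. F (torus_map x)) = L2_inner u (\<lambda>x. F (torus_map x) - p (torus_map x))"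
      using L2_inner_diff_right[OF FL2 pL2 u] p0 by simp
    also have "\<bar>\<dots>\<bar> \<le> (\<integral>x. \<bar>u x * (F (torus_map x) - p (torus_map x))\<bar> \<partial>cube)"
      unfolding L2_inner_def by (rule integral_abs_bound)
    also have "\<dots> \<le> (\<integral>x. e * \<bar>u x\<bar> \<partial>cube)"
    proof (rule integral_mono)
      show "integrable cube (\<lambda>x. \<bar>u x * (F (torus_map x) - p (torus_map x))\<bar>)"
        using L2_mult_integrable[OF u L2_diff[OF FL2 pL2]] by (rule integrable_abs)
      show "integrable cube (\<lambda>x. e * \<bar>u x\<bar>)"
        using L2_integrable[OF u] by auto
      fix x :: "real ^ 'd"
      assume "x \<in> space cube"
      then have "\<bar>F (torus_map x) - p (torus_map x)\<bar> \<le> e"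
        using p(2)[of "torus_map x"] by (auto simp: less_imp_le)
      then show "\<bar>u x * (F (torus_map x) - p (torus_map x))\<bar> \<le> e * \<bar>u x\<bar>"
        unfolding abs_mult by (subst mult.commute) (rule mult_right_mono; simp)
    qed
    finally show ?thesis by simp
  qed
  then have lim: "\<forall>\<^sub>F e in at_right 0. \<bar>L2_inner u (\<lambda>x. F (torus_map x))\<bar> \<le> e * ?c"
    by (auto simp: eventually_at_filter)
  have "((\<lambda>e. e * ?c) \<longlongrightarrow> 0 * ?c) (at_right 0)"
    by (intro tendsto_intros)
  then have "\<bar>L2_inner u (\<lambda>x. F (torus_map x))\<bar> \<le> 0 * ?c"
    by (rule tendsto_lowerbound[OF _ lim]) simp
  then show ?thesis
    by (simp add: L2_inner_def)
qed

text \<open>The indicator of a closed set is the pointwise limit of the continuous cutoffs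
  \<open>max 0 (1 - real n * infdist z C)\<close>; dominated convergence with majorant
  \<open>\<bar>u\<bar>\<close> passes to the limit.\<close>

lemma orthogonal_torus_closed:
  fixes u :: "real ^ 'd::finite \<Rightarrow> real"
  assumes u: "u \<in> L2" and orth: "\<And>j k. k \<in> K j \<Longrightarrow> L2_inner u (phi j k) = 0"
    and C: "closed C"
  shows "(\<integral>x. u x * indicator C (torus_map x) \<partial>cube) = 0"
\<comment> \<open>By convention \<open>infdist z {} = 0\<close>, so the cutoffs would converge to
  \<open>1\<close> instead of the indicator of the empty set.\<close>
proof (cases "C = {}")
  case False
  let ?F = "\<lambda>n z. max 0 (1 - real n * infdist z C)"
  have contF: "continuous_on UNIV (?F n)" for n
    by (intro continuous_intros)
  have [measurable]: "C \<in> sets borel"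
    using C by simp
  have [measurable]: "u \<in> borel_measurable cube"
    using u by (rule L2_measurable)
  have "(\<lambda>n. \<integral>x. u x * ?F n (torus_map x) \<partial>cube) \<longlonglongrightarrow> (\<integral>x. u x * indicator C (torus_map x) \<partial>cube)"
  proof (rule integral_dominated_convergence[where w = "\<lambda>x. \<bar>u x\<bar>"])
    show "integrable cube (\<lambda>x. \<bar>u x\<bar>)"
      using L2_integrable[OF u] by auto
    show "(\<lambda>x. u x * ?F n (torus_map x)) \<in> borel_measurable cube" for n
      using borel_measurable_continuous_onI[OF contF[of n]] by measurable
    have "\<bar>?F n z\<bar> \<le> 1" for n z
      by (auto simp: infdist_nonneg)
    then show "AE x in cube. norm (u x * ?F n (torus_map x)) \<le> \<bar>u x\<bar>" for n
      unfolding real_norm_def abs_mult by (intro AE_I2 mult_left_le) auto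
    have "(\<lambda>n. ?F n z) \<longlonglongrightarrow> indicator C z" for z
    proof (cases "z \<in> C")
      case False
      then have pos: "infdist z C > 0"
        using C \<open>C \<noteq> {}\<close> by (intro infdist_pos_not_in_closed)
      obtain N :: nat where "1 / infdist z C < real N"
        using reals_Archimedean2 by blast
      then have "1 < real N * infdist z C"
        using pos by (simp add: field_simps)
      have "?F n z = 0" if "n \<ge> N" for n
      proof -
        have "real N * infdist z C \<le> real n * infdist z C"
          using that pos by (intro mult_right_mono) auto
        then show ?thesis
          using \<open>1 < real N * infdist z C\<close> by linarith
      qed
      then show ?thesis
        using False by (intro tendsto_eventually eventually_sequentiallyI[of N]) auto
    qed simp
    then show "AE x in cube. (\<lambda>n. u x * ?F n (torus_map x)) \<longlonglongrightarrow> u x * indicator C (torus_map x)"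
      by (intro AE_I2 tendsto_mult tendsto_const)
  qed measurable
  moreover have "(\<integral>x. u x * ?F n (torus_map x) \<partial>cube) = 0" for n
    using orthogonal_continuous[OF u orth contF] .
  ultimately show ?thesis
    by (simp add: LIMSEQ_const_iff)
qed simp

lemma AE_half_open_cube: "AE x in cube. x \<in> (half_open_cube :: (real ^ 'd::finite) set)"
proof -
  have "(\<integral>\<^sup>+x. indicator (- half_open_cube) x \<partial>(cube :: (real ^ 'd) measure)) =
     (\<integral>\<^sup>+x. 0 \<partial>(lborel :: (real ^ 'd) measure))"
    unfolding nn_integral_cube by (rule nn_integral_cong) (simp add: indicator_def)
  then have "(\<integral>\<^sup>+x. indicator (- half_open_cube) x \<partial>(cube :: (real ^ 'd) measure)) = 0"
    by simp
  moreover have "indicator (- half_open_cube) \<in> borel_measurable (cube :: (real ^ 'd) measure)"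
    unfolding cube_def by (intro measurable_restrict_space1) measurable
  ultimately have "AE x in cube. indicator (- half_open_cube) (x :: real ^ 'd) = (0 :: ennreal)"
    using nn_integral_0_iff_AE[THEN iffD1] by blast
  then show ?thesis
    by (rule eventually_mono) (auto simp: indicator_def split: if_splits)
qed

lemma torus_map_inj:
  assumes "x \<in> half_open_cube" "y \<in> half_open_cube" "torus_map x = torus_map y"
  shows "x = y"
proof -
  have "x $ i = y $ i" for i
  proof -
    have "sin (2 * pi * x $ i) = sin (2 * pi * y $ i) \<and> cos (2 * pi * x $ i) = cos (2 * pi * y $ i)"
      using assms(3) by (simp add: torus_map_def vec_eq_iff)
    then obtain n :: int where "2 * pi * x $ i = 2 * pi * y $ i + 2 * pi * n"
      unfolding sin_cos_eq_iff by auto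
    then have "2 * pi * (x $ i) = 2 * pi * (y $ i + n)"
      by (simp add: algebra_simps)
    then have n: "x $ i = y $ i + n"
      by simp
    have "0 \<le> x $ i" "x $ i < 1" "0 \<le> y $ i" "y $ i < 1"
      using assms(1,2) by (auto simp: half_open_cube_def)
    then have "\<bar>real_of_int n\<bar> < 1"
      using n by linarith
    then have "n = 0"
      by linarith
    then show ?thesis
      using n by simp
  qed
  then show ?thesis
    by (simp add: vec_eq_iff)
qed

text \<open>Pulling back from the torus requires \<open>torus_map\<close> to be injective on the set
  and its image to be closed. Cutting \<open>D\<close> at \<open>1 - 1 / real (Suc n)\<close> in
  each coordinate gives compact sets inside the half-open cube, where both hold; they exhaust
  \<open>D\<close> up to a null set of the cube.\<close>

lemma orthogonal_closed:
  fixes u :: "real ^ 'd::finite \<Rightarrow> real"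
  assumes u: "u \<in> L2" and orth: "\<And>j k. k \<in> K j \<Longrightarrow> L2_inner u (phi j k) = 0"
    and D: "closed D"
  shows "(\<integral>x. u x * indicator D x \<partial>cube) = 0"
proof -
  let ?Q = "\<lambda>n. D \<inter> cbox 0 (\<chi> i. 1 - 1 / real (Suc n))"
  have Qsub: "?Q n \<subseteq> half_open_cube" for n
  proof -
    have "t \<le> 1 - 1 / real (Suc n) \<Longrightarrow> t < 1" for t
      by (erule order.strict_trans1) simp
    then show ?thesis
      by (auto simp: half_open_cube_def mem_box_cart)
  qed
  have [measurable]: "u \<in> borel_measurable cube"
    using u by (rule L2_measurable)
  have "(\<integral>x. u x * indicator (?Q n) x \<partial>cube) = 0" for n
  proof -
    have "compact (?Q n)"
      using D by (intro closed_Int_compact compact_cbox)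
    then have "closed (torus_map ` ?Q n)"
      by (intro compact_imp_closed compact_continuous_image continuous_torus_map)
    from orthogonal_torus_closed[OF u orth this]
    have "(\<integral>x. u x * indicator (torus_map ` ?Q n) (torus_map x) \<partial>cube) = 0" .
    moreover have "(\<integral>x. u x * indicator (torus_map ` ?Q n) (torus_map x) \<partial>cube) =
        (\<integral>x. u x * indicator (?Q n) x \<partial>cube)"
    proof (rule integral_cong_AE)
      have [measurable]: "torus_map ` ?Q n \<in> sets borel"
        using \<open>closed (torus_map ` ?Q n)\<close> by simp
      show "(\<lambda>x. u x * indicator (torus_map ` ?Q n) (torus_map x)) \<in> borel_measurable cube"
        by measurable
      show "(\<lambda>x. u x * indicator (?Q n) x) \<in> borel_measurable cube"
        using D by (intro borel_measurable_times measurable_cube_indicator) auto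
      show "AE x in cube. u x * indicator (torus_map ` ?Q n) (torus_map x) = u x * indicator (?Q n) x"
        using AE_half_open_cube
      proof (rule eventually_mono)
        fix x :: "real ^ 'd"
        assume "x \<in> half_open_cube"
        then have "torus_map x \<in> torus_map ` ?Q n \<longleftrightarrow> x \<in> ?Q n"
          using torus_map_inj Qsub by blast
        then show "u x * indicator (torus_map ` ?Q n) (torus_map x) = u x * indicator (?Q n) x"
          by (simp add: indicator_def)
      qed
    qed
    ultimately show ?thesis by simp
  qed
  moreover have "(\<lambda>n. \<integral>x. u x * indicator (?Q n) x \<partial>cube) \<longlonglongrightarrow> (\<integral>x. u x * indicator D x \<partial>cube)"
  proof (rule integral_dominated_convergence[where w = "\<lambda>x. \<bar>u x\<bar>"])
    show "integrable cube (\<lambda>x. \<bar>u x\<bar>)"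
      using L2_integrable[OF u] by auto
    show "(\<lambda>x. u x * indicator (?Q n) x) \<in> borel_measurable cube" for n
      using D by (intro borel_measurable_times measurable_cube_indicator) auto
    show "(\<lambda>x. u x * indicator D x) \<in> borel_measurable cube"
      using D by (intro borel_measurable_times measurable_cube_indicator) auto
    show "AE x in cube. norm (u x * indicator (?Q n) x) \<le> \<bar>u x\<bar>" for n
      by (auto simp: indicator_def)
    show "AE x in cube. (\<lambda>n. u x * indicator (?Q n) x) \<longlonglongrightarrow> u x * indicator D x"
      using AE_half_open_cube
    proof (rule eventually_mono)
      fix x :: "real ^ 'd"
      assume x: "x \<in> half_open_cube"
      have "\<forall>\<^sub>F n in sequentially. x $ i \<le> 1 - 1 / real (Suc n)" for i
      proof -
        have "(\<lambda>n. 1 - 1 / real (Suc n)) \<longlonglongrightarrow> 1 - 0"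
          by (intro tendsto_diff tendsto_const LIMSEQ_Suc lim_1_over_n)
        then have "\<forall>\<^sub>F n in sequentially. x $ i < 1 - 1 / real (Suc n)"
          using x by (intro order_tendstoD) (auto simp: half_open_cube_def)
        then show ?thesis
          by (rule eventually_mono) simp
      qed
      then have "\<forall>\<^sub>F n in sequentially. \<forall>i. x $ i \<le> 1 - 1 / real (Suc n)"
        by (rule eventually_all_finite)
      then have "\<forall>\<^sub>F n in sequentially. u x * indicator (?Q n) x = u x * indicator D x"
        by (rule eventually_mono) (use x in \<open>auto simp: indicator_def mem_box_cart half_open_cube_def\<close>)
      then show "(\<lambda>n. u x * indicator (?Q n) x) \<longlonglongrightarrow> u x * indicator D x"
        by (rule tendsto_eventually)
    qed
  qed
  ultimately show ?thesis
    by (simp add: LIMSEQ_const_iff)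
qed

text \<open>The sets with vanishing integral form a Dynkin system, and the closed sets are an
  intersection-stable generator of the Borel sets.\<close>

lemma orthogonal_borel:
  fixes u :: "real ^ 'd::finite \<Rightarrow> real"
  assumes u: "u \<in> L2" and orth: "\<And>j k. k \<in> K j \<Longrightarrow> L2_inner u (phi j k) = 0"
    and "A \<in> sets borel"
  shows "(\<integral>x. u x * indicator A x \<partial>cube) = 0"
proof -
  have int: "A \<in> sets borel \<Longrightarrow> integrable cube (\<lambda>x. u x * indicator A x)" for A
    by (rule L2_mult_bounded_integrable[OF u measurable_cube_indicator, where B = 1]) (auto simp: indicator_def)
  have gen: "sets (borel :: (real ^ 'd) measure) = sigma_sets UNIV (Collect closed)"
  proof (rule antisym)
    show "sets (borel :: (real ^ 'd) measure) \<subseteq> sigma_sets UNIV (Collect closed)"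
    proof -
      have "U \<in> sigma_sets UNIV (Collect closed)" if "open U" for U :: "(real ^ 'd) set"
        using sigma_sets.Compl[of "- U" UNIV "Collect closed"] that
        by (auto intro: sigma_sets.Basic simp: Compl_eq_Diff_UNIV[symmetric])
      then show ?thesis
        unfolding sets_borel by (intro sigma_sets_mono) auto
    qed
    show "sigma_sets UNIV (Collect closed) \<subseteq> sets (borel :: (real ^ 'd) measure)"
      by (rule sets.sigma_sets_subset') auto
  qed
  have "Int_stable (Collect closed :: (real ^ 'd) set set)" "Collect closed \<subseteq> Pow (UNIV :: (real ^ 'd) set)"
    and "A \<in> sigma_sets UNIV (Collect closed)"
    using \<open>A \<in> sets borel\<close> by (auto simp: Int_stable_def gen)
  then show ?thesis
  proof (induction rule: sigma_sets_induct_disjoint)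
    case (basic A)
    then show ?case
      using orthogonal_closed[OF u orth] by auto
  next
    case empty
    then show ?case by simp
  next
    case (compl A)
    have "A \<in> sets borel"
      using compl.hyps by (simp add: gen)
    then have "(\<integral>x. u x * indicator (UNIV - A) x \<partial>cube) =
        (\<integral>x. u x * indicator UNIV x \<partial>cube) - (\<integral>x. u x * indicator A x \<partial>cube)"
    proof -
      have "u x * indicator (UNIV - A) x = u x * indicator UNIV x - u x * indicator A x" for x
        by (simp add: indicator_def)
      then show ?thesis
        using int[of UNIV] int[OF \<open>A \<in> sets borel\<close>] by simp
    qed
    then show ?case
      using compl.IH orthogonal_closed[OF u orth, of UNIV] by simp
  next
    case (union A)
    then have A: "A i \<in> sets borel" for i
      by (auto simp: gen)
    have "(\<integral>x. u x * indicator (\<Union>i. A i) x \<partial>cube) = (\<Sum>i. \<integral>x. u x * indicator (A i) x \<partial>cube)"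
    proof -
      have "(\<lambda>n. \<integral>x. u x * indicator (\<Union>i<n. A i) x \<partial>cube) \<longlonglongrightarrow> (\<integral>x. u x * indicator (\<Union>i. A i) x \<partial>cube)"
      proof (rule integral_dominated_convergence[where w = "\<lambda>x. \<bar>u x\<bar>"])
        show "integrable cube (\<lambda>x. \<bar>u x\<bar>)"
          using L2_integrable[OF u] by auto
        show "(\<lambda>x. u x * indicator (\<Union>i<n. A i) x) \<in> borel_measurable cube" for n
          using int[of "\<Union>i<n. A i"] A by auto
        show "(\<lambda>x. u x * indicator (\<Union>i. A i) x) \<in> borel_measurable cube"
          using int[of "\<Union>i. A i"] A by auto
        show "AE x in cube. norm (u x * indicator (\<Union>i<n. A i) x) \<le> \<bar>u x\<bar>" for n
          by (auto simp: indicator_def)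
        show "AE x in cube. (\<lambda>n. u x * indicator (\<Union>i<n. A i) x) \<longlonglongrightarrow> u x * indicator (\<Union>i. A i) x"
          by (intro AE_I2 tendsto_mult tendsto_const LIMSEQ_indicator_UN)
      qed
      moreover have "(\<integral>x. u x * indicator (\<Union>i<n. A i) x \<partial>cube) = (\<Sum>i<n. \<integral>x. u x * indicator (A i) x \<partial>cube)" for n
      proof -
        have "indicator (\<Union>i<n. A i) x = (\<Sum>i<n. indicator (A i) x :: real)" for x
          using union.hyps(1) by (intro indicator_UN_disjoint) (auto intro: disjoint_family_on_mono)
        then have "(\<integral>x. u x * indicator (\<Union>i<n. A i) x \<partial>cube) =
            (\<integral>x. (\<Sum>i<n. u x * indicator (A i) x) \<partial>cube)"
          by (simp only: sum_distrib_left)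
        also have "\<dots> = (\<Sum>i<n. \<integral>x. u x * indicator (A i) x \<partial>cube)"
          using int[OF A] by (rule Bochner_Integration.integral_sum)
        finally show ?thesis .
      qed
      ultimately show ?thesis
        using union.IH by (simp add: LIMSEQ_const_iff)
    qed
    then show ?case
      using union.IH by simp
  qed
qed

text \<open>The integral of \<open>u\<close> over the set where it is positive is zero, so the
  positive part vanishes almost everywhere; the same applies to \<open>- u\<close>.\<close>

lemma phi_complete:
  fixes u :: "real ^ 'd::finite \<Rightarrow> real"
  assumes u: "u \<in> L2" and orth: "\<And>j k. k \<in> K j \<Longrightarrow> L2_inner u (phi j k) = 0"
  shows "AE x in cube. u x = 0"
proof -
  have le: "AE x in cube. v x \<le> 0" if v: "v \<in> L2" and zero: "\<And>A. A \<in> sets borel \<Longrightarrow> (\<integral>x. v x * indicator A x \<partial>cube) = 0"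
    for v :: "real ^ 'd \<Rightarrow> real"
  proof -
    let ?A = "{x \<in> cbox 0 1. v x > 0}"
    have "{x \<in> space cube. v x > 0} \<in> sets cube"
      using L2_measurable[OF v] by measurable
    then have A: "?A \<in> sets borel"
      by (auto simp: cube_def sets_restrict_space)
    have "integrable cube (\<lambda>x. v x * indicator ?A x)"
      by (rule L2_mult_bounded_integrable[OF v measurable_cube_indicator[OF A], where B = 1]) (auto simp: indicator_def)
    then have "AE x in cube. v x * indicator ?A x = 0"
      using zero[OF A] by (subst integral_nonneg_eq_0_iff_AE[symmetric]) (auto simp: indicator_def)
    then show ?thesis
      using AE_space by eventually_elim (auto simp: indicator_def not_less split: if_splits)
  qed
  have "AE x in cube. u x \<le> 0"
    using le[OF u orthogonal_borel[OF u orth]] .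
  moreover have "AE x in cube. - u x \<le> 0"
    using le[of "\<lambda>x. - u x"] L2_cmult[OF u, of "-1"] orthogonal_borel[OF u orth] by simp
  ultimately show ?thesis
    by eventually_elim simp
qed

section \<open>The convolution operator\<close>

text \<open>The map from \<open>y\<close> to \<open>x - y\<close> is the reflection of the cube
  followed by the translation by \<open>x - 1\<close>, and a periodic integrand absorbs the
  translation.\<close>

lemma nn_integral_periodic_slice:
  fixes h :: "real ^ 'd::finite \<Rightarrow> ennreal"
  assumes h: "h \<in> borel_measurable borel" "\<And>x m. h (x + int_vec m) = h x"
  shows "(\<integral>\<^sup>+y. h (x - y) \<partial>cube) = (\<integral>\<^sup>+y. h y \<partial>cube)"
    and "(\<integral>\<^sup>+y. h (y - x) \<partial>cube) = (\<integral>\<^sup>+y. h y \<partial>cube)"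
proof -
  have "(\<lambda>y. h (y + (x - 1))) \<in> borel_measurable cube"
    using h(1) by (intro measurable_cube) simp
  from nn_integral_cube_reflect[OF this] nn_integral_cube_shift[OF h, of "x - 1"]
  show "(\<integral>\<^sup>+y. h (x - y) \<partial>cube) = (\<integral>\<^sup>+y. h y \<partial>cube)"
    by simp
  show "(\<integral>\<^sup>+y. h (y - x) \<partial>cube) = (\<integral>\<^sup>+y. h y \<partial>cube)"
    using nn_integral_cube_shift[OF h, of "- x"] by simp
qed

locale periodic_filter =
  fixes a :: "real ^ 'd::finite \<Rightarrow> real"
  assumes periodic: "periodic1 a" and L2: "a \<in> L2"
begin

lemma measurable_filter [measurable]: "a \<in> borel_measurable borel"
  using periodic L2_measurable[OF L2] by (rule periodic1_measurable)

lemma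
  shows L2_slice_left: "(\<lambda>y. a (x - y)) \<in> L2"
    and L2_slice_right: "(\<lambda>y. a (y - x)) \<in> L2"
    and L2_inner_slice: "L2_inner (\<lambda>y. a (x - y)) (\<lambda>y. a (x - y)) = L2_inner a a"
proof -
  let ?h = "\<lambda>z. ennreal ((a z)\<^sup>2)"
  have h: "?h \<in> borel_measurable borel" "\<And>x m. ?h (x + int_vec m) = ?h x"
    using periodic1_int_vec[OF periodic] by auto
  have fin: "(\<integral>\<^sup>+y. ?h y \<partial>cube) < \<infinity>"
    using L2 by (simp add: L2_def nn_integral_eq_integral)
  have m: "(\<lambda>y. a (x - y)) \<in> borel_measurable cube" "(\<lambda>y. a (y - x)) \<in> borel_measurable cube"
    by (intro measurable_cube; measurable)+
  show "(\<lambda>y. a (x - y)) \<in> L2" "(\<lambda>y. a (y - x)) \<in> L2"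
    using nn_integral_periodic_slice[OF h, of x] fin m by (auto simp: L2_def integrable_iff_bounded)
  show "L2_inner (\<lambda>y. a (x - y)) (\<lambda>y. a (x - y)) = L2_inner a a"
    unfolding L2_inner_def power2_eq_square[symmetric]
    using nn_integral_periodic_slice(1)[OF h, of x] m L2_measurable[OF L2]
    by (simp add: integral_eq_nn_integral)
qed

lemma integrable_conv: "f \<in> L2 \<Longrightarrow> integrable cube (\<lambda>y. a (x - y) * f y)"
  by (rule L2_mult_integrable[OF L2_slice_left])

text \<open>Pointwise \<open>2 * \<bar>p * r\<bar> \<le> p\<^sup>2 + r\<^sup>2\<close> takes the
  place of the Cauchy-Schwarz inequality; all that matters is that the bound does not depend on
  \<open>x\<close>.\<close>

lemma conv_bound:
  assumes f: "f \<in> L2"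
  shows "\<bar>conv a f x\<bar> \<le> (L2_inner a a + L2_inner f f) / 2"
proof -
  have "\<bar>conv a f x\<bar> \<le> (\<integral>y. \<bar>a (x - y) * f y\<bar> \<partial>cube)"
    unfolding conv_def by (rule integral_abs_bound)
  also have "\<dots> \<le> (\<integral>y. (a (x - y) * a (x - y) + f y * f y) / 2 \<partial>cube)"
  proof (rule integral_mono)
    show "integrable cube (\<lambda>y. \<bar>a (x - y) * f y\<bar>)"
      using integrable_conv[OF f] by (rule integrable_abs)
    show "integrable cube (\<lambda>y. (a (x - y) * a (x - y) + f y * f y) / 2)"
      using L2_mult_integrable[OF L2_slice_left L2_slice_left] L2_mult_integrable[OF f f] by auto
    show "\<bar>a (x - y) * f y\<bar> \<le> (a (x - y) * a (x - y) + f y * f y) / 2" for y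
      using sum_squares_bound[of "\<bar>a (x - y)\<bar>" "\<bar>f y\<bar>"]
      by (simp add: abs_mult power2_eq_square)
  qed
  also have "\<dots> = (L2_inner (\<lambda>y. a (x - y)) (\<lambda>y. a (x - y)) + L2_inner f f) / 2"
    using L2_mult_integrable[OF L2_slice_left L2_slice_left, of x x] L2_mult_integrable[OF f f]
    by (simp add: L2_inner_def)
  finally show ?thesis
    by (simp add: L2_inner_slice)
qed

lemma measurable_conv_kernel:
  assumes "f \<in> borel_measurable cube"
  shows "(\<lambda>(x, y). a (x - y) * f y) \<in> borel_measurable (cube \<Otimes>\<^sub>M cube)"
proof -
  have id: "(\<lambda>x. x) \<in> borel_measurable (cube :: (real ^ 'd) measure)"
    by (rule measurable_cube) simp
  note [measurable] = measurable_compose[OF measurable_fst id] measurable_compose[OF measurable_snd id]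
  have "(\<lambda>p. a (fst p - snd p)) \<in> borel_measurable (cube \<Otimes>\<^sub>M cube)"
    by measurable
  moreover have "(\<lambda>p. f (snd p)) \<in> borel_measurable (cube \<Otimes>\<^sub>M cube)"
    by (rule measurable_compose[OF measurable_snd assms])
  ultimately show ?thesis
    unfolding case_prod_beta by (rule borel_measurable_times)
qed

lemma conv_L2: "f \<in> L2 \<Longrightarrow> conv a f \<in> L2"
proof (rule L2_bounded[OF _ conv_bound])
  assume "f \<in> L2"
  then show "conv a f \<in> borel_measurable cube"
    using cube.borel_measurable_lebesgue_integral[OF measurable_conv_kernel[OF L2_measurable[of f]]]
    by (simp add: conv_def[abs_def])
qed

lemma conv_cmult: "conv a (\<lambda>x. c * f x) x = c * conv a f x"
  by (simp add: conv_def mult.left_commute[of _ c])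

lemma conv_sum:
  "(\<And>i. i \<in> I \<Longrightarrow> f i \<in> L2) \<Longrightarrow> conv a (\<lambda>x. \<Sum>i\<in>I. f i x) x = (\<Sum>i\<in>I. conv a (f i) x)"
  by (simp add: conv_def sum_distrib_left integrable_conv)

text \<open>After exchanging the integrals the kernel is \<open>a (x - y)\<close> integrated over
  \<open>x\<close>. Substituting \<open>1 - x\<close> for \<open>x\<close> turns its argument into
  \<open>(1 - y) - x\<close>, so the adjoint is the convolution conjugated by the
  reflection.\<close>

lemma conv_adjoint:
  assumes f: "f \<in> L2" and u: "u \<in> L2"
  shows "L2_inner (conv a f) u = L2_inner f (\<lambda>y. conv a (\<lambda>x. u (1 - x)) (1 - y))"
proof -
  interpret pair_sigma_finite "cube :: (real ^ 'd) measure" "cube :: (real ^ 'd) measure" ..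
  \<comment> \<open>Absolute integrability of the double integrand is the statement that the
    convolution of \<open>\<bar>a\<bar>\<close> with \<open>\<bar>f\<bar>\<close> lies in
    \<open>L2\<close>, so the locale is instantiated a second time.\<close>
  interpret abs: periodic_filter "\<lambda>x. \<bar>a x\<bar>"
    using periodic L2 by unfold_locales (auto simp: periodic1_def L2_def)
  let ?F = "\<lambda>(x, y). a (x - y) * f y * u x"
  have [measurable]: "f \<in> borel_measurable cube" "u \<in> borel_measurable cube"
    using f u by (auto simp: L2_measurable)
  have F: "integrable (cube \<Otimes>\<^sub>M cube) ?F"
  proof (rule Fubini_integrable)
    show "?F \<in> borel_measurable (cube \<Otimes>\<^sub>M cube)"
    proof -
      have "(\<lambda>p. u (fst p)) \<in> borel_measurable (cube \<Otimes>\<^sub>M (cube :: (real ^ 'd) measure))"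
        by measurable
      then show ?thesis
        using measurable_conv_kernel[OF L2_measurable[OF f]] unfolding case_prod_beta
        by (rule borel_measurable_times[rotated])
    qed
    have "(\<lambda>x. \<integral>y. norm (?F (x, y)) \<partial>cube) = (\<lambda>x. conv (\<lambda>x. \<bar>a x\<bar>) (\<lambda>y. \<bar>f y\<bar>) x * \<bar>u x\<bar>)"
      by (simp add: conv_def abs_mult)
    moreover have "(\<lambda>y. \<bar>f y\<bar>) \<in> L2" "(\<lambda>y. \<bar>u y\<bar>) \<in> L2"
      using f u by (auto simp: L2_def)
    ultimately show "integrable cube (\<lambda>x. \<integral>y. norm (?F (x, y)) \<partial>cube)"
      using L2_mult_integrable[OF abs.conv_L2] by simp
    show "AE x in cube. integrable cube (\<lambda>y. ?F (x, y))"
      using integrable_conv[OF f] by auto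
  qed
  have "L2_inner (conv a f) u = (\<integral>x. (\<integral>y. a (x - y) * f y * u x \<partial>cube) \<partial>cube)"
    by (simp add: L2_inner_def conv_def)
  also have "\<dots> = (\<integral>y. (\<integral>x. a (x - y) * f y * u x \<partial>cube) \<partial>cube)"
    using Fubini_integral[OF F] by simp
  also have "\<dots> = (\<integral>y. f y * (\<integral>x. a (x - y) * u x \<partial>cube) \<partial>cube)"
    by (simp add: mult.assoc mult.left_commute[of _ "f _"])
  also have "(\<lambda>y. \<integral>x. a (x - y) * u x \<partial>cube) = (\<lambda>y. conv a (\<lambda>x. u (1 - x)) (1 - y))"
  proof
    fix y
    have "(\<lambda>x. a (x - y) * u x) \<in> borel_measurable cube"
      using L2_measurable[OF L2_slice_right[of y]] by measurable
    from integral_cube_reflect[OF this]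
    show "(\<integral>x. a (x - y) * u x \<partial>cube) = conv a (\<lambda>x. u (1 - x)) (1 - y)"
      by (simp add: conv_def algebra_simps)
  qed
  finally show ?thesis
    by (simp add: L2_inner_def)
qed

end

lemma L2_norm_reflect: "f \<in> L2 \<Longrightarrow> L2_inner (\<lambda>x. f (1 - x)) (\<lambda>x. f (1 - x)) = L2_inner f f"
  unfolding L2_inner_def
  using integral_cube_reflect[of "\<lambda>x. f x * f x"] L2_measurable[of f] by simp

lemma L2_inner_self_eq_0_iff: "f \<in> L2 \<Longrightarrow> L2_inner f f = 0 \<longleftrightarrow> (AE x in cube. f x = 0)"
  using L2_norm_eq_0_iff[of f] by (simp add: L2_norm_def)

section \<open>Finite sums of basis functions\<close>

definition phi_sum ::
  "((nat ^ 'd::finite) \<times> (nat ^ 'd)) set \<Rightarrow> ((nat ^ 'd) \<times> (nat ^ 'd) \<Rightarrow> real) \<Rightarrow> real ^ 'd \<Rightarrow> real" where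
  "phi_sum S c x = (\<Sum>p\<in>S. c p * phi (fst p) (snd p) x)"

lemma phi_sum_L2: "phi_sum S c \<in> L2"
  unfolding phi_sum_def by (intro L2_sum L2_cmult phi_L2)

lemma L2_inner_phi_sum: "u \<in> L2 \<Longrightarrow> L2_inner u (phi_sum S c) = (\<Sum>p\<in>S. c p * L2_inner u (phi (fst p) (snd p)))"
  unfolding phi_sum_def by (simp add: L2_inner_sum_right L2_cmult phi_L2 L2_inner_cmult_right)

lemma phi_sum_inner_phi:
  assumes "finite S" "S \<subseteq> jk_index" "p \<in> S"
  shows "L2_inner (phi_sum S c) (phi (fst p) (snd p)) = c p * L2_inner (phi (fst p) (snd p)) (phi (fst p) (snd p))"
proof -
  have z: "L2_inner (phi (fst p) (snd p)) (phi (fst p') (snd p')) = 0" if "p' \<in> S" "p' \<noteq> p" for p'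
    using that assms by (subst phi_inner) (auto simp: jk_index_def prod_eq_iff)
  have "L2_inner (phi_sum S c) (phi (fst p) (snd p)) =
      (\<Sum>p'\<in>S. c p' * L2_inner (phi (fst p) (snd p)) (phi (fst p') (snd p')))"
    by (subst L2_inner_commute) (rule L2_inner_phi_sum[OF phi_L2])
  also have "\<dots> = (\<Sum>p'\<in>{p}. c p' * L2_inner (phi (fst p) (snd p)) (phi (fst p') (snd p')))"
    using assms z by (intro sum.mono_neutral_right) auto
  finally show ?thesis by simp
qed

lemma phi_sum_inner:
  assumes "finite S" "S \<subseteq> jk_index"
  shows "L2_inner (phi_sum S c) (phi_sum S c') =
    (\<Sum>p\<in>S. c p * c' p * L2_inner (phi (fst p) (snd p)) (phi (fst p) (snd p)))"
  unfolding L2_inner_phi_sum[OF phi_sum_L2] using assms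
  by (intro sum.cong refl) (simp add: phi_sum_inner_phi mult.assoc mult.left_commute)

lemma phi_sum_diff: "phi_sum S c x - phi_sum S c' x = phi_sum S (\<lambda>p. c p - c' p) x"
  by (simp add: phi_sum_def sum_subtractf left_diff_distrib)

lemma finite_vec_box:
  fixes A :: "'i::finite \<Rightarrow> 'a set"
  assumes "\<And>i. finite (A i)"
  shows "finite {v :: 'a ^ 'i. \<forall>i. v $ i \<in> A i}"
    and "card {v :: 'a ^ 'i. \<forall>i. v $ i \<in> A i} = (\<Prod>i\<in>UNIV. card (A i))"
proof -
  have eq: "{v :: 'a ^ 'i. \<forall>i. v $ i \<in> A i} = vec_lambda ` (PiE UNIV A)"
  proof (intro set_eqI iffI)
    fix v :: "'a ^ 'i"
    assume "v \<in> {v. \<forall>i. v $ i \<in> A i}"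
    then show "v \<in> vec_lambda ` (PiE UNIV A)"
      by (intro image_eqI[of _ _ "vec_nth v"]) auto
  qed auto
  have "finite (PiE UNIV A)"
    using assms by (intro finite_PiE) auto
  then show "finite {v :: 'a ^ 'i. \<forall>i. v $ i \<in> A i}"
    unfolding eq by (rule finite_imageI)
  have "inj_on vec_lambda (PiE UNIV A)"
    by (auto simp: inj_on_def vec_lambda_inject)
  then show "card {v :: 'a ^ 'i. \<forall>i. v $ i \<in> A i} = (\<Prod>i\<in>UNIV. card (A i))"
    unfolding eq by (simp add: card_image card_PiE)
qed

definition low_freq :: "nat \<Rightarrow> ((nat ^ 'd::finite) \<times> (nat ^ 'd)) set" where
  "low_freq M = (SIGMA j:{j. \<forall>i. j $ i \<le> M}. K j)"

lemma finite_K: "finite (K j)"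
proof -
  have "K j \<subseteq> {k. \<forall>i. k $ i \<in> {0, 1}}"
    by (auto simp: K_def)
  then show ?thesis
    by (rule finite_subset) (rule finite_vec_box, simp)
qed

lemma finite_low_freq: "finite (low_freq M :: ((nat ^ 'd::finite) \<times> (nat ^ 'd)) set)"
  using finite_vec_box(1)[of "\<lambda>_ :: 'd. {..M}"] by (auto simp: low_freq_def finite_K)

lemma low_freq_subset: "low_freq M \<subseteq> jk_index"
  by (auto simp: low_freq_def jk_index_def)

lemma trig_poly_eq_phi_sum: "trig_poly M \<theta> = phi_sum (low_freq M) (\<lambda>p. \<theta> (fst p) (snd p))"
proof
  fix x :: "real ^ 'a"
  have "finite {j :: nat ^ 'a. \<forall>i. j $ i \<le> M}"
    using finite_vec_box(1)[of "\<lambda>_ :: 'a. {..M}"] by simp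
  then show "trig_poly M \<theta> x = phi_sum (low_freq M) (\<lambda>p. \<theta> (fst p) (snd p)) x"
    by (simp add: trig_poly_def phi_sum_def low_freq_def sum.Sigma finite_K case_prod_beta)
qed

section \<open>The adjoint of the inverse\<close>

locale singular_filter = periodic_filter a for a :: "real ^ 'd::finite \<Rightarrow> real" +
  fixes \<beta> :: "nat ^ 'd \<Rightarrow> nat ^ 'd \<Rightarrow> real"
  assumes singular: "\<And>j k. k \<in> K j \<Longrightarrow>
      (conv a (phi j k), \<lambda>x. (\<beta> j k)\<^sup>2 * phi j k x) \<in> op_adjoint (op_graph (conv a))"
    and beta_pos: "\<And>j k. k \<in> K j \<Longrightarrow> 0 < \<beta> j k"
begin

lemma conv_inner_phi:
  assumes "f \<in> L2" "k \<in> K j"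
  shows "L2_inner (conv a f) (conv a (phi j k)) = (\<beta> j k)\<^sup>2 * L2_inner f (phi j k)"
  using singular[OF assms(2)] assms(1)
  by (auto simp: op_adjoint_def op_graph_def L2_inner_cmult_right)

lemma conv_phi_sum: "conv a (phi_sum S c) x = (\<Sum>p\<in>S. c p * conv a (phi (fst p) (snd p)) x)"
  unfolding phi_sum_def by (subst conv_sum) (auto simp: conv_cmult intro: L2_cmult phi_L2)

lemma conv_inner_phi_sum:
  assumes f: "f \<in> L2" and S: "S \<subseteq> jk_index"
  shows "L2_inner (conv a f) (conv a (phi_sum S c)) =
    (\<Sum>p\<in>S. c p * (\<beta> (fst p) (snd p))\<^sup>2 * L2_inner f (phi (fst p) (snd p)))"
proof -
  have "L2_inner (conv a f) (conv a (phi_sum S c)) =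
      (\<Sum>p\<in>S. c p * L2_inner (conv a f) (conv a (phi (fst p) (snd p))))"
    unfolding conv_phi_sum
    by (subst L2_inner_sum_right) (auto simp: L2_inner_cmult_right intro!: L2_cmult conv_L2 phi_L2 f)
  then show ?thesis
    using S by (auto intro!: sum.cong simp: conv_inner_phi[OF f] jk_index_def)
qed

text \<open>Write \<open>v\<close> for the adjoint applied to \<open>u\<close>. Testing the
  hypothesis with \<open>f = v\<close> gives that \<open>v\<close> has norm zero, hence
  \<open>conv a\<close> kills the reflection of \<open>u\<close>. Pairing with
  \<open>conv a (phi j k)\<close> multiplies the coefficients of that reflection by
  \<open>(\<beta> j k)\<^sup>2 > 0\<close>, so they all vanish and completeness applies.\<close>

lemma conv_range_dense:
  assumes u: "u \<in> L2" and orth: "\<And>f. f \<in> L2 \<Longrightarrow> L2_inner (conv a f) u = 0"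
  shows "AE x in cube. u x = 0"
proof -
  let ?r = "\<lambda>x. u (1 - x)"
  let ?v = "\<lambda>y. conv a ?r (1 - y)"
  have r: "?r \<in> L2"
    using u by (rule L2_reflect)
  have "?v \<in> L2"
    using conv_L2[OF r] by (rule L2_reflect)
  then have "L2_inner ?v ?v = 0"
    using conv_adjoint[of ?v u] u orth[of ?v] by simp
  then have "L2_inner (conv a ?r) (conv a ?r) = 0"
    using L2_norm_reflect[OF conv_L2[OF r]] by simp
  then have "AE x in cube. conv a ?r x = 0"
    using conv_L2[OF r] by (simp add: L2_inner_self_eq_0_iff)
  then have "L2_inner (conv a ?r) (conv a (phi j k)) = 0" for j k
    by (rule L2_inner_AE_zero) (auto intro: conv_L2 phi_L2 r)
  then have "L2_inner ?r (phi j k) = 0" if "k \<in> K j" for j k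
    using conv_inner_phi[OF r that] beta_pos[OF that] by simp
  then have "AE x in cube. ?r x = 0"
    by (intro phi_complete r)
  then have "L2_inner u u = 0"
    using L2_norm_reflect[OF u] L2_inner_self_eq_0_iff[OF r] by simp
  then show ?thesis
    using L2_inner_self_eq_0_iff[OF u] by simp
qed

text \<open>\<open>inv_adjoint\<close> is a choice, so its defining property needs a witness. It is
  \<open>conv a ?f0\<close>, because pairing with \<open>conv a (phi j k)\<close> multiplies by
  \<open>(\<beta> j k)\<^sup>2\<close>, which the coefficients of \<open>?f0\<close> divide
  out.\<close>

lemma inv_adjoint_phi_sum:
  assumes S: "S \<subseteq> jk_index"
  shows "inv_adjoint (conv a) (phi_sum S c) \<in> L2"
    and "f \<in> L2 \<Longrightarrow> L2_inner (conv a f) (inv_adjoint (conv a) (phi_sum S c)) = L2_inner f (phi_sum S c)"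
proof -
  let ?f0 = "phi_sum S (\<lambda>p. c p / (\<beta> (fst p) (snd p))\<^sup>2)"
  have "L2_inner (conv a f) (conv a ?f0) = L2_inner f (phi_sum S c)" if "f \<in> L2" for f
  proof -
    have "\<beta> (fst p) (snd p) \<noteq> 0" if "p \<in> S" for p
      using S that beta_pos[of "snd p" "fst p"] by (auto simp: jk_index_def)
    then show ?thesis
      using that S by (auto simp: conv_inner_phi_sum L2_inner_phi_sum intro!: sum.cong)
  qed
  then have "(phi_sum S c, conv a ?f0) \<in> op_adjoint ((op_graph (conv a))\<inverse>)"
    by (auto simp: op_adjoint_def op_graph_def phi_sum_L2 conv_L2)
  then have "(phi_sum S c, inv_adjoint (conv a) (phi_sum S c)) \<in> op_adjoint ((op_graph (conv a))\<inverse>)"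
    unfolding inv_adjoint_def by (rule someI[where P = "\<lambda>h. (phi_sum S c, h) \<in> op_adjoint ((op_graph (conv a))\<inverse>)"])
  then show "inv_adjoint (conv a) (phi_sum S c) \<in> L2"
    and "f \<in> L2 \<Longrightarrow> L2_inner (conv a f) (inv_adjoint (conv a) (phi_sum S c)) = L2_inner f (phi_sum S c)"
    by (auto simp: op_adjoint_def op_graph_def dest!: bspec[where x = "(conv a f, f)"])
qed

text \<open>
  By the density of the range the choice made by \<open>inv_adjoint\<close> is unique up to null sets, so that
  it can be replaced by the image under \<open>conv a\<close> of the function with coefficients divided
  by \<open>(\<beta> j k)\<^sup>2\<close>.
\<close>

lemma inv_adjoint_norm_diff:
  assumes S: "finite S" "S \<subseteq> jk_index" and \<kappa>: "\<And>p. p \<in> S \<Longrightarrow> 1 \<le> \<kappa> * (\<beta> (fst p) (snd p))\<^sup>2"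
  shows "(L2_norm (\<lambda>x. inv_adjoint (conv a) (phi_sum S c) x - inv_adjoint (conv a) (phi_sum S c') x))\<^sup>2
    \<le> \<kappa> * (L2_norm (\<lambda>x. phi_sum S c x - phi_sum S c' x))\<^sup>2"
proof -
  let ?Q = "\<lambda>c. inv_adjoint (conv a) (phi_sum S c)"
  let ?D = "\<lambda>x. ?Q c x - ?Q c' x"
  let ?d = "\<lambda>p. c p - c' p"
  let ?b = "\<lambda>p. (\<beta> (fst p) (snd p))\<^sup>2"
  let ?n = "\<lambda>p. L2_inner (phi (fst p) (snd p)) (phi (fst p) (snd p))"
  let ?f0 = "phi_sum S (\<lambda>p. ?d p / ?b p)"
  have bpos: "?b p > 0" if "p \<in> S" for p
    using S(2) that beta_pos[of "snd p" "fst p"] by (auto simp: jk_index_def)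
  note Q = inv_adjoint_phi_sum[OF S(2)]
  have D: "?D \<in> L2"
    by (intro L2_diff Q)
  have Dinner: "L2_inner (conv a f) ?D = L2_inner f (phi_sum S ?d)" if "f \<in> L2" for f
    using Q that unfolding phi_sum_diff[symmetric]
    by (simp add: L2_inner_diff_right conv_L2 phi_sum_L2)
  have f0inner: "L2_inner (conv a f) (conv a ?f0) = L2_inner f (phi_sum S ?d)" if "f \<in> L2" for f
    unfolding conv_inner_phi_sum[OF that S(2)] L2_inner_phi_sum[OF that]
    using bpos by (intro sum.cong refl) (auto simp: less_le)
  have f0L2: "conv a ?f0 \<in> L2"
    by (intro conv_L2 phi_sum_L2)
  let ?u = "\<lambda>x. ?D x - conv a ?f0 x"
  have u: "?u \<in> L2"
    by (rule L2_diff[OF D f0L2])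
  have "AE x in cube. ?u x = 0"
    using Dinner f0inner by (intro conv_range_dense[OF u]) (simp add: L2_inner_diff_right[OF D f0L2 conv_L2])
  then have "L2_inner ?u ?D = 0"
    by (rule L2_inner_AE_zero[OF _ D u])
  \<comment> \<open>Only one factor is replaced: the adjoint identity evaluates the other, and the
    squared norm becomes diagonal with weights \<open>1 / ?b p\<close>, each at most
    \<open>\<kappa>\<close>.\<close>
  then have "L2_inner ?D ?D = L2_inner (conv a ?f0) ?D"
    using L2_inner_diff_left[OF D f0L2 D] by simp
  also have "\<dots> = L2_inner ?f0 (phi_sum S ?d)"
    by (rule Dinner[OF phi_sum_L2])
  also have "\<dots> = (\<Sum>p\<in>S. ?d p / ?b p * ?d p * ?n p)"
    using S by (simp add: phi_sum_inner)
  also have "\<dots> \<le> (\<Sum>p\<in>S. \<kappa> * (?d p * ?d p * ?n p))"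
  proof (rule sum_mono)
    fix p assume p: "p \<in> S"
    have "1 / ?b p \<le> \<kappa>"
      using \<kappa>[OF p] bpos[OF p] by (simp add: field_simps)
    then have "1 / ?b p * (?d p * ?d p * ?n p) \<le> \<kappa> * (?d p * ?d p * ?n p)"
      by (rule mult_right_mono) (simp add: L2_inner_self_nonneg)
    then show "?d p / ?b p * ?d p * ?n p \<le> \<kappa> * (?d p * ?d p * ?n p)"
      by simp
  qed
  also have "\<dots> = \<kappa> * L2_inner (phi_sum S ?d) (phi_sum S ?d)"
    using S by (simp add: phi_sum_inner sum_distrib_left)
  finally show ?thesis
    by (simp add: L2_norm_square phi_sum_diff)
qed

end

section \<open>Uniqueness of characteristic functions\<close>

lemma (in finite_measure) integrable_bounded_real:
  fixes f :: "'a \<Rightarrow> real"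
  assumes "f \<in> borel_measurable M" "\<And>x. \<bar>f x\<bar> \<le> B"
  shows "integrable M f"
  using assms by (intro integrable_const_bound[where B = B]) auto

text \<open>Phases \<open>0\<close> and \<open>- (pi / 2)\<close> give the real and the imaginary
  part of the characteristic function, and \<open>t = \<eta> = 0\<close> gives the total mass.
  Levy's theorem needs probability measures, so both are normalised, which leaves the case of mass
  zero apart.\<close>

lemma finite_measure_eqI_cos:
  fixes M1 M2 :: "real measure"
  assumes "finite_measure M1" "finite_measure M2"
    and [simp]: "sets M1 = sets borel" "sets M2 = sets borel"
    and eq: "\<And>t \<eta>. (\<integral>x. cos (t * x + \<eta>) \<partial>M1) = (\<integral>x. cos (t * x + \<eta>) \<partial>M2)"
  shows "M1 = M2"
proof -
  interpret M1: finite_measure M1 by fact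
  interpret M2: finite_measure M2 by fact
  have sp [simp]: "space M1 = UNIV" "space M2 = UNIV"
    using sets_eq_imp_space_eq[of M1 borel] sets_eq_imp_space_eq[of M2 borel] by auto
  have meas [simp]: "borel_measurable M1 = borel_measurable borel" "borel_measurable M2 = borel_measurable borel"
    by (auto intro!: measurable_cong_sets)
  let ?m = "measure M1 UNIV"
  have m2: "measure M2 UNIV = ?m"
    using eq[of 0 0] by simp
  show ?thesis
  proof (cases "?m = 0")
    case True
    show ?thesis
    proof (rule measure_eqI)
      fix A
      have "emeasure M1 A \<le> emeasure M1 UNIV" "emeasure M2 A \<le> emeasure M2 UNIV"
        using emeasure_space[of M1 A] emeasure_space[of M2 A] by auto
      then show "emeasure M1 A = emeasure M2 A"
        using True m2 M1.emeasure_eq_measure[of UNIV] M2.emeasure_eq_measure[of UNIV] by simp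
    qed simp
  next
    case False
    then have m: "?m > 0"
      by (simp add: less_le)
    let ?N = "\<lambda>M :: real measure. density M (\<lambda>_. ennreal (1 / ?m))"
    have dist: "real_distribution (?N M)"
      if "finite_measure M" "sets M = sets borel" "measure M UNIV = ?m" for M
    proof -
      interpret finite_measure M by fact
      have "space M = UNIV"
        using sets_eq_imp_space_eq[OF that(2)] by simp
      then have "emeasure (?N M) (space (?N M)) = ennreal (1 / ?m) * ennreal ?m"
        using that(3) emeasure_eq_measure[of UNIV] sets.top[of M]
        by (simp add: emeasure_density_const)
      also have "\<dots> = 1"
        using m by (simp flip: ennreal_mult)
      finally show ?thesis
        using that(2) by (auto simp: real_distribution_def real_distribution_axioms_def intro: prob_spaceI)
    qed
    have char: "char (?N M) t = complex_of_real (1 / ?m) *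
        Complex (\<integral>x. cos (t * x + 0) \<partial>M) (\<integral>x. cos (t * x + (- (pi / 2))) \<partial>M)"
      if "finite_measure M" "sets M = sets borel" for M t
    proof -
      interpret finite_measure M by fact
      have [measurable_cong]: "sets M = sets borel" by fact
      have int: "integrable M (\<lambda>x. iexp (t * x))"
        by (intro integrable_const_bound[where B = 1]) auto
      have "char (?N M) t = complex_of_real (1 / ?m) * (CLINT x|M. iexp (t * x))"
        unfolding char_def by (subst integral_density) (auto simp: scaleR_conv_of_real)
      moreover have "Re (CLINT x|M. iexp (t * x)) = (\<integral>x. cos (t * x + 0) \<partial>M)"
        using int by (subst integral_Re[symmetric]) (auto simp: Re_exp)
      moreover have "Im (CLINT x|M. iexp (t * x)) = (\<integral>x. cos (t * x + (- (pi / 2))) \<partial>M)"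
        using int by (subst integral_Im[symmetric]) (auto simp: Im_exp cos_add cos_diff)
      ultimately show ?thesis
        by (metis complex_surj)
    qed
    have "char (?N M1) = char (?N M2)"
      by (rule ext) (simp only: char[OF assms(1,3)] char[OF assms(2,4)] eq)
    then have N: "?N M1 = ?N M2"
      using m2 assms(1,2) by (intro Levy_uniqueness dist) auto
    have "emeasure (?N M1) A = emeasure (?N M2) A" for A
      by (simp only: N)
    then have "ennreal (1 / ?m) * emeasure M1 A = ennreal (1 / ?m) * emeasure M2 A" if "A \<in> sets borel" for A
      using that by (metis emeasure_density_const assms(3,4))
    then show ?thesis
      using m by (intro measure_eqI) (auto simp: ennreal_mult_cancel_left)
  qed
qed

lemma integral_distr_density:
  fixes g :: "real \<Rightarrow> real"
  assumes [measurable]: "X \<in> borel_measurable P" "w \<in> borel_measurable P" "g \<in> borel_measurable borel"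
    and w: "\<And>\<omega>. 0 \<le> w \<omega>"
  shows "(\<integral>x. g x \<partial>distr (density P (\<lambda>\<omega>. ennreal (w \<omega>))) borel X) = (\<integral>\<omega>. w \<omega> * g (X \<omega>) \<partial>P)"
  by (subst integral_distr, simp, simp, subst integral_density) (auto simp: w)

lemma finite_measure_distr_density:
  assumes P: "finite_measure P" and [measurable]: "X \<in> borel_measurable P" "w \<in> borel_measurable P"
    and w: "\<And>\<omega>. 0 \<le> w \<omega>" "\<And>\<omega>. w \<omega> \<le> B"
  shows "finite_measure (distr (density P (\<lambda>\<omega>. ennreal (w \<omega>))) borel X)"
proof -
  interpret finite_measure P by fact
  have "integrable P w"
    using w by (intro integrable_bounded_real[where B = B]) (auto simp: abs_le_iff intro: order_trans[OF _ w(1)])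
  then have "(\<integral>\<^sup>+\<omega>. ennreal (w \<omega>) \<partial>P) < \<infinity>"
    using w(1) by (simp add: nn_integral_eq_integral)
  then show ?thesis
    by (intro finite_measure.finite_measure_distr finite_measureI) (auto simp: emeasure_density cong: nn_integral_cong_simp)
qed

text \<open>
  The joint law of finitely many variables is treated one variable at a time: weighting with the
  nonnegative function \<open>1 + cos (Y + \<eta>)\<close>, where \<open>Y\<close> is a linear combination of the other variables,
  reduces the claim for the new variable to the one-dimensional uniqueness theorem.
\<close>

lemma measure_eqI_cos:
  fixes X1 :: "'i \<Rightarrow> 'a \<Rightarrow> real" and X2 :: "'i \<Rightarrow> 'b \<Rightarrow> real"
  assumes "finite I" "finite_measure P1" "finite_measure P2"
    and "\<And>i. i \<in> I \<Longrightarrow> X1 i \<in> borel_measurable P1" "\<And>i. i \<in> I \<Longrightarrow> X2 i \<in> borel_measurable P2"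
    and "\<And>i. i \<in> I \<Longrightarrow> B i \<in> sets borel"
    and "\<And>t \<eta>. (\<integral>\<omega>. cos ((\<Sum>i\<in>I. t i * X1 i \<omega>) + \<eta>) \<partial>P1) = (\<integral>\<omega>. cos ((\<Sum>i\<in>I. t i * X2 i \<omega>) + \<eta>) \<partial>P2)"
  shows "emeasure P1 {\<omega> \<in> space P1. \<forall>i\<in>I. X1 i \<omega> \<in> B i} = emeasure P2 {\<omega> \<in> space P2. \<forall>i\<in>I. X2 i \<omega> \<in> B i}"
  using assms
\<comment> \<open>The measures vary because the induction hypothesis is applied to their
  restrictions to the event that the new variable lies in \<open>B a\<close>; these are finite but
  in general no longer of the same mass.\<close>
proof (induction I arbitrary: P1 P2)
  case empty
  interpret P1: finite_measure P1 by fact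
  interpret P2: finite_measure P2 by fact
  show ?case
    using empty.prems(6)[of _ 0] by (simp add: P1.emeasure_eq_measure P2.emeasure_eq_measure)
next
  case (insert a I)
  define Y1 where "Y1 t \<omega> = (\<Sum>i\<in>I. t i * X1 i \<omega>)" for t :: "'i \<Rightarrow> real" and \<omega>
  define Y2 where "Y2 t \<omega> = (\<Sum>i\<in>I. t i * X2 i \<omega>)" for t :: "'i \<Rightarrow> real" and \<omega>
  note fin = insert.prems(1,2)
  have meas: "X1 a \<in> borel_measurable P1" "X2 a \<in> borel_measurable P2" "B a \<in> sets borel"
    using insert.prems(3-5) by auto
  have Ymeas: "Y1 t \<in> borel_measurable P1" "Y2 t \<in> borel_measurable P2" for t
    using insert.prems(3,4) by (auto simp: Y1_def[abs_def] Y2_def[abs_def])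
  note [measurable] = meas Ymeas
  have cos_eq: "(\<integral>\<omega>. cos (Y1 t \<omega> + s * X1 a \<omega> + \<eta>) \<partial>P1) = (\<integral>\<omega>. cos (Y2 t \<omega> + s * X2 a \<omega> + \<eta>) \<partial>P2)" for t s \<eta>
  proof -
    have "(\<Sum>i\<in>insert a I. (t(a := s)) i * Z i) = (\<Sum>i\<in>I. t i * Z i) + s * Z a" for Z :: "'i \<Rightarrow> real"
    proof -
      have "(\<Sum>i\<in>I. (t(a := s)) i * Z i) = (\<Sum>i\<in>I. t i * Z i)"
        using insert.hyps by (intro sum.cong) auto
      then show ?thesis
        using insert.hyps by simp
    qed
    then show ?thesis
      using insert.prems(6)[of "t(a := s)" \<eta>] by (simp only: Y1_def Y2_def)
  qed
  have cos0: "(\<integral>\<omega>. cos (s * X1 a \<omega> + \<eta>) \<partial>P1) = (\<integral>\<omega>. cos (s * X2 a \<omega> + \<eta>) \<partial>P2)" for s \<eta>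
    using cos_eq[of "\<lambda>_. 0" s \<eta>] by (simp add: Y1_def Y2_def)
  let ?w1 = "\<lambda>t \<eta> \<omega>. 1 + cos (Y1 t \<omega> + \<eta>)" and ?w2 = "\<lambda>t \<eta> \<omega>. 1 + cos (Y2 t \<omega> + \<eta>)"
  have w: "0 \<le> 1 + cos (y :: real)" "1 + cos (y :: real) \<le> 2" for y
    using cos_ge_minus_one[of y] cos_le_one[of y] by linarith+
  let ?M1 = "\<lambda>t \<eta>. distr (density P1 (\<lambda>\<omega>. ennreal (?w1 t \<eta> \<omega>))) borel (X1 a)"
  let ?M2 = "\<lambda>t \<eta>. distr (density P2 (\<lambda>\<omega>. ennreal (?w2 t \<eta> \<omega>))) borel (X2 a)"
  \<comment> \<open>The addition theorem turns the weighted cosine into cosines of linear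
    combinations of all variables, which are the only integrals known to agree.\<close>
  have expand: "(\<integral>\<omega>. (1 + cos (Y \<omega> + \<eta>)) * cos (s * X \<omega> + \<zeta>) \<partial>P) =
      (\<integral>\<omega>. cos (s * X \<omega> + \<zeta>) \<partial>P) + (\<integral>\<omega>. cos (Y \<omega> + (- s) * X \<omega> + (\<eta> - \<zeta>)) \<partial>P) / 2 +
      (\<integral>\<omega>. cos (Y \<omega> + s * X \<omega> + (\<eta> + \<zeta>)) \<partial>P) / 2"
    if "finite_measure P" and [measurable]: "X \<in> borel_measurable P" "Y \<in> borel_measurable P" for P :: "'c measure" and X Y :: "'c \<Rightarrow> real" and s \<zeta> \<eta>
  proof -
    interpret finite_measure P by fact
    have int: "integrable P (\<lambda>\<omega>. cos (f \<omega>))" if "f \<in> borel_measurable P" for f :: "'c \<Rightarrow> real"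
      using that by (intro integrable_bounded_real[where B = 1]) auto
    have "(1 + cos (Y \<omega> + \<eta>)) * cos (s * X \<omega> + \<zeta>) =
      cos (s * X \<omega> + \<zeta>) + cos (Y \<omega> + (- s) * X \<omega> + (\<eta> - \<zeta>)) / 2 + cos (Y \<omega> + s * X \<omega> + (\<eta> + \<zeta>)) / 2" for \<omega>
      using cos_times_cos[of "Y \<omega> + \<eta>" "s * X \<omega> + \<zeta>"] by (simp add: algebra_simps add_divide_distrib)
    then show ?thesis
      by (simp add: int)
  qed
  have M: "?M1 t \<eta> = ?M2 t \<eta>" for t \<eta>
  proof (rule finite_measure_eqI_cos)
    show "finite_measure (?M1 t \<eta>)" "finite_measure (?M2 t \<eta>)"
      using w fin by (intro finite_measure_distr_density[where B = 2]; simp)+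
    fix s \<zeta> :: real
    have "(\<integral>x. cos (s * x + \<zeta>) \<partial>?M1 t \<eta>) = (\<integral>\<omega>. ?w1 t \<eta> \<omega> * cos (s * X1 a \<omega> + \<zeta>) \<partial>P1)"
      using w by (intro integral_distr_density) simp_all
    also have "\<dots> = (\<integral>\<omega>. ?w2 t \<eta> \<omega> * cos (s * X2 a \<omega> + \<zeta>) \<partial>P2)"
      by (simp only: expand fin meas Ymeas cos_eq cos0)
    also have "\<dots> = (\<integral>x. cos (s * x + \<zeta>) \<partial>?M2 t \<eta>)"
      using w by (intro integral_distr_density[symmetric]) simp_all
    finally show "(\<integral>x. cos (s * x + \<zeta>) \<partial>?M1 t \<eta>) = (\<integral>x. cos (s * x + \<zeta>) \<partial>?M2 t \<eta>)" .
  qed simp_all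
  let ?b = "indicator (B a) :: real \<Rightarrow> real"
  have b: "(\<integral>\<omega>. ?w1 t \<eta> \<omega> * ?b (X1 a \<omega>) \<partial>P1) = (\<integral>\<omega>. ?w2 t \<eta> \<omega> * ?b (X2 a \<omega>) \<partial>P2)" for t \<eta>
  proof -
    have "(\<integral>\<omega>. ?w1 t \<eta> \<omega> * ?b (X1 a \<omega>) \<partial>P1) = (\<integral>x. ?b x \<partial>?M1 t \<eta>)"
      using w by (intro integral_distr_density[symmetric]) simp_all
    also have "\<dots> = (\<integral>x. ?b x \<partial>?M2 t \<eta>)"
      by (simp only: M)
    also have "\<dots> = (\<integral>\<omega>. ?w2 t \<eta> \<omega> * ?b (X2 a \<omega>) \<partial>P2)"
      using w by (intro integral_distr_density) simp_all
    finally show ?thesis .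
  qed
  \<comment> \<open>Zero coefficients and the phase \<open>pi / 2\<close> make the weight
    \<open>1 + cos (pi / 2) = 1\<close>. Subtracting this unweighted identity below isolates the
    cosine part of the weight.\<close>
  have b0: "(\<integral>\<omega>. ?b (X1 a \<omega>) \<partial>P1) = (\<integral>\<omega>. ?b (X2 a \<omega>) \<partial>P2)"
    using b[of "\<lambda>_. 0" "pi / 2"] by (simp add: Y1_def Y2_def)
  interpret P1: finite_measure P1 by fact
  interpret P2: finite_measure P2 by fact
  have bcos: "(\<integral>\<omega>. ?b (X1 a \<omega>) * cos (Y1 t \<omega> + \<eta>) \<partial>P1) = (\<integral>\<omega>. ?b (X2 a \<omega>) * cos (Y2 t \<omega> + \<eta>) \<partial>P2)" for t \<eta>
  proof -
    have i1: "integrable P1 (\<lambda>\<omega>. ?b (X1 a \<omega>))" "integrable P1 (\<lambda>\<omega>. ?b (X1 a \<omega>) * cos (Y1 t \<omega> + \<eta>))"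
      by (intro P1.integrable_bounded_real[where B = 1]; auto simp: indicator_def)+
    have i2: "integrable P2 (\<lambda>\<omega>. ?b (X2 a \<omega>))" "integrable P2 (\<lambda>\<omega>. ?b (X2 a \<omega>) * cos (Y2 t \<omega> + \<eta>))"
      by (intro P2.integrable_bounded_real[where B = 1]; auto simp: indicator_def)+
    show ?thesis
      using b[of t \<eta>] b0 i1 i2 by (simp add: distrib_left mult.commute[of "1 + _"])
  qed
  have Qfin: "finite_measure (density P (\<lambda>\<omega>. ennreal (?b (X \<omega>))))"
    if "finite_measure P" and [measurable]: "X \<in> borel_measurable P" for P :: "'c measure" and X
  proof (rule finite_measureI)
    have "(\<integral>\<^sup>+\<omega>. ennreal (?b (X \<omega>)) \<partial>P) \<le> (\<integral>\<^sup>+\<omega>. 1 \<partial>P)"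
      by (intro nn_integral_mono) (auto simp: indicator_def)
    then show "emeasure (density P (\<lambda>\<omega>. ennreal (?b (X \<omega>)))) (space (density P (\<lambda>\<omega>. ennreal (?b (X \<omega>))))) \<noteq> \<infinity>"
      using finite_measure.emeasure_finite[OF that(1), of "space P"]
      by (auto simp: emeasure_density top_unique cong: nn_integral_cong_simp)
  qed
  have Qset: "emeasure (density P (\<lambda>\<omega>. ennreal (?b (X a \<omega>))))
        {\<omega> \<in> space (density P (\<lambda>\<omega>. ennreal (?b (X a \<omega>)))). \<forall>i\<in>I. X i \<omega> \<in> B i} =
      emeasure P {\<omega> \<in> space P. \<forall>i\<in>insert a I. X i \<omega> \<in> B i}"
    if X: "\<And>i. i \<in> insert a I \<Longrightarrow> X i \<in> borel_measurable P" for P :: "'c measure" and X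
  proof -
    have [measurable]: "X a \<in> borel_measurable P"
      using X by simp
    have "{\<omega> \<in> space P. \<forall>i\<in>J. X i \<omega> \<in> B i} \<in> sets P" if "J \<subseteq> insert a I" for J
      using X insert.prems(5) that insert.hyps(1)
      by (intro sets.sets_Collect_finite_All) (auto intro: finite_subset[OF that] measurable_sets_Collect)
    from this[of I] this[of "insert a I"] show ?thesis
      by (subst emeasure_density) (auto simp: indicator_def simp flip: nn_integral_indicator intro!: nn_integral_cong)
  qed
  let ?Q1 = "density P1 (\<lambda>\<omega>. ennreal (?b (X1 a \<omega>)))" and ?Q2 = "density P2 (\<lambda>\<omega>. ennreal (?b (X2 a \<omega>)))"
  have "emeasure ?Q1 {\<omega> \<in> space ?Q1. \<forall>i\<in>I. X1 i \<omega> \<in> B i} = emeasure ?Q2 {\<omega> \<in> space ?Q2. \<forall>i\<in>I. X2 i \<omega> \<in> B i}"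
  proof (rule insert.IH)
    show "finite_measure ?Q1" "finite_measure ?Q2"
      by (rule Qfin, fact, measurable)+
    show "(\<integral>\<omega>. cos ((\<Sum>i\<in>I. t i * X1 i \<omega>) + \<eta>) \<partial>?Q1) = (\<integral>\<omega>. cos ((\<Sum>i\<in>I. t i * X2 i \<omega>) + \<eta>) \<partial>?Q2)" for t \<eta>
      using bcos[of t \<eta>] Ymeas[of t] unfolding Y1_def[symmetric] Y2_def[symmetric]
      by (subst (1 2) integral_density) auto
  qed (use insert.prems in auto)
  moreover have "emeasure ?Q1 {\<omega> \<in> space ?Q1. \<forall>i\<in>I. X1 i \<omega> \<in> B i} =
      emeasure P1 {\<omega> \<in> space P1. \<forall>i\<in>insert a I. X1 i \<omega> \<in> B i}"
    using insert.prems(3) by (rule Qset)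
  moreover have "emeasure ?Q2 {\<omega> \<in> space ?Q2. \<forall>i\<in>I. X2 i \<omega> \<in> B i} =
      emeasure P2 {\<omega> \<in> space P2. \<forall>i\<in>insert a I. X2 i \<omega> \<in> B i}"
    using insert.prems(4) by (rule Qset)
  ultimately show ?case by simp
qed

lemma L2_norm_square_add_orthogonal:
  assumes "f \<in> L2" "g \<in> L2" "L2_inner f g = 0"
  shows "(L2_norm (\<lambda>x. f x + r * g x))\<^sup>2 = (L2_norm f)\<^sup>2 + r\<^sup>2 * (L2_norm g)\<^sup>2"
  unfolding L2_norm_square using assms L2_inner_commute[of g f]
  by (simp add: L2_inner_add_left L2_inner_add_right L2_cmult L2_add
      L2_inner_cmult_left L2_inner_cmult_right power2_eq_square)

lemma L2_norm_square_cmult: "(L2_norm (\<lambda>x. c * f x))\<^sup>2 = c\<^sup>2 * (L2_norm f)\<^sup>2"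
  unfolding L2_norm_square by (simp add: L2_inner_cmult_left L2_inner_cmult_right power2_eq_square)

section \<open>Centered normal variables\<close>

interpretation std_normal: prob_space std_normal_distribution
  by (rule prob_space_normal_density) simp

lemma std_normal_cos: "(\<integral>x. cos (\<sigma> * x + \<eta>) \<partial>std_normal_distribution) = exp (- \<sigma>\<^sup>2 / 2) * cos \<eta>"
proof -
  have int: "integrable std_normal_distribution (\<lambda>x. iexp (\<sigma> * x))"
    by (intro std_normal.integrable_const_bound[where B = 1]) auto
  have "(\<integral>x. cos (\<sigma> * x + \<eta>) \<partial>std_normal_distribution) =
      Re (CLINT x|std_normal_distribution. iexp \<eta> * iexp (\<sigma> * x))"
    using int by (subst integral_Re[symmetric]) (auto simp: Re_exp Im_exp cos_add mult.commute)
  also have "\<dots> = Re (iexp \<eta> * char std_normal_distribution \<sigma>)"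
    using int by (simp add: char_def)
  also have "\<dots> = exp (- \<sigma>\<^sup>2 / 2) * cos \<eta>"
    by (simp add: char_std_normal_distribution Re_exp)
  finally show ?thesis .
qed

lemma std_normal_square: "(\<integral>x. x\<^sup>2 \<partial>std_normal_distribution) = 1"
    "integrable std_normal_distribution (\<lambda>x. x\<^sup>2)"
  using std_normal_distribution_even_moments[of 1] by (simp_all add: fact_numeral)

text \<open>The one-dimensional Cameron-Martin formula, obtained by completing the square in the
  exponent of the density.\<close>

lemma std_normal_shift:
  "distr std_normal_distribution borel (\<lambda>x. x + \<sigma>) =
    density std_normal_distribution (\<lambda>x. ennreal (exp (\<sigma> * x - \<sigma>\<^sup>2 / 2)))"
proof (rule measure_eqI)
  fix A :: "real set"
  assume "A \<in> sets (distr std_normal_distribution borel (\<lambda>x. x + \<sigma>))"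
  then have [measurable]: "A \<in> sets borel"
    by simp
  have "emeasure (distr std_normal_distribution borel (\<lambda>x. x + \<sigma>)) A =
      (\<integral>\<^sup>+x. indicator A (x + \<sigma>) \<partial>std_normal_distribution)"
    by (subst nn_integral_indicator[symmetric], simp, subst nn_integral_distr) auto
  also have "\<dots> = (\<integral>\<^sup>+x. ennreal (std_normal_density ((x + \<sigma>) - \<sigma>)) * indicator A (x + \<sigma>) \<partial>lborel)"
    by (subst nn_integral_density) auto
  also have "\<dots> = (\<integral>\<^sup>+x. ennreal (std_normal_density (x - \<sigma>)) * indicator A x \<partial>lborel)"
    by (rule nn_integral_lborel_translate[where h = "\<lambda>x. ennreal (std_normal_density (x - \<sigma>)) * indicator A x"]) measurable
  also have "\<dots> = (\<integral>\<^sup>+x. ennreal (std_normal_density x) * (ennreal (exp (\<sigma> * x - \<sigma>\<^sup>2 / 2)) * indicator A x) \<partial>lborel)"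
  proof (rule nn_integral_cong)
    fix x
    have "std_normal_density (x - \<sigma>) = std_normal_density x * exp (\<sigma> * x - \<sigma>\<^sup>2 / 2)"
      unfolding std_normal_density_def by (simp add: exp_add[symmetric] power2_eq_square field_simps)
    then show "ennreal (std_normal_density (x - \<sigma>)) * indicator A x =
        ennreal (std_normal_density x) * (ennreal (exp (\<sigma> * x - \<sigma>\<^sup>2 / 2)) * indicator A x)"
      by (simp add: ennreal_mult mult.assoc)
  qed
  also have "\<dots> = emeasure (density std_normal_distribution (\<lambda>x. ennreal (exp (\<sigma> * x - \<sigma>\<^sup>2 / 2)))) A"
    by (subst emeasure_density, simp, simp, subst nn_integral_density) auto
  finally show "emeasure (distr std_normal_distribution borel (\<lambda>x. x + \<sigma>)) A =
    emeasure (density std_normal_distribution (\<lambda>x. ennreal (exp (\<sigma> * x - \<sigma>\<^sup>2 / 2)))) A" .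
qed simp

lemma std_normal_exp:
  fixes g :: "real \<Rightarrow> real"
  assumes [measurable]: "g \<in> borel_measurable borel"
  shows "(\<integral>x. exp (\<sigma> * x - \<sigma>\<^sup>2 / 2) * g x \<partial>std_normal_distribution) = (\<integral>x. g (x + \<sigma>) \<partial>std_normal_distribution)"
proof -
  have "(\<integral>x. g (x + \<sigma>) \<partial>std_normal_distribution) = (\<integral>x. g x \<partial>distr std_normal_distribution borel (\<lambda>x. x + \<sigma>))"
    by (subst integral_distr) auto
  also have "\<dots> = (\<integral>x. exp (\<sigma> * x - \<sigma>\<^sup>2 / 2) * g x \<partial>std_normal_distribution)"
    unfolding std_normal_shift by (subst integral_density) auto
  finally show ?thesis ..
qed

lemma std_normal_exp_one:
  "(\<integral>\<^sup>+x. ennreal (exp (\<sigma> * x - \<sigma>\<^sup>2 / 2)) \<partial>std_normal_distribution) = 1"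
proof -
  have "(\<integral>\<^sup>+x. ennreal (exp (\<sigma> * x - \<sigma>\<^sup>2 / 2)) \<partial>std_normal_distribution) =
      emeasure (distr std_normal_distribution borel (\<lambda>x. x + \<sigma>)) UNIV"
    unfolding std_normal_shift by (subst emeasure_density) auto
  also have "\<dots> = 1"
    using std_normal.emeasure_space_1 by (subst emeasure_distr) auto
  finally show ?thesis .
qed

text \<open>With exponent \<open>x\<^sup>2 / 4\<close> the product with the standard density is
  again Gaussian: it is \<open>sqrt 2\<close> times the density of variance
  \<open>2\<close>.\<close>

lemma std_normal_exp_square:
  "(\<integral>\<^sup>+x. ennreal (exp (x\<^sup>2 / 4)) \<partial>std_normal_distribution) = ennreal (sqrt 2)"
proof -
  have "(\<integral>\<^sup>+x. ennreal (exp (x\<^sup>2 / 4)) \<partial>std_normal_distribution) =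
      (\<integral>\<^sup>+x. ennreal (sqrt 2) * ennreal (normal_density 0 (sqrt 2) x) \<partial>lborel)"
  proof (subst nn_integral_density, simp, simp, rule nn_integral_cong)
    fix x :: real
    have "exp (- x\<^sup>2 / 2) * exp (x\<^sup>2 / 4) = exp (- x\<^sup>2 / 4)"
      by (simp add: exp_add[symmetric])
    then have "std_normal_density x * exp (x\<^sup>2 / 4) = sqrt 2 * normal_density 0 (sqrt 2) x"
      unfolding normal_density_def by (simp add: real_sqrt_mult field_simps)
    then show "ennreal (std_normal_density x) * ennreal (exp (x\<^sup>2 / 4)) =
        ennreal (sqrt 2) * ennreal (normal_density 0 (sqrt 2) x)"
      by (simp flip: ennreal_mult)
  qed
  also have "\<dots> = ennreal (sqrt 2) * emeasure (density lborel (normal_density 0 (sqrt 2))) UNIV"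
    by (subst nn_integral_cmult) (auto simp: emeasure_density)
  also have "emeasure (density lborel (normal_density 0 (sqrt 2))) UNIV = 1"
    using prob_space.emeasure_space_1[OF prob_space_normal_density[of "sqrt 2" 0]] by simp
  finally show ?thesis by simp
qed

text \<open>Scaling the standard normal law covers the degenerate case \<open>v = 0\<close> as well,
  so no later computation has to split it off.\<close>

lemma centered_normal_distr:
  assumes "centered_normal P X v" "v \<ge> 0"
  shows "distr P borel X = distr std_normal_distribution borel (\<lambda>x. sqrt v * x)"
proof (cases "v = 0")
  case True
  have "distr std_normal_distribution borel (\<lambda>x. 0 :: real) = return borel 0"
    by (rule std_normal.distr_const) simp
  then show ?thesis
    using assms True by (simp add: centered_normal_def)
next
  case False
  have "distributed std_normal_distribution lborel (\<lambda>x. x) (\<lambda>x. ennreal (std_normal_density x))"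
    by (auto simp: distributed_def distr_id2)
  from std_normal.normal_density_affine[OF this, of "sqrt v" 0]
  have "distributed std_normal_distribution lborel (\<lambda>x. sqrt v * x) (normal_density 0 (sqrt v))"
    using assms False by simp
  then have "distr std_normal_distribution lborel (\<lambda>x. sqrt v * x) = density lborel (normal_density 0 (sqrt v))"
    by (simp add: distributed_def)
  moreover have "distr std_normal_distribution lborel (\<lambda>x. sqrt v * x) = distr std_normal_distribution borel (\<lambda>x. sqrt v * x)"
    by (rule distr_cong) auto
  ultimately show ?thesis
    using assms False by (simp add: centered_normal_def)
qed

lemma centered_normal_integral:
  fixes g :: "real \<Rightarrow> real"
  assumes "centered_normal P X v" "v \<ge> 0" and [measurable]: "g \<in> borel_measurable borel"
  shows "(\<integral>\<omega>. g (X \<omega>) \<partial>P) = (\<integral>x. g (sqrt v * x) \<partial>std_normal_distribution)"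
    and "integrable P (\<lambda>\<omega>. g (X \<omega>)) \<longleftrightarrow> integrable std_normal_distribution (\<lambda>x. g (sqrt v * x))"
    and "(\<integral>\<^sup>+\<omega>. ennreal (g (X \<omega>)) \<partial>P) = (\<integral>\<^sup>+x. ennreal (g (sqrt v * x)) \<partial>std_normal_distribution)"
proof -
  have X[measurable]: "X \<in> borel_measurable P"
    using assms by (simp add: centered_normal_def)
  note d = centered_normal_distr[OF assms(1,2)]
  show "(\<integral>\<omega>. g (X \<omega>) \<partial>P) = (\<integral>x. g (sqrt v * x) \<partial>std_normal_distribution)"
    using integral_distr[OF X assms(3)] by (simp add: d integral_distr)
  show "integrable P (\<lambda>\<omega>. g (X \<omega>)) \<longleftrightarrow> integrable std_normal_distribution (\<lambda>x. g (sqrt v * x))"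
    using integrable_distr_eq[OF X assms(3)] by (simp add: d integrable_distr_eq)
  show "(\<integral>\<^sup>+\<omega>. ennreal (g (X \<omega>)) \<partial>P) = (\<integral>\<^sup>+x. ennreal (g (sqrt v * x)) \<partial>std_normal_distribution)"
    using nn_integral_distr[OF X, of "\<lambda>x. ennreal (g x)"] by (simp add: d nn_integral_distr)
qed

lemma centered_normal_cos:
  assumes "centered_normal P X v" "v \<ge> 0"
  shows "(\<integral>\<omega>. cos (X \<omega> + \<eta>) \<partial>P) = exp (- v / 2) * cos \<eta>"
  using centered_normal_integral(1)[OF assms, of "\<lambda>x. cos (x + \<eta>)"] assms(2)
  by (simp add: std_normal_cos)

lemma centered_normal_square:
  assumes "centered_normal P X v" "v \<ge> 0"
  shows "(\<integral>\<omega>. (X \<omega>)\<^sup>2 \<partial>P) = v" "integrable P (\<lambda>\<omega>. (X \<omega>)\<^sup>2)"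
  using centered_normal_integral(1,2)[OF assms, of "\<lambda>x. x\<^sup>2"] assms(2)
  by (simp_all add: power_mult_distrib std_normal_square)

text \<open>Normalising by a positive upper bound \<open>\<tau>\<close> of the variance keeps the
  quotient meaningful for \<open>v = 0\<close> and makes the bound independent of
  \<open>v\<close>.\<close>

lemma centered_normal_exp_square_le:
  assumes "centered_normal P X v" "0 \<le> v" "v \<le> \<tau>"  "0 < \<tau>"
  shows "(\<integral>\<^sup>+\<omega>. ennreal (exp ((X \<omega>)\<^sup>2 / (4 * \<tau>))) \<partial>P) \<le> ennreal (sqrt 2)"
proof -
  have "(\<integral>\<^sup>+\<omega>. ennreal (exp ((X \<omega>)\<^sup>2 / (4 * \<tau>))) \<partial>P) =
      (\<integral>\<^sup>+x. ennreal (exp ((sqrt v * x)\<^sup>2 / (4 * \<tau>))) \<partial>std_normal_distribution)"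
    using assms by (intro centered_normal_integral(3)) auto
  also have "\<dots> \<le> (\<integral>\<^sup>+x. ennreal (exp (x\<^sup>2 / 4)) \<partial>std_normal_distribution)"
  proof (intro nn_integral_mono ennreal_leI)
    fix x :: real
    have "v * x\<^sup>2 \<le> \<tau> * x\<^sup>2"
      using assms by (intro mult_right_mono) auto
    then show "exp ((sqrt v * x)\<^sup>2 / (4 * \<tau>)) \<le> exp (x\<^sup>2 / 4)"
      using assms by (simp add: power_mult_distrib field_simps)
  qed
  finally show ?thesis
    by (simp add: std_normal_exp_square)
qed

section \<open>White noise\<close>

locale noise =
  fixes P :: "'w measure" and W :: "(real ^ 'd::finite \<Rightarrow> real) \<Rightarrow> 'w \<Rightarrow> real"
  assumes white_noise: "white_noise P W"
begin

sublocale prob_space P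
  using white_noise by (simp add: white_noise_def)

lemma noise_pair:
  assumes "h1 \<in> L2" "h2 \<in> L2"
  shows "centered_normal P (\<lambda>\<omega>. c1 * W h1 \<omega> + c2 * W h2 \<omega>) ((L2_norm (\<lambda>x. c1 * h1 x + c2 * h2 x))\<^sup>2)"
proof -
  have "(L2_norm (\<lambda>x. c1 * h1 x + c2 * h2 x))\<^sup>2 =
      c1\<^sup>2 * (L2_norm h1)\<^sup>2 + 2 * c1 * c2 * L2_inner h1 h2 + c2\<^sup>2 * (L2_norm h2)\<^sup>2"
    unfolding L2_norm_square using assms L2_inner_commute[of h2 h1]
    by (simp add: L2_inner_add_left L2_inner_add_right L2_cmult L2_add
        L2_inner_cmult_left L2_inner_cmult_right power2_eq_square algebra_simps)
  then show ?thesis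
    using white_noise assms by (simp add: white_noise_def)
qed

lemma noise_single: "h \<in> L2 \<Longrightarrow> centered_normal P (W h) ((L2_norm h)\<^sup>2)"
  using noise_pair[of h h 1 0] by simp

lemma noise_measurable [measurable]: "h \<in> L2 \<Longrightarrow> W h \<in> borel_measurable P"
  using noise_single by (simp add: centered_normal_def)

lemma noise_square:
  assumes "h \<in> L2"
  shows "expectation (\<lambda>\<omega>. W h \<omega> * W h \<omega>) = L2_inner h h" "integrable P (\<lambda>\<omega>. W h \<omega> * W h \<omega>)"
  using centered_normal_square[OF noise_single[OF assms]]
  by (simp_all add: power2_eq_square[of "W h _"] L2_norm_square L2_inner_self_nonneg)

text \<open>Polarization: the variance of \<open>W h1 + W h2\<close> is known from the normality of
  the pair, and the two single variances are subtracted.\<close>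

lemma noise_covariance:
  assumes h: "h1 \<in> L2" "h2 \<in> L2"
  shows "expectation (\<lambda>\<omega>. W h1 \<omega> * W h2 \<omega>) = L2_inner h1 h2" "integrable P (\<lambda>\<omega>. W h1 \<omega> * W h2 \<omega>)"
proof -
  note s = centered_normal_square[OF noise_pair[OF h, of 1 1], simplified]
  have eq: "W h1 \<omega> * W h2 \<omega> = ((W h1 \<omega> + W h2 \<omega>)\<^sup>2 - W h1 \<omega> * W h1 \<omega> - W h2 \<omega> * W h2 \<omega>) / 2" for \<omega>
    by (simp add: power2_eq_square algebra_simps)
  have "integrable P (\<lambda>\<omega>. (W h1 \<omega> + W h2 \<omega>)\<^sup>2 - W h1 \<omega> * W h1 \<omega> - W h2 \<omega> * W h2 \<omega>)"
    by (intro Bochner_Integration.integrable_diff s noise_square h)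
  then show "integrable P (\<lambda>\<omega>. W h1 \<omega> * W h2 \<omega>)"
    unfolding eq by simp
  have "expectation (\<lambda>\<omega>. W h1 \<omega> * W h2 \<omega>) =
      ((L2_norm (\<lambda>x. h1 x + h2 x))\<^sup>2 - L2_inner h1 h1 - L2_inner h2 h2) / 2"
    unfolding eq using s h by (simp add: noise_square)
  also have "\<dots> = L2_inner h1 h2"
    using h L2_inner_commute[of h2 h1]
    by (simp add: L2_norm_square L2_inner_add_left L2_inner_add_right L2_add)
  finally show "expectation (\<lambda>\<omega>. W h1 \<omega> * W h2 \<omega>) = L2_inner h1 h2" .
qed

text \<open>Linearity is not part of the definition. The second moment of the defect expands into
  inner products that cancel, so the defect is almost surely zero.\<close>

lemma noise_linear:
  assumes f: "f \<in> L2" and g: "g \<in> L2"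
  shows "AE \<omega> in P. W (\<lambda>x. f x + c * g x) \<omega> = W f \<omega> + c * W g \<omega>"
proof -
  let ?s = "\<lambda>x. f x + c * g x"
  let ?e = "\<lambda>\<omega>. W ?s \<omega> - W f \<omega> - c * W g \<omega>"
  have s: "?s \<in> L2"
    using f g by (intro L2_add L2_cmult)
  have eq: "(?e \<omega>)\<^sup>2 = W ?s \<omega> * W ?s \<omega> + W f \<omega> * W f \<omega> + c * c * (W g \<omega> * W g \<omega>)
    - 2 * (W ?s \<omega> * W f \<omega>) - 2 * c * (W ?s \<omega> * W g \<omega>) + 2 * c * (W f \<omega> * W g \<omega>)" for \<omega>
    by (simp add: power2_eq_square algebra_simps)
  have int: "integrable P (\<lambda>\<omega>. (?e \<omega>)\<^sup>2)"
    unfolding eq using f g s by (simp add: noise_covariance(2) noise_square(2))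
  have "expectation (\<lambda>\<omega>. (?e \<omega>)\<^sup>2) = L2_inner ?s ?s + L2_inner f f + c * c * L2_inner g g
    - 2 * L2_inner ?s f - 2 * c * L2_inner ?s g + 2 * c * L2_inner f g"
    unfolding eq using f g s by (simp add: noise_covariance noise_square)
  also have "\<dots> = 0"
    using f g L2_inner_commute[of g f]
    by (simp add: L2_inner_add_left L2_inner_add_right L2_cmult L2_add
        L2_inner_cmult_left L2_inner_cmult_right algebra_simps)
  finally have "AE \<omega> in P. (?e \<omega>)\<^sup>2 = 0"
    using int by (subst (asm) integral_nonneg_eq_0_iff_AE) auto
  then show ?thesis
    by (rule eventually_mono) simp
qed

lemma noise_sum:
  assumes "finite J" "J \<subseteq> L2"
  shows "AE \<omega> in P. W (\<lambda>x. \<Sum>h\<in>J. t h * h x) \<omega> = (\<Sum>h\<in>J. t h * W h \<omega>)"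
  using assms
proof (induction J)
  case empty
  \<comment> \<open>Linearity for the combination \<open>0 + (- 1) * 0\<close> says
    \<open>W 0 = W 0 - W 0\<close> almost surely, that is, \<open>W 0 = 0\<close>.\<close>
  have "AE \<omega> in P. W (\<lambda>x. 0 + (- 1) * 0) \<omega> = W (\<lambda>x. 0) \<omega> + (- 1) * W (\<lambda>x. 0) \<omega>"
    by (rule noise_linear) (rule L2_zero)+
  then show ?case by simp
next
  case (insert g J)
  then have L: "(\<lambda>x. \<Sum>h\<in>J. t h * h x) \<in> L2" "g \<in> L2"
    by (auto intro!: L2_sum L2_cmult)
  have "AE \<omega> in P. W (\<lambda>x. \<Sum>h\<in>J. t h * h x) \<omega> = (\<Sum>h\<in>J. t h * W h \<omega>)"
    using insert by auto
  with noise_linear[OF L, of "t g"] show ?case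
    by eventually_elim (use insert.hyps in \<open>simp add: add.commute\<close>)
qed

text \<open>
  Split \<open>W H = W Z + \<gamma> * W D\<close> with \<open>Z\<close> orthogonal to \<open>D\<close>. Weighting with \<open>1 + cos (W Z + \<zeta>)\<close> and
  one-dimensional uniqueness replace the independence of \<open>W Z\<close> and \<open>W D\<close>.
\<close>

lemma orthogonal_noise_cos:
  assumes D: "D \<in> L2" and H: "H \<in> L2" and orth: "L2_inner (\<lambda>x. H x + (- \<gamma>) * D x) D = 0"
    and [measurable]: "g \<in> borel_measurable borel" and g: "integrable P (\<lambda>\<omega>. g (W D \<omega>))"
  shows "expectation (\<lambda>\<omega>. cos (1 * W H \<omega> + (- \<gamma>) * W D \<omega> + \<zeta>) * g (W D \<omega>)) =
    exp (- (L2_norm (\<lambda>x. H x + (- \<gamma>) * D x))\<^sup>2 / 2) * cos \<zeta> * expectation (\<lambda>\<omega>. g (W D \<omega>))"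
proof -
  let ?Z = "\<lambda>\<omega>. 1 * W H \<omega> + (- \<gamma>) * W D \<omega>"
  let ?z = "\<lambda>x. H x + (- \<gamma>) * D x"
  let ?v = "(L2_norm ?z)\<^sup>2"
  have z: "?z \<in> L2"
    using D H by (intro L2_add L2_cmult)
  have Zcos: "expectation (\<lambda>\<omega>. cos (1 * W H \<omega> + (- \<gamma> + r) * W D \<omega> + \<eta>)) =
      exp (- (?v + r\<^sup>2 * (L2_norm D)\<^sup>2) / 2) * cos \<eta>" for r \<eta>
  proof -
    have "(\<lambda>x. 1 * H x + (- \<gamma> + r) * D x) = (\<lambda>x. ?z x + r * D x)"
      by (auto simp: algebra_simps)
    then have "(L2_norm (\<lambda>x. 1 * H x + (- \<gamma> + r) * D x))\<^sup>2 = ?v + r\<^sup>2 * (L2_norm D)\<^sup>2"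
      using L2_norm_square_add_orthogonal[OF z D orth] by (simp only:)
    then show ?thesis
      using centered_normal_cos[OF noise_pair[OF H D, of 1 "- \<gamma> + r"], of \<eta>] by simp
  qed
  have Dcos: "expectation (\<lambda>\<omega>. cos (s * W D \<omega> + \<eta>)) = exp (- (s\<^sup>2 * (L2_norm D)\<^sup>2) / 2) * cos \<eta>" for s \<eta>
    using centered_normal_cos[OF noise_pair[OF D D, of s 0], of \<eta>]
    by (simp add: L2_norm_square_cmult)
  have [measurable]: "W H \<in> borel_measurable P" "W D \<in> borel_measurable P"
    using D H by auto
  let ?w = "\<lambda>\<omega>. 1 + cos (?Z \<omega> + \<zeta>)"
  \<comment> \<open>The mean of the weight \<open>?w\<close>. That weighting by \<open>?w\<close>
    and by this constant give \<open>W D\<close> the same law is the form of independence used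
    here.\<close>
  let ?c = "1 + exp (- ?v / 2) * cos \<zeta>"
  have w: "0 \<le> 1 + cos (y :: real)" "1 + cos (y :: real) \<le> 2" for y
    using cos_ge_minus_one[of y] cos_le_one[of y] by linarith+
  have c: "0 \<le> ?c"
  proof -
    have "\<bar>exp (- ?v / 2) * cos \<zeta>\<bar> \<le> 1"
      unfolding abs_mult by (intro mult_le_one) auto
    then show ?thesis by linarith
  qed
  let ?M1 = "distr (density P (\<lambda>\<omega>. ennreal (?w \<omega>))) borel (W D)"
  let ?M2 = "distr (density P (\<lambda>\<omega>. ennreal ?c)) borel (W D)"
  have int: "integrable P (\<lambda>\<omega>. cos (f \<omega>))" if "f \<in> borel_measurable P" for f :: "'w \<Rightarrow> real"
    using that by (intro integrable_bounded_real[where B = 1]) auto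
  have M: "?M1 = ?M2"
  proof (rule finite_measure_eqI_cos)
    show "finite_measure ?M1"
      using w by (intro finite_measure_distr_density[where B = 2]) (auto simp: finite_measure_axioms)
    show "finite_measure ?M2"
      using c by (intro finite_measure_distr_density[where B = ?c]) (auto simp: finite_measure_axioms)
    fix s \<eta> :: real
    have "(\<integral>x. cos (s * x + \<eta>) \<partial>?M1) = expectation (\<lambda>\<omega>. ?w \<omega> * cos (s * W D \<omega> + \<eta>))"
      using w by (intro integral_distr_density) auto
    also have "\<dots> = expectation (\<lambda>\<omega>. cos (s * W D \<omega> + \<eta>) + cos (1 * W H \<omega> + (- \<gamma> + (- s)) * W D \<omega> + (\<zeta> - \<eta>)) / 2
        + cos (1 * W H \<omega> + (- \<gamma> + s) * W D \<omega> + (\<zeta> + \<eta>)) / 2)"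
    proof (rule Bochner_Integration.integral_cong)
      fix \<omega>
      show "?w \<omega> * cos (s * W D \<omega> + \<eta>) = cos (s * W D \<omega> + \<eta>) + cos (1 * W H \<omega> + (- \<gamma> + (- s)) * W D \<omega> + (\<zeta> - \<eta>)) / 2
        + cos (1 * W H \<omega> + (- \<gamma> + s) * W D \<omega> + (\<zeta> + \<eta>)) / 2"
        using cos_times_cos[of "?Z \<omega> + \<zeta>" "s * W D \<omega> + \<eta>"] by (simp add: algebra_simps add_divide_distrib)
    qed simp
    also have "\<dots> = expectation (\<lambda>\<omega>. cos (s * W D \<omega> + \<eta>)) +
        expectation (\<lambda>\<omega>. cos (1 * W H \<omega> + (- \<gamma> + (- s)) * W D \<omega> + (\<zeta> - \<eta>))) / 2 +
        expectation (\<lambda>\<omega>. cos (1 * W H \<omega> + (- \<gamma> + s) * W D \<omega> + (\<zeta> + \<eta>))) / 2"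
    proof -
      have "integrable P (\<lambda>\<omega>. cos (s * W D \<omega> + \<eta>))"
        "integrable P (\<lambda>\<omega>. cos (1 * W H \<omega> + (- \<gamma> + (- s)) * W D \<omega> + (\<zeta> - \<eta>)) / 2)"
        "integrable P (\<lambda>\<omega>. cos (1 * W H \<omega> + (- \<gamma> + s) * W D \<omega> + (\<zeta> + \<eta>)) / 2)"
        by (auto intro!: int)
      then show ?thesis
        by (simp only: Bochner_Integration.integral_add Bochner_Integration.integrable_add integral_divide_zero)
    qed
    also have "\<dots> = exp (- (s\<^sup>2 * (L2_norm D)\<^sup>2) / 2) * cos \<eta> +
        exp (- (?v + s\<^sup>2 * (L2_norm D)\<^sup>2) / 2) * ((cos (\<zeta> - \<eta>) + cos (\<zeta> + \<eta>)) / 2)"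
      unfolding Zcos Dcos by (simp add: algebra_simps add_divide_distrib)
    also have "\<dots> = ?c * (exp (- (s\<^sup>2 * (L2_norm D)\<^sup>2) / 2) * cos \<eta>)"
    proof -
      have "exp (- (?v + s\<^sup>2 * (L2_norm D)\<^sup>2) / 2) = exp (- ?v / 2) * exp (- (s\<^sup>2 * (L2_norm D)\<^sup>2) / 2)"
        unfolding exp_add[symmetric] by (rule arg_cong[where f = exp]) (simp add: field_simps)
      then show ?thesis
        unfolding cos_times_cos[symmetric] by (simp add: algebra_simps)
    qed
    also have "\<dots> = expectation (\<lambda>\<omega>. ?c * cos (s * W D \<omega> + \<eta>))"
      by (simp add: Dcos)
    also have "\<dots> = (\<integral>x. cos (s * x + \<eta>) \<partial>?M2)"
      using c by (intro integral_distr_density[symmetric]) auto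
    finally show "(\<integral>x. cos (s * x + \<eta>) \<partial>?M1) = (\<integral>x. cos (s * x + \<eta>) \<partial>?M2)" .
  qed auto
  have "expectation (\<lambda>\<omega>. ?w \<omega> * g (W D \<omega>)) = (\<integral>x. g x \<partial>?M1)"
    using w by (intro integral_distr_density[symmetric]) auto
  also have "\<dots> = expectation (\<lambda>\<omega>. ?c * g (W D \<omega>))"
    unfolding M using c by (intro integral_distr_density) auto
  finally have eq: "expectation (\<lambda>\<omega>. ?w \<omega> * g (W D \<omega>)) = ?c * expectation (\<lambda>\<omega>. g (W D \<omega>))"
    by simp
  have "integrable P (\<lambda>\<omega>. cos (?Z \<omega> + \<zeta>) * g (W D \<omega>))"
    using g by (rule Bochner_Integration.integrable_bound)
      (auto simp: abs_mult intro!: mult_left_le_one_le)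
  then have "expectation (\<lambda>\<omega>. ?w \<omega> * g (W D \<omega>)) =
      expectation (\<lambda>\<omega>. g (W D \<omega>)) + expectation (\<lambda>\<omega>. cos (?Z \<omega> + \<zeta>) * g (W D \<omega>))"
    using g by (simp add: distrib_right)
  then show ?thesis
    using eq by (simp add: algebra_simps)
qed

text \<open>Weighting with \<open>exp (W D - (L2_norm D)\<^sup>2 / 2)\<close> moves the mean of
  \<open>W H\<close> by \<open>L2_inner H D\<close> and keeps its variance. The part of
  \<open>H\<close> orthogonal to \<open>D\<close> does not feel the weight, the part along
  \<open>D\<close> is handled by the one-dimensional shift, and Pythagoras puts the variances
  together.\<close>

lemma noise_tilted_cos:
  assumes D: "D \<in> L2" and H: "H \<in> L2" and pos: "L2_norm D > 0"
  shows "expectation (\<lambda>\<omega>. exp (W D \<omega> - (L2_norm D)\<^sup>2 / 2) * cos (W H \<omega> + \<eta>)) =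
    exp (- (L2_norm H)\<^sup>2 / 2) * cos (L2_inner H D + \<eta>)"
proof -
  let ?\<sigma> = "L2_norm D"
  \<comment> \<open>The coefficient of the projection of \<open>H\<close> on \<open>D\<close>, so
    that \<open>?z\<close> is orthogonal to \<open>D\<close>.\<close>
  define \<gamma> where "\<gamma> = L2_inner H D / ?\<sigma>\<^sup>2"
  let ?z = "\<lambda>x. H x + (- \<gamma>) * D x"
  have \<gamma>: "\<gamma> * ?\<sigma>\<^sup>2 = L2_inner H D"
    using pos by (simp add: \<gamma>_def)
  have orth: "L2_inner ?z D = 0"
    using \<gamma> D H by (simp add: L2_inner_diff_left L2_cmult L2_inner_cmult_left L2_norm_square)
  have norm: "(L2_norm ?z)\<^sup>2 + \<gamma>\<^sup>2 * ?\<sigma>\<^sup>2 = (L2_norm H)\<^sup>2"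
  proof -
    have "(L2_norm ?z)\<^sup>2 = (L2_norm H)\<^sup>2 - 2 * \<gamma> * L2_inner H D + \<gamma>\<^sup>2 * ?\<sigma>\<^sup>2"
      using D H L2_norm_square_diff[OF H L2_cmult[OF D, of \<gamma>]]
      unfolding L2_norm_square by (simp add: L2_inner_cmult_right L2_inner_cmult_left power2_eq_square)
    then show ?thesis
      using \<gamma> by (simp add: power2_eq_square algebra_simps)
  qed
  let ?g = "\<lambda>\<theta> y. exp (y - ?\<sigma>\<^sup>2 / 2) * cos (\<gamma> * y + \<theta>)"
  have gint: "integrable P (\<lambda>\<omega>. ?g \<theta> (W D \<omega>))" for \<theta>
  proof (rule integrableI_bounded)
    have "(\<integral>\<^sup>+\<omega>. ennreal (norm (?g \<theta> (W D \<omega>))) \<partial>P) \<le> (\<integral>\<^sup>+\<omega>. ennreal (exp (W D \<omega> - ?\<sigma>\<^sup>2 / 2)) \<partial>P)"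
      by (intro nn_integral_mono ennreal_leI) (auto simp: abs_mult intro!: mult_left_le)
    also have "\<dots> = (\<integral>\<^sup>+x. ennreal (exp (?\<sigma> * x - ?\<sigma>\<^sup>2 / 2)) \<partial>std_normal_distribution)"
      using centered_normal_integral(3)[OF noise_single[OF D], of "\<lambda>y. exp (y - ?\<sigma>\<^sup>2 / 2)"]
      by (simp add: L2_norm_nonneg)
    finally show "(\<integral>\<^sup>+\<omega>. ennreal (norm (?g \<theta> (W D \<omega>))) \<partial>P) < \<infinity>"
      by (auto simp: std_normal_exp_one intro: le_less_trans)
  qed (use D in measurable)
  have gE: "expectation (\<lambda>\<omega>. ?g \<theta> (W D \<omega>)) = exp (- (\<gamma>\<^sup>2 * ?\<sigma>\<^sup>2) / 2) * cos (L2_inner H D + \<theta>)" for \<theta>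
  proof -
    have "expectation (\<lambda>\<omega>. ?g \<theta> (W D \<omega>)) =
        (\<integral>x. exp (?\<sigma> * x - ?\<sigma>\<^sup>2 / 2) * cos (\<gamma> * (?\<sigma> * x) + \<theta>) \<partial>std_normal_distribution)"
      using centered_normal_integral(1)[OF noise_single[OF D], of "?g \<theta>"] by (simp add: L2_norm_nonneg)
    also have "\<dots> = (\<integral>x. cos (\<gamma> * (?\<sigma> * (x + ?\<sigma>)) + \<theta>) \<partial>std_normal_distribution)"
      by (rule std_normal_exp) measurable
    also have "\<dots> = (\<integral>x. cos ((\<gamma> * ?\<sigma>) * x + (L2_inner H D + \<theta>)) \<partial>std_normal_distribution)"
      unfolding \<gamma>[symmetric] by (simp add: algebra_simps power2_eq_square)
    finally show ?thesis
      by (simp add: std_normal_cos power_mult_distrib)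
  qed
  note oc = orthogonal_noise_cos[OF D H orth _ gint]
  have m: "?g \<theta> \<in> borel_measurable borel" for \<theta>
    by measurable
  have int: "integrable P (\<lambda>\<omega>. cos (1 * W H \<omega> + (- \<gamma>) * W D \<omega> + \<zeta>) * ?g \<theta> (W D \<omega>))" for \<zeta> \<theta>
    using gint[of \<theta>] by (rule Bochner_Integration.integrable_bound)
      (use D H in \<open>auto simp: abs_mult intro!: mult_left_le_one_le\<close>)
  \<comment> \<open>The addition theorem separates the orthogonal part from the \<open>D\<close>
    part; both sines become cosines with phases \<open>pi / 2\<close> and \<open>- pi / 2\<close>,
    so \<open>orthogonal_noise_cos\<close> applies to each product.\<close>
  have "exp (W D \<omega> - ?\<sigma>\<^sup>2 / 2) * cos (W H \<omega> + \<eta>) =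
      cos (1 * W H \<omega> + (- \<gamma>) * W D \<omega> + 0) * ?g \<eta> (W D \<omega>) +
      cos (1 * W H \<omega> + (- \<gamma>) * W D \<omega> + pi / 2) * ?g (\<eta> - pi / 2) (W D \<omega>)" for \<omega>
  proof -
    let ?Z = "1 * W H \<omega> + (- \<gamma>) * W D \<omega>" and ?Y = "\<gamma> * W D \<omega> + \<eta>"
    have "cos (W H \<omega> + \<eta>) = cos (?Z + ?Y)"
      by simp
    also have "\<dots> = cos ?Z * cos ?Y + cos (?Z + pi / 2) * cos (?Y - pi / 2)"
    proof -
      have "cos (z + pi / 2) = - sin z" "cos (z - pi / 2) = sin z" for z :: real
        by (simp_all add: cos_add cos_diff)
      then show ?thesis
        by (simp only: cos_add[of ?Z ?Y])
    qed
    finally show ?thesis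
      by (simp add: algebra_simps)
  qed
  then have "expectation (\<lambda>\<omega>. exp (W D \<omega> - ?\<sigma>\<^sup>2 / 2) * cos (W H \<omega> + \<eta>)) =
      exp (- (L2_norm ?z)\<^sup>2 / 2) * (exp (- (\<gamma>\<^sup>2 * ?\<sigma>\<^sup>2) / 2) * cos (L2_inner H D + \<eta>))"
    using int by (simp only: Bochner_Integration.integral_add int oc[OF m] gE cos_zero cos_pi_half)
  also have "\<dots> = exp (- ((L2_norm ?z)\<^sup>2 + \<gamma>\<^sup>2 * ?\<sigma>\<^sup>2) / 2) * cos (L2_inner H D + \<eta>)"
    by (simp add: exp_add[symmetric] add_divide_distrib)
  finally show ?thesis
    by (simp only: norm)
qed

text \<open>Two finite measures on the infinite product agree once they agree on cylinder sets.
  There only cosines of finite combinations matter, each of which is almost surely a single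
  \<open>W ?H\<close>, covered by \<open>noise_tilted_cos\<close>. The affine data
  \<open>\<alpha>\<close> and \<open>c\<close> make the formula applicable to observations.\<close>

lemma cameron_martin:
  assumes D: "D \<in> L2" and pos: "L2_norm D > 0"
  shows "distr P path_space (\<lambda>\<omega>. \<lambda>h\<in>L2. \<alpha> h + c * (W h \<omega> + L2_inner h D)) =
    distr (density P (\<lambda>\<omega>. ennreal (exp (W D \<omega> - (L2_norm D)\<^sup>2 / 2)))) path_space (\<lambda>\<omega>. \<lambda>h\<in>L2. \<alpha> h + c * W h \<omega>)"
    (is "distr P path_space ?T1 = distr ?Q path_space ?T2")
proof (rule measure_eqI_PiM_infinite)
  have [measurable]: "W D \<in> borel_measurable P"
    using D by simp
  have T1: "?T1 \<in> P \<rightarrow>\<^sub>M path_space" and T2: "?T2 \<in> ?Q \<rightarrow>\<^sub>M path_space"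
    by (auto intro!: measurable_restrict)
  show "finite_measure (distr P path_space ?T1)"
    by (rule finite_measure_distr[OF T1])
  have Qfin: "finite_measure ?Q"
  proof (rule finite_measureI)
    have "emeasure ?Q (space ?Q) = (\<integral>\<^sup>+\<omega>. ennreal (exp (W D \<omega> - (L2_norm D)\<^sup>2 / 2)) \<partial>P)"
      by (auto simp: emeasure_density cong: nn_integral_cong_simp)
    also have "\<dots> = 1"
      using centered_normal_integral(3)[OF noise_single[OF D], of "\<lambda>y. exp (y - (L2_norm D)\<^sup>2 / 2)"]
      by (simp add: L2_norm_nonneg std_normal_exp_one)
    finally show "emeasure ?Q (space ?Q) \<noteq> \<infinity>"
      by simp
  qed
  fix A :: "(real ^ 'd \<Rightarrow> real) \<Rightarrow> real set" and J
  assume J: "finite J" "J \<subseteq> L2" and A: "\<And>i. i \<in> J \<Longrightarrow> A i \<in> sets borel"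
  let ?X1 = "\<lambda>h \<omega>. \<alpha> h + c * (W h \<omega> + L2_inner h D)" and ?X2 = "\<lambda>h \<omega>. \<alpha> h + c * W h \<omega>"
  have emb: "prod_emb L2 (\<lambda>_. borel) J (Pi\<^sub>E J A) \<in> sets path_space"
    using J A by (intro sets_PiM_I) auto
  have mem: "(\<lambda>h\<in>L2. X h) \<in> prod_emb L2 (\<lambda>_. borel) J (Pi\<^sub>E J A) \<longleftrightarrow> (\<forall>h\<in>J. X h \<in> A h)" for X
    using J by (auto simp: prod_emb_def PiE_iff subset_eq)
  have "emeasure (distr P path_space ?T1) (prod_emb L2 (\<lambda>_. borel) J (Pi\<^sub>E J A)) =
      emeasure P {\<omega> \<in> space P. \<forall>h\<in>J. ?X1 h \<omega> \<in> A h}"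
    unfolding emeasure_distr[OF T1 emb] by (rule arg_cong[where f = "emeasure P"]) (auto simp: mem)
  also have "\<dots> = emeasure ?Q {\<omega> \<in> space ?Q. \<forall>h\<in>J. ?X2 h \<omega> \<in> A h}"
  proof (rule measure_eqI_cos[OF J(1) finite_measure_axioms Qfin])
    fix t :: "(real ^ 'd \<Rightarrow> real) \<Rightarrow> real" and \<eta> :: real
    let ?H = "\<lambda>x. \<Sum>h\<in>J. (t h * c) * h x" and ?a = "\<Sum>h\<in>J. t h * \<alpha> h"
    have H: "?H \<in> L2"
      using J by (intro L2_sum L2_cmult) auto
    have HD: "L2_inner ?H D = (\<Sum>h\<in>J. (t h * c) * L2_inner h D)"
      using J D by (subst L2_inner_sum_left) (auto simp: L2_inner_cmult_left intro!: L2_cmult)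
    have ae: "AE \<omega> in P. W ?H \<omega> = (\<Sum>h\<in>J. (t h * c) * W h \<omega>)"
      by (rule noise_sum[OF J])
    have [measurable]: "W ?H \<in> borel_measurable P" "\<And>h. h \<in> J \<Longrightarrow> W h \<in> borel_measurable P"
      using H J by auto
    have X1: "(\<Sum>h\<in>J. t h * ?X1 h \<omega>) = (\<Sum>h\<in>J. (t h * c) * W h \<omega>) + L2_inner ?H D + ?a" for \<omega>
      unfolding HD by (simp add: algebra_simps sum.distrib)
    have X2: "(\<Sum>h\<in>J. t h * ?X2 h \<omega>) = (\<Sum>h\<in>J. (t h * c) * W h \<omega>) + ?a" for \<omega>
      by (simp add: algebra_simps sum.distrib)
    have "expectation (\<lambda>\<omega>. cos ((\<Sum>h\<in>J. t h * ?X1 h \<omega>) + \<eta>)) =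
        expectation (\<lambda>\<omega>. cos (W ?H \<omega> + (L2_inner ?H D + ?a + \<eta>)))"
    proof -
      have "AE \<omega> in P. cos ((\<Sum>h\<in>J. t h * c * W h \<omega>) + L2_inner ?H D + ?a + \<eta>) =
          cos (W ?H \<omega> + (L2_inner ?H D + ?a + \<eta>))"
        using ae by eventually_elim (simp add: add.assoc)
      then show ?thesis
        unfolding X1 by (rule integral_cong_AE[rotated 2]) measurable
    qed
    also have "\<dots> = exp (- (L2_norm ?H)\<^sup>2 / 2) * cos (L2_inner ?H D + (?a + \<eta>))"
      using centered_normal_cos[OF noise_single[OF H]] by (simp add: add.assoc)
    also have "\<dots> = expectation (\<lambda>\<omega>. exp (W D \<omega> - (L2_norm D)\<^sup>2 / 2) * cos (W ?H \<omega> + (?a + \<eta>)))"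
      by (rule noise_tilted_cos[OF D H pos, symmetric])
    also have "\<dots> = expectation (\<lambda>\<omega>. exp (W D \<omega> - (L2_norm D)\<^sup>2 / 2) * cos ((\<Sum>h\<in>J. t h * ?X2 h \<omega>) + \<eta>))"
    proof -
      have "AE \<omega> in P. exp (W D \<omega> - (L2_norm D)\<^sup>2 / 2) * cos (W ?H \<omega> + (?a + \<eta>)) =
          exp (W D \<omega> - (L2_norm D)\<^sup>2 / 2) * cos ((\<Sum>h\<in>J. t h * c * W h \<omega>) + ?a + \<eta>)"
        using ae by eventually_elim (simp add: add.assoc)
      then show ?thesis
        unfolding X2 by (rule integral_cong_AE[rotated 2]) measurable
    qed
    also have "\<dots> = (\<integral>\<omega>. cos ((\<Sum>h\<in>J. t h * ?X2 h \<omega>) + \<eta>) \<partial>?Q)"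
      by (subst integral_density) auto
    finally show "(\<integral>\<omega>. cos ((\<Sum>h\<in>J. t h * ?X1 h \<omega>) + \<eta>) \<partial>P) = (\<integral>\<omega>. cos ((\<Sum>h\<in>J. t h * ?X2 h \<omega>) + \<eta>) \<partial>?Q)" .
  qed (use J A in auto)
  also have "\<dots> = emeasure (distr ?Q path_space ?T2) (prod_emb L2 (\<lambda>_. borel) J (Pi\<^sub>E J A))"
    unfolding emeasure_distr[OF T2 emb] by (rule arg_cong[where f = "emeasure ?Q"]) (auto simp: mem)
  finally show "emeasure (distr P path_space ?T1) (prod_emb L2 (\<lambda>_. borel) J (Pi\<^sub>E J A)) =
    emeasure (distr ?Q path_space ?T2) (prod_emb L2 (\<lambda>_. borel) J (Pi\<^sub>E J A))" .
qed simp_all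

end

section \<open>The risk of the net estimator\<close>

locale deconvolution = singular_filter a \<beta> + noise P W
  for a :: "real ^ 'd::finite \<Rightarrow> real" and \<beta> :: "nat ^ 'd \<Rightarrow> nat ^ 'd \<Rightarrow> real"
    and P :: "'w measure" and W :: "(real ^ 'd \<Rightarrow> real) \<Rightarrow> 'w \<Rightarrow> real"
begin

lemma obs_in_path_space: "obs (conv a) W n f \<omega> \<in> space path_space"
  by (simp add: obs_def space_PiM)

lemma net_estimator_oracle:
  fixes n :: nat and \<omega> :: 'w
  assumes f: "f \<in> L2" and S: "S \<subseteq> jk_index" and N: "N \<subseteq> range (phi_sum S)"
    and g: "g \<in> N" and est: "net_estimator (conv a) N fhat"
  defines "h \<equiv> fhat (obs (conv a) W n f \<omega>)"
  shows "h \<in> N" and "(L2_norm (\<lambda>x. h x - f x))\<^sup>2 \<le> (L2_norm (\<lambda>x. g x - f x))\<^sup>2 +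
    2 * ((W (inv_adjoint (conv a) h) \<omega> - W (inv_adjoint (conv a) g) \<omega>) / sqrt (real n))"
proof -
  let ?y = "obs (conv a) W n f \<omega>"
  have am: "is_arg_min (contrast (conv a) ?y) (\<lambda>h. h \<in> N) h"
    using est obs_in_path_space by (simp add: net_estimator_def h_def)
  then show hN: "h \<in> N"
    by (simp add: is_arg_min_def)
  have le: "contrast (conv a) ?y h \<le> contrast (conv a) ?y g"
    using am g by (auto simp: is_arg_min_def not_less)
  \<comment> \<open>The adjoint property replaces
    \<open>L2_inner (conv a f) (inv_adjoint (conv a) u)\<close> by \<open>L2_inner f u\<close>,
    which completes the square. The term \<open>(L2_norm f)\<^sup>2\<close> is common to all
    candidates and cancels when two contrasts are compared.\<close>
  have eq: "contrast (conv a) ?y u = (L2_norm (\<lambda>x. u x - f x))\<^sup>2 - (L2_norm f)\<^sup>2 -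
      2 * (W (inv_adjoint (conv a) u) \<omega> / sqrt (real n))" if "u \<in> N" for u
  proof -
    obtain c where u: "u = phi_sum S c"
      using N \<open>u \<in> N\<close> by auto
    have "?y (inv_adjoint (conv a) u) = L2_inner f u + W (inv_adjoint (conv a) u) \<omega> / sqrt (real n)"
      using inv_adjoint_phi_sum[OF S] f
      by (simp add: obs_def u L2_inner_commute[of "inv_adjoint (conv a) _"])
    then show ?thesis
      using f by (simp add: contrast_def u L2_norm_square_diff phi_sum_L2 L2_inner_commute)
  qed
  show "(L2_norm (\<lambda>x. h x - f x))\<^sup>2 \<le> (L2_norm (\<lambda>x. g x - f x))\<^sup>2 +
    2 * ((W (inv_adjoint (conv a) h) \<omega> - W (inv_adjoint (conv a) g) \<omega>) / sqrt (real n))"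
    using le hN g by (simp add: eq diff_divide_distrib)
qed

text \<open>
  The noise increment is compared with its standard deviation, enlarged by the resolution \<open>\<delta>\<close> to
  keep it positive. The largest of the normalized squares over the net is at most of
  logarithmic order, because their exponential moments are bounded.
\<close>

lemma risk_net_estimator_le:
  assumes f: "f \<in> L2" and S: "finite S" "S \<subseteq> jk_index" and N: "N \<subseteq> range (phi_sum S)" "finite N"
    and g: "g \<in> N" "L2_norm (\<lambda>x. f x - g x) \<le> \<delta>" and est: "net_estimator (conv a) N fhat"
    and \<delta>: "0 < \<delta>" and \<kappa>: "0 < \<kappa>" "\<And>p. p \<in> S \<Longrightarrow> 1 \<le> \<kappa> * (\<beta> (fst p) (snd p))\<^sup>2"
    and n: "n \<ge> 1"
  shows "risk (conv a) P W n fhat f \<le>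
    ennreal (4 * \<delta>\<^sup>2 + 32 * \<kappa> / real n * (ln (real (card N)) + 2))"
proof -
  let ?Q = "inv_adjoint (conv a)"
  let ?m = "real (card N)"
  define Z where "Z h \<omega> = W (?Q h) \<omega> - W (?Q g) \<omega>" for h \<omega>
  define \<tau> where "\<tau> h = \<kappa> * ((L2_norm (\<lambda>x. h x - g x))\<^sup>2 + \<delta>\<^sup>2)" for h
  have m: "?m \<ge> 1"
    using N(2) g(1) by (metis One_nat_def Suc_leI card_gt_0_iff empty_iff of_nat_1 of_nat_le_iff)
  have \<tau>: "\<tau> h > 0" for h
    unfolding \<tau>_def using \<kappa>(1) \<delta> by (intro mult_pos_pos add_nonneg_pos) auto
  have QL2: "?Q h \<in> L2" if "h \<in> N" for h
    using N(1) that inv_adjoint_phi_sum(1)[OF S(2)] by auto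
  have NL2: "h \<in> L2" if "h \<in> N" for h
    using N(1) that phi_sum_L2 by auto
  have Zmeas [measurable]: "Z h \<in> borel_measurable P" if "h \<in> N" for h
    unfolding Z_def[abs_def] using QL2[OF that] QL2[OF g(1)] by measurable
  have Zexp: "(\<integral>\<^sup>+\<omega>. ennreal (exp ((Z h \<omega>)\<^sup>2 / (4 * \<tau> h))) \<partial>P) \<le> ennreal (sqrt 2)" if h: "h \<in> N" for h
  proof (rule centered_normal_exp_square_le)
    show "centered_normal P (Z h) ((L2_norm (\<lambda>x. ?Q h x - ?Q g x))\<^sup>2)"
      using noise_pair[OF QL2[OF h] QL2[OF g(1)], of 1 "- 1"] by (simp add: Z_def[abs_def])
    obtain c c' where "h = phi_sum S c" "g = phi_sum S c'"
      using N(1) h g(1) by blast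
    then have "(L2_norm (\<lambda>x. ?Q h x - ?Q g x))\<^sup>2 \<le> \<kappa> * (L2_norm (\<lambda>x. h x - g x))\<^sup>2"
      using inv_adjoint_norm_diff[OF S \<kappa>(2)] by simp
    also have "\<dots> \<le> \<tau> h"
      using \<kappa>(1) by (simp add: \<tau>_def)
    finally show "(L2_norm (\<lambda>x. ?Q h x - ?Q g x))\<^sup>2 \<le> \<tau> h" .
  qed (use \<tau> in auto)
  \<comment> \<open>It dominates \<open>(Z h \<omega>)\<^sup>2 / \<tau> h\<close> simultaneously for
    all \<open>h\<close> in the net, since \<open>z - ln m \<le> exp z / m\<close>, and its mean is
    at most \<open>4 * ln m + 4 * sqrt 2\<close>.\<close>
  let ?\<Xi> = "\<lambda>\<omega>. 4 * ln ?m + 4 / ?m * (\<Sum>h\<in>N. exp ((Z h \<omega>)\<^sup>2 / (4 * \<tau> h)))"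
  have bound: "(L2_norm (\<lambda>x. fhat (obs (conv a) W n f \<omega>) x - f x))\<^sup>2 \<le> 4 * \<delta>\<^sup>2 + 8 * \<kappa> / real n * ?\<Xi> \<omega>" for \<omega>
  proof -
    define h where "h = fhat (obs (conv a) W n f \<omega>)"
    note o = net_estimator_oracle[OF f S(2) N(1) g(1) est, of n \<omega>, folded h_def Z_def]
    let ?e = "(L2_norm (\<lambda>x. h x - f x))\<^sup>2" and ?x = "Z h \<omega> / sqrt (real n)"
    have gf: "(L2_norm (\<lambda>x. g x - f x))\<^sup>2 \<le> \<delta>\<^sup>2"
      using g(2) L2_norm_nonneg by (subst L2_norm_minus_commute) (intro power_mono)
    have hg: "(L2_norm (\<lambda>x. h x - g x))\<^sup>2 \<le> 2 * ?e + 2 * \<delta>\<^sup>2"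
      using L2_norm_diff_square_le[OF NL2[OF o(1)] NL2[OF g(1)] f] gf L2_norm_minus_commute[of f g]
      by simp
    have amgm: "2 * x \<le> p + x\<^sup>2 / p" if "p > 0" for x p :: real
    proof -
      have "0 \<le> (p - x)\<^sup>2 / p"
        using that by simp
      also have "\<dots> = p + x\<^sup>2 / p - 2 * x"
        using that by (simp add: power2_eq_square field_simps)
      finally show ?thesis by simp
    qed
    \<comment> \<open>Completing the square with weight \<open>\<tau> h / (4 * \<kappa>)\<close>
      leaves only a quarter of the squared distance of \<open>h\<close> to \<open>g\<close>, small
      enough to be absorbed below.\<close>
    have "2 * ?x \<le> \<tau> h / (4 * \<kappa>) + ?x\<^sup>2 / (\<tau> h / (4 * \<kappa>))"
      using \<tau>[of h] \<kappa>(1) by (intro amgm) simp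
    also have "?x\<^sup>2 / (\<tau> h / (4 * \<kappa>)) = 4 * \<kappa> / real n * ((Z h \<omega>)\<^sup>2 / \<tau> h)"
      using n by (simp add: power_divide)
    also have "\<tau> h / (4 * \<kappa>) = ((L2_norm (\<lambda>x. h x - g x))\<^sup>2 + \<delta>\<^sup>2) / 4"
      using \<kappa>(1) by (simp add: \<tau>_def)
    finally have x: "2 * ?x \<le> ((L2_norm (\<lambda>x. h x - g x))\<^sup>2 + \<delta>\<^sup>2) / 4 + 4 * \<kappa> / real n * ((Z h \<omega>)\<^sup>2 / \<tau> h)" .
    have "(Z h \<omega>)\<^sup>2 / \<tau> h \<le> ?\<Xi> \<omega>"
    proof -
      let ?z = "(Z h \<omega>)\<^sup>2 / (4 * \<tau> h)"
      have "?z - ln ?m \<le> exp (?z - ln ?m)"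
        using exp_ge_add_one_self[of "?z - ln ?m"] by linarith
      also have "\<dots> = exp ?z / ?m"
        using m by (simp add: exp_diff)
      also have "\<dots> \<le> (\<Sum>h\<in>N. exp ((Z h \<omega>)\<^sup>2 / (4 * \<tau> h))) / ?m"
        using o(1) N(2) by (intro divide_right_mono member_le_sum) auto
      finally show ?thesis
        using \<tau>[of h] by (simp add: field_simps)
    qed
    then have "4 * \<kappa> / real n * ((Z h \<omega>)\<^sup>2 / \<tau> h) \<le> 4 * \<kappa> / real n * ?\<Xi> \<omega>"
      using \<kappa>(1) by (intro mult_left_mono) auto
    \<comment> \<open>As the squared distance of \<open>h\<close> to \<open>g\<close> is at most
      \<open>2 * ?e + 2 * \<delta>\<^sup>2\<close>, the quarter puts \<open>?e / 2\<close> on the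
      right; moving it to the left doubles the rest.\<close>
    then have "?e \<le> \<delta>\<^sup>2 + ((2 * ?e + 2 * \<delta>\<^sup>2 + \<delta>\<^sup>2) / 4 + 4 * \<kappa> / real n * ?\<Xi> \<omega>)"
    proof -
      have "e \<le> d + ((2 * e + 2 * d + d) / 4 + t')"
        if "e \<le> c + 2 * x" "c \<le> d" "b \<le> 2 * e + 2 * d" "2 * x \<le> (b + d) / 4 + t" "t \<le> t'"
        for e c x d b t t' :: real
        using that by argo
      from this[OF o(2) gf hg x] show ?thesis
        using \<open>4 * \<kappa> / real n * ((Z h \<omega>)\<^sup>2 / \<tau> h) \<le> 4 * \<kappa> / real n * ?\<Xi> \<omega>\<close> by blast
    qed
    then have "?e \<le> 4 * \<delta>\<^sup>2 + 2 * (4 * \<kappa> / real n * ?\<Xi> \<omega>)"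
    proof -
      have "e \<le> 4 * d + 2 * t" if "e \<le> d + ((2 * e + 2 * d + d) / 4 + t)" "0 \<le> d" for e d t :: real
        using that by argo
      from this[OF \<open>?e \<le> \<delta>\<^sup>2 + _\<close>] show ?thesis
        by simp
    qed
    then show ?thesis
      by (simp add: h_def)
  qed
  have ln0: "0 \<le> ln ?m"
    using m by simp
  let ?A = "4 * \<delta>\<^sup>2 + 8 * \<kappa> / real n * (4 * ln ?m)" and ?B = "8 * \<kappa> / real n * (4 / ?m)"
  have AB: "0 \<le> ?A" "0 \<le> ?B"
    using \<kappa>(1) ln0 by auto
  have "risk (conv a) P W n fhat f \<le> (\<integral>\<^sup>+\<omega>. ennreal ?A + ennreal ?B * (\<Sum>h\<in>N. ennreal (exp ((Z h \<omega>)\<^sup>2 / (4 * \<tau> h)))) \<partial>P)"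
    unfolding risk_def
  proof (rule nn_integral_mono)
    fix \<omega>
    have "ennreal ?A + ennreal ?B * (\<Sum>h\<in>N. ennreal (exp ((Z h \<omega>)\<^sup>2 / (4 * \<tau> h)))) =
        ennreal (?A + ?B * (\<Sum>h\<in>N. exp ((Z h \<omega>)\<^sup>2 / (4 * \<tau> h))))"
    proof -
      have "ennreal A + ennreal B * (\<Sum>h\<in>N. ennreal (E h)) = ennreal (A + B * (\<Sum>h\<in>N. E h))"
        if "0 \<le> A" "0 \<le> B" "\<And>h. 0 \<le> E h" for A B and E :: "(real ^ 'd \<Rightarrow> real) \<Rightarrow> real"
        using that by (simp add: sum_ennreal sum_nonneg ennreal_plus ennreal_mult)
      from this[OF AB] show ?thesis
        by simp
    qed
    moreover have "?A + ?B * (\<Sum>h\<in>N. exp ((Z h \<omega>)\<^sup>2 / (4 * \<tau> h))) = 4 * \<delta>\<^sup>2 + 8 * \<kappa> / real n * ?\<Xi> \<omega>"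
      by (simp add: distrib_left)
    ultimately show "ennreal ((L2_norm (\<lambda>x. fhat (obs (conv a) W n f \<omega>) x - f x))\<^sup>2) \<le>
        ennreal ?A + ennreal ?B * (\<Sum>h\<in>N. ennreal (exp ((Z h \<omega>)\<^sup>2 / (4 * \<tau> h))))"
      using ennreal_leI[OF bound[of \<omega>]] by (simp only:)
  qed
  also have "\<dots> = ennreal ?A + ennreal ?B * (\<Sum>h\<in>N. \<integral>\<^sup>+\<omega>. ennreal (exp ((Z h \<omega>)\<^sup>2 / (4 * \<tau> h))) \<partial>P)"
  proof -
    have "(\<integral>\<^sup>+\<omega>. A + B * (\<Sum>h\<in>N. G h \<omega>) \<partial>P) = A + B * (\<Sum>h\<in>N. \<integral>\<^sup>+\<omega>. G h \<omega> \<partial>P)"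
      if "\<And>h. h \<in> N \<Longrightarrow> G h \<in> borel_measurable P" for A B and G :: "(real ^ 'd \<Rightarrow> real) \<Rightarrow> 'w \<Rightarrow> ennreal"
      using that by (subst nn_integral_add) (auto simp: nn_integral_cmult nn_integral_sum emeasure_space_1)
    then show ?thesis
      by this measurable
  qed
  also have "\<dots> \<le> ennreal ?A + ennreal ?B * (\<Sum>h\<in>N. ennreal (sqrt 2))"
    using Zexp by (intro add_left_mono mult_left_mono sum_mono) auto
  also have "(\<Sum>h\<in>N. ennreal (sqrt 2)) = ennreal (?m * sqrt 2)"
    by (simp add: ennreal_mult ennreal_of_nat_eq_real_of_nat)
  also have "ennreal ?A + ennreal ?B * ennreal (?m * sqrt 2) = ennreal (?A + ?B * (?m * sqrt 2))"
  proof -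
    have "ennreal A + ennreal B * ennreal C = ennreal (A + B * C)" if "0 \<le> A" "0 \<le> B" "0 \<le> C" for A B C
      using that by (simp add: ennreal_plus ennreal_mult)
    from this[OF AB] show ?thesis
      by simp
  qed
  also have "\<dots> \<le> ennreal (4 * \<delta>\<^sup>2 + 32 * \<kappa> / real n * (ln ?m + 2))"
  proof (rule ennreal_leI)
    have "?A + ?B * (?m * sqrt 2) = 4 * \<delta>\<^sup>2 + 32 * \<kappa> / real n * (ln ?m + sqrt 2)"
      using m by (simp add: field_simps flip: add_divide_distrib)
    also have "\<dots> \<le> 4 * \<delta>\<^sup>2 + 32 * \<kappa> / real n * (ln ?m + 2)"
      using \<kappa>(1) sqrt2_less_2 by (intro add_left_mono mult_left_mono) auto
    finally show "?A + ?B * (?m * sqrt 2) \<le> 4 * \<delta>\<^sup>2 + 32 * \<kappa> / real n * (ln ?m + 2)" .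
  qed
  finally show ?thesis .
qed

end

section \<open>The minimax lower bound\<close>

lemma L2_inner_estimator_measurable:
  assumes "g \<in> estimators" "h \<in> L2"
  shows "(\<lambda>y. L2_inner (g y) h) \<in> borel_measurable path_space"
  using measurable_compose[OF _ L2_inner_borel_measurable[OF assms(2)], of g path_space] assms(1)
  by (simp add: estimators_def)

lemma estimator_L2:
  assumes "g \<in> estimators" "y \<in> space path_space"
  shows "g y \<in> L2"
proof -
  have "space (L2_borel :: (real ^ 'a \<Rightarrow> real) measure) = L2"
    unfolding L2_borel_def by (rule space_measure_of) auto
  then show ?thesis
    using assms measurable_space[of g path_space L2_borel] by (auto simp: estimators_def)
qed

text \<open>The residual of the projection has nonnegative squared norm. The assumption
  \<open>unit\<close> selects those \<open>phi\<close> that are normalised.\<close>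

lemma bessel_inequality:
  assumes S: "finite S" "S \<subseteq> jk_index" and u: "u \<in> L2"
    and unit: "\<And>p. p \<in> S \<Longrightarrow> L2_inner (phi (fst p) (snd p)) (phi (fst p) (snd p)) = 1"
  shows "(\<Sum>p\<in>S. (L2_inner u (phi (fst p) (snd p)))\<^sup>2) \<le> (L2_norm u)\<^sup>2"
proof -
  let ?c = "\<lambda>p. L2_inner u (phi (fst p) (snd p))"
  have "0 \<le> (L2_norm (\<lambda>x. u x - phi_sum S ?c x))\<^sup>2"
    by simp
  also have "\<dots> = (L2_norm u)\<^sup>2 - (\<Sum>p\<in>S. (?c p)\<^sup>2)"
  proof -
    have "L2_inner u (phi_sum S ?c) = (\<Sum>p\<in>S. (?c p)\<^sup>2)"
      using u by (simp add: L2_inner_phi_sum power2_eq_square)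
    moreover have "L2_inner (phi_sum S ?c) (phi_sum S ?c) = (\<Sum>p\<in>S. (?c p)\<^sup>2)"
      using S unit by (simp add: phi_sum_inner power2_eq_square)
    ultimately show ?thesis
      using u by (simp add: L2_norm_square_diff phi_sum_L2 L2_norm_square[of "phi_sum S ?c"])
  qed
  finally show ?thesis by simp
qed

text \<open>Pairs the vertices of the sign cube that differ exactly in the sign at
  \<open>p\<close>.\<close>

lemma sum_Pow_split:
  assumes "finite S" "p \<in> S"
  shows "(\<Sum>A\<in>Pow S. F A) = (\<Sum>A\<in>Pow (S - {p}). F A + F (insert p A))"
proof -
  have "Pow S = Pow (S - {p}) \<union> insert p ` Pow (S - {p})"
    using Pow_insert[of p "S - {p}"] assms(2) by (simp add: insert_absorb)
  moreover have "Pow (S - {p}) \<inter> insert p ` Pow (S - {p}) = {}"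
    by auto
  moreover have "inj_on (insert p) (Pow (S - {p}))"
    by (auto simp: inj_on_def)
  ultimately show ?thesis
    using assms(1) by (simp add: sum.union_disjoint sum.reindex sum.distrib)
qed

text \<open>Sign vectors are encoded by the sets of their positive entries, so that flipping a sign
  from minus to plus is \<open>insert\<close>.\<close>

definition sign_pattern :: "real \<Rightarrow> 'a set \<Rightarrow> 'a \<Rightarrow> real" where
  "sign_pattern \<tau> A p = (if p \<in> A then \<tau> else - \<tau>)"

text \<open>With coefficients extended by zero, the partial sums over every finite index set
  containing \<open>S\<close> are equal to the function, so the expansion converges
  trivially.\<close>

lemma phi_sum_in_fun_class:
  assumes S: "finite S" "S \<subseteq> jk_index"
    and le: "(\<Sum>p\<in>S. (w (fst p) (snd p))\<^sup>2 * (c p)\<^sup>2) \<le> L\<^sup>2"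
  shows "phi_sum S c \<in> fun_class w L"
proof -
  let ?\<theta> = "\<lambda>j k. if (j, k) \<in> S then c (j, k) else 0"
  let ?t = "\<lambda>(j, k). (w j k)\<^sup>2 * (?\<theta> j k)\<^sup>2"
  have sum: "(\<Sum>p\<in>S. ?t p) \<le> L\<^sup>2"
    using le by (simp add: case_prod_beta cong: sum.cong)
  have hs: "(?t has_sum (\<Sum>p\<in>S. ?t p)) jk_index"
    using S by (intro has_sum_finite_neutralI) (auto split: if_splits)
  have "?\<theta> \<in> ellipsoid w L"
    using has_sum_imp_summable[OF hs] infsumI[OF hs] sum by (simp add: ellipsoid_def)
  moreover have "L2_expansion (phi_sum S c) ?\<theta>"
    unfolding L2_expansion_def
  proof
    have "L2_norm (\<lambda>x. phi_sum S c x - (\<Sum>(j, k)\<in>S'. ?\<theta> j k * phi j k x)) = 0"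
      if "finite S'" "S \<subseteq> S'" for S'
    proof -
      have "(\<Sum>(j, k)\<in>S'. ?\<theta> j k * phi j k x) = phi_sum S c x" for x
      proof -
        have "(\<Sum>(j, k)\<in>S'. ?\<theta> j k * phi j k x) = (\<Sum>(j, k)\<in>S. ?\<theta> j k * phi j k x)"
          using that by (intro sum.mono_neutral_right) auto
        then show ?thesis
          by (simp add: phi_sum_def case_prod_beta cong: sum.cong)
      qed
      then show ?thesis
        by (simp add: L2_norm_def L2_inner_def)
    qed
    then have "\<forall>\<^sub>F S' in finite_subsets_at_top jk_index.
        L2_norm (\<lambda>x. phi_sum S c x - (\<Sum>(j, k)\<in>S'. ?\<theta> j k * phi j k x)) = 0"
      using S by (auto simp: eventually_finite_subsets_at_top)
    then show "((\<lambda>S'. L2_norm (\<lambda>x. phi_sum S c x - (\<Sum>(j, k)\<in>S'. ?\<theta> j k * phi j k x))) \<longlongrightarrow> 0)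
        (finite_subsets_at_top jk_index)"
      by (rule tendsto_eventually)
  qed (rule phi_sum_L2)
  ultimately show ?thesis
    unfolding fun_class_def by blast
qed

context deconvolution
begin

section \<open>Comparison of two signals\<close>

lemma obs_measurable: "obs (conv a) W n f \<in> P \<rightarrow>\<^sub>M path_space"
  unfolding obs_def by (intro measurable_restrict) measurable

text \<open>\<open>W D\<close> and \<open>- W D\<close> have the same law, and the events
  \<open>0 \<le> W D\<close> and \<open>W D \<le> 0\<close> cover the space. Equality to zero is
  allowed, so a degenerate law does no harm.\<close>

lemma noise_nonneg_prob:
  assumes D: "D \<in> L2"
  shows "1 / 2 \<le> prob {\<omega> \<in> space P. 0 \<le> W D \<omega>}"
proof -
  note [measurable] = noise_measurable[OF D]
  let ?v = "(L2_norm D)\<^sup>2"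
  have n1: "centered_normal P (W D) ?v" and n2: "centered_normal P (\<lambda>\<omega>. - W D \<omega>) ?v"
    using noise_single[OF D] noise_pair[OF D D, of "- 1" 0] L2_norm_square_cmult[of "- 1" D] by simp_all
  have "prob {\<omega> \<in> space P. 0 \<le> W D \<omega>} = measure (distr P borel (W D)) {0..}"
    by (subst measure_distr) (auto intro!: arg_cong[where f = prob])
  also have "\<dots> = measure (distr P borel (\<lambda>\<omega>. - W D \<omega>)) {0..}"
    using centered_normal_distr[OF n1] centered_normal_distr[OF n2] by simp
  also have "\<dots> = prob {\<omega> \<in> space P. W D \<omega> \<le> 0}"
    by (subst measure_distr) (auto intro!: arg_cong[where f = prob])
  finally have "2 * prob {\<omega> \<in> space P. 0 \<le> W D \<omega>} =
      prob {\<omega> \<in> space P. 0 \<le> W D \<omega>} + prob {\<omega> \<in> space P. W D \<omega> \<le> 0}"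
    by simp
  also have "\<dots> \<ge> prob ({\<omega> \<in> space P. 0 \<le> W D \<omega>} \<union> {\<omega> \<in> space P. W D \<omega> \<le> 0})"
    by (rule measure_Un_le) measurable
  also have "{\<omega> \<in> space P. 0 \<le> W D \<omega>} \<union> {\<omega> \<in> space P. W D \<omega> \<le> 0} = space P"
    by auto
  finally show ?thesis
    by (simp add: prob_space)
qed

text \<open>\<open>D\<close> is the difference of the means in units of the noise level: the
  observation under \<open>f1\<close> arises from that under \<open>f0\<close> by replacing
  \<open>W h\<close> with \<open>W h + L2_inner h D\<close>.\<close>

lemma obs_change_of_measure:
  assumes n: "n \<ge> 1" and f: "f0 \<in> L2" "f1 \<in> L2"
  defines "D \<equiv> \<lambda>x. sqrt (real n) * (conv a f1 x - conv a f0 x)"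
  assumes pos: "L2_norm D > 0" and G: "G \<in> borel_measurable path_space"
  shows "(\<integral>\<^sup>+\<omega>. G (obs (conv a) W n f1 \<omega>) \<partial>P) =
    (\<integral>\<^sup>+\<omega>. ennreal (exp (W D \<omega> - (L2_norm D)\<^sup>2 / 2)) * G (obs (conv a) W n f0 \<omega>) \<partial>P)"
proof -
  have D: "D \<in> L2"
    unfolding D_def using f by (intro L2_cmult L2_diff conv_L2)
  note [measurable] = noise_measurable[OF D]
  have o0: "obs (conv a) W n f0 = (\<lambda>\<omega>. \<lambda>h\<in>L2. L2_inner h (conv a f0) + (1 / sqrt (real n)) * W h \<omega>)"
    by (auto simp: obs_def)
  have o1: "obs (conv a) W n f1 =
      (\<lambda>\<omega>. \<lambda>h\<in>L2. L2_inner h (conv a f0) + (1 / sqrt (real n)) * (W h \<omega> + L2_inner h D))"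
  proof (intro ext)
    fix \<omega> h
    have "L2_inner h D = sqrt (real n) * (L2_inner h (conv a f1) - L2_inner h (conv a f0))" if "h \<in> L2"
      unfolding D_def L2_inner_cmult_right using that f by (simp add: L2_inner_diff_right conv_L2)
    then show "obs (conv a) W n f1 \<omega> h =
        (\<lambda>h\<in>L2. L2_inner h (conv a f0) + (1 / sqrt (real n)) * (W h \<omega> + L2_inner h D)) h"
      using n by (auto simp: obs_def restrict_def add_divide_distrib)
  qed
  let ?Q = "density P (\<lambda>\<omega>. ennreal (exp (W D \<omega> - (L2_norm D)\<^sup>2 / 2)))"
  have eq: "distr P path_space (obs (conv a) W n f1) = distr ?Q path_space (obs (conv a) W n f0)"
    unfolding o0 o1 by (rule cameron_martin[OF D pos])
  have "(\<integral>\<^sup>+\<omega>. G (obs (conv a) W n f1 \<omega>) \<partial>P) = (\<integral>\<^sup>+y. G y \<partial>distr P path_space (obs (conv a) W n f1))"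
    using obs_measurable G by (simp add: nn_integral_distr)
  also have "\<dots> = (\<integral>\<^sup>+\<omega>. G (obs (conv a) W n f0 \<omega>) \<partial>?Q)"
    unfolding eq using obs_measurable[of n f0] G by (subst nn_integral_distr) auto
  also have "\<dots> = (\<integral>\<^sup>+\<omega>. ennreal (exp (W D \<omega> - (L2_norm D)\<^sup>2 / 2)) * G (obs (conv a) W n f0 \<omega>) \<partial>P)"
    using measurable_compose[OF obs_measurable[of n f0] G] by (subst nn_integral_density) auto
  finally show ?thesis .
qed

text \<open>Where \<open>W D\<close> is nonnegative, the likelihood ratio is at least
  \<open>exp (- V / 2)\<close>. Since \<open>(y + \<tau>)\<^sup>2 + (y - \<tau>)\<^sup>2 \<ge> 2 *
  \<tau>\<^sup>2\<close>, no statistic can be close to both \<open>- \<tau>\<close> and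
  \<open>\<tau>\<close> there, and this event has probability at least one half.\<close>

lemma two_point_bound:
  assumes n: "n \<ge> 1" and f: "f0 \<in> L2" "f1 \<in> L2"
  defines "D \<equiv> \<lambda>x. sqrt (real n) * (conv a f1 x - conv a f0 x)"
  assumes D: "L2_norm D > 0" "(L2_norm D)\<^sup>2 \<le> V" and X: "X \<in> borel_measurable path_space"
  shows "ennreal (\<tau>\<^sup>2 * exp (- V / 2)) \<le>
    (\<integral>\<^sup>+\<omega>. ennreal ((X (obs (conv a) W n f0 \<omega>) + \<tau>)\<^sup>2) \<partial>P) +
    (\<integral>\<^sup>+\<omega>. ennreal ((X (obs (conv a) W n f1 \<omega>) - \<tau>)\<^sup>2) \<partial>P)"
proof -
  have DL2: "D \<in> L2"
    unfolding D_def using f by (intro L2_cmult L2_diff conv_L2)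
  note [measurable] = noise_measurable[OF DL2]
  let ?Y = "\<lambda>\<omega>. X (obs (conv a) W n f0 \<omega>)"
  let ?E = "{\<omega> \<in> space P. 0 \<le> W D \<omega>}"
  have [measurable]: "?Y \<in> borel_measurable P"
    by (rule measurable_compose[OF obs_measurable X])
  have G: "(\<lambda>y. ennreal ((X y - \<tau>)\<^sup>2)) \<in> borel_measurable path_space"
    using X by measurable
  have "ennreal (\<tau>\<^sup>2 * exp (- V / 2)) \<le> ennreal (2 * \<tau>\<^sup>2 * exp (- V / 2)) * ennreal (1 / 2)"
    by (subst ennreal_mult[symmetric]) auto
  also have "\<dots> \<le> ennreal (2 * \<tau>\<^sup>2 * exp (- V / 2)) * emeasure P ?E"
    unfolding emeasure_eq_measure using ennreal_leI[OF noise_nonneg_prob[OF DL2]]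
    by (rule mult_left_mono) simp
  also have "\<dots> = (\<integral>\<^sup>+\<omega>. ennreal (2 * \<tau>\<^sup>2 * exp (- V / 2)) * indicator ?E \<omega> \<partial>P)"
    by (subst nn_integral_cmult_indicator) measurable
  also have "\<dots> \<le> (\<integral>\<^sup>+\<omega>. ennreal ((?Y \<omega> + \<tau>)\<^sup>2) +
      ennreal (exp (W D \<omega> - (L2_norm D)\<^sup>2 / 2)) * ennreal ((?Y \<omega> - \<tau>)\<^sup>2) \<partial>P)"
  proof (rule nn_integral_mono)
    fix \<omega>
    let ?y = "?Y \<omega>" and ?l = "exp (W D \<omega> - (L2_norm D)\<^sup>2 / 2)"
    have le: "2 * \<tau>\<^sup>2 * exp (- V / 2) \<le> (?y + \<tau>)\<^sup>2 + ?l * (?y - \<tau>)\<^sup>2" if "0 \<le> W D \<omega>"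
    proof -
      have V: "exp (- V / 2) \<le> 1"
        using order_trans[OF zero_le_power2 D(2)] by simp
      have l: "exp (- V / 2) \<le> ?l"
        using that D(2) by simp
      have "2 * \<tau>\<^sup>2 \<le> (?y + \<tau>)\<^sup>2 + (?y - \<tau>)\<^sup>2"
        by (simp add: power2_sum power2_diff)
      then have "2 * \<tau>\<^sup>2 * exp (- V / 2) \<le> ((?y + \<tau>)\<^sup>2 + (?y - \<tau>)\<^sup>2) * exp (- V / 2)"
        by (rule mult_right_mono) simp
      also have "\<dots> = (?y + \<tau>)\<^sup>2 * exp (- V / 2) + exp (- V / 2) * (?y - \<tau>)\<^sup>2"
        by (simp add: algebra_simps)
      also have "\<dots> \<le> (?y + \<tau>)\<^sup>2 + ?l * (?y - \<tau>)\<^sup>2"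
        using V l by (intro add_mono mult_left_le mult_right_mono) auto
      finally show ?thesis .
    qed
    have eq: "ennreal ((?y + \<tau>)\<^sup>2) + ennreal ?l * ennreal ((?y - \<tau>)\<^sup>2) =
        ennreal ((?y + \<tau>)\<^sup>2 + ?l * (?y - \<tau>)\<^sup>2)"
      by (simp add: ennreal_mult ennreal_plus)
    show "ennreal (2 * \<tau>\<^sup>2 * exp (- V / 2)) * indicator ?E \<omega> \<le>
        ennreal ((?y + \<tau>)\<^sup>2) + ennreal ?l * ennreal ((?y - \<tau>)\<^sup>2)"
    proof (cases "\<omega> \<in> ?E")
      case True
      then have "0 \<le> W D \<omega>"
        by simp
      from ennreal_leI[OF le[OF this]] True show ?thesis
        unfolding eq by (simp only: indicator_simps mult_1_right)
    qed simp
  qed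
  also have "\<dots> = (\<integral>\<^sup>+\<omega>. ennreal ((?Y \<omega> + \<tau>)\<^sup>2) \<partial>P) +
      (\<integral>\<^sup>+\<omega>. ennreal (exp (W D \<omega> - (L2_norm D)\<^sup>2 / 2)) * ennreal ((?Y \<omega> - \<tau>)\<^sup>2) \<partial>P)"
    by (rule nn_integral_add) measurable
  also have "(\<integral>\<^sup>+\<omega>. ennreal (exp (W D \<omega> - (L2_norm D)\<^sup>2 / 2)) * ennreal ((?Y \<omega> - \<tau>)\<^sup>2) \<partial>P) =
      (\<integral>\<^sup>+\<omega>. ennreal ((X (obs (conv a) W n f1 \<omega>) - \<tau>)\<^sup>2) \<partial>P)"
    by (rule obs_change_of_measure[OF n f, folded D_def, OF D(1) G, symmetric])
  finally show ?thesis .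
qed

text \<open>
  Assouad's argument: flipping one sign changes the mean of the observation so little that the
  sign cannot be recovered, and by Bessel's inequality the errors in the coordinates add up.
\<close>

lemma assouad:
  assumes n: "n \<ge> 1" and S: "finite S" "S \<subseteq> jk_index" and \<tau>: "\<tau> > 0"
    and unit: "\<And>p. p \<in> S \<Longrightarrow> L2_inner (phi (fst p) (snd p)) (phi (fst p) (snd p)) = 1"
    and V: "\<And>p. p \<in> S \<Longrightarrow> 4 * real n * \<tau>\<^sup>2 * (\<beta> (fst p) (snd p))\<^sup>2 \<le> V"
    and F: "\<And>A. A \<subseteq> S \<Longrightarrow> phi_sum S (sign_pattern \<tau> A) \<in> F" and g: "g \<in> estimators"
  shows "ennreal (real (card S) * \<tau>\<^sup>2 * exp (- V / 2) / 2) \<le> (SUP f\<in>F. risk (conv a) P W n g f)"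
proof -
  let ?f = "\<lambda>A. phi_sum S (sign_pattern \<tau> A)"
  let ?X = "\<lambda>p y. L2_inner (g y) (phi (fst p) (snd p))"
  let ?o = "\<lambda>A. obs (conv a) W n (?f A)"
  let ?r = "\<lambda>p A. \<integral>\<^sup>+\<omega>. ennreal ((?X p (?o A \<omega>) - sign_pattern \<tau> A p)\<^sup>2) \<partial>P"
  have X: "?X p \<in> borel_measurable path_space" for p
    by (rule L2_inner_estimator_measurable[OF g phi_L2])
  have risk: "(\<Sum>p\<in>S. ?r p A) \<le> risk (conv a) P W n g (?f A)" for A
  proof -
    have [measurable]: "(\<lambda>\<omega>. ?X p (?o A \<omega>)) \<in> borel_measurable P" for p
      by (rule measurable_compose[OF obs_measurable X])
    have "(\<Sum>p\<in>S. ?r p A) = (\<integral>\<^sup>+\<omega>. (\<Sum>p\<in>S. ennreal ((?X p (?o A \<omega>) - sign_pattern \<tau> A p)\<^sup>2)) \<partial>P)"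
      by (subst nn_integral_sum) auto
    also have "\<dots> \<le> risk (conv a) P W n g (?f A)"
      unfolding risk_def
    proof (rule nn_integral_mono)
      fix \<omega>
      let ?u = "\<lambda>x. g (?o A \<omega>) x - ?f A x"
      have gL2: "g (?o A \<omega>) \<in> L2"
        using g obs_in_path_space by (rule estimator_L2)
      have u: "?u \<in> L2"
        by (rule L2_diff[OF gL2 phi_sum_L2])
      have "?X p (?o A \<omega>) - sign_pattern \<tau> A p = L2_inner ?u (phi (fst p) (snd p))" if "p \<in> S" for p
        using phi_sum_inner_phi[OF S that] unit[OF that]
        by (simp add: L2_inner_diff_left gL2 phi_sum_L2 phi_L2)
      then have "(\<Sum>p\<in>S. (?X p (?o A \<omega>) - sign_pattern \<tau> A p)\<^sup>2) \<le> (L2_norm ?u)\<^sup>2"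
        using bessel_inequality[OF S u unit] by simp
      then show "(\<Sum>p\<in>S. ennreal ((?X p (?o A \<omega>) - sign_pattern \<tau> A p)\<^sup>2)) \<le> ennreal ((L2_norm ?u)\<^sup>2)"
        by (simp add: sum_ennreal ennreal_leI)
    qed
    finally show ?thesis .
  qed
  have pair: "ennreal (\<tau>\<^sup>2 * exp (- V / 2)) \<le> ?r p A + ?r p (insert p A)" if p: "p \<in> S" "A \<subseteq> S - {p}" for p A
  proof -
    let ?D = "\<lambda>x. sqrt (real n) * (conv a (?f (insert p A)) x - conv a (?f A) x)"
    have pK: "snd p \<in> K (fst p)"
      using S(2) p(1) by (auto simp: jk_index_def)
    have "conv a (?f (insert p A)) x - conv a (?f A) x = 2 * \<tau> * conv a (phi (fst p) (snd p)) x" for x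
    proof -
      have "conv a (?f (insert p A)) x - conv a (?f A) x =
          (\<Sum>p'\<in>S. (sign_pattern \<tau> (insert p A) p' - sign_pattern \<tau> A p') * conv a (phi (fst p') (snd p')) x)"
        unfolding conv_phi_sum by (simp add: sum_subtractf left_diff_distrib)
      also have "\<dots> = (\<Sum>p'\<in>{p}. (sign_pattern \<tau> (insert p A) p' - sign_pattern \<tau> A p') * conv a (phi (fst p') (snd p')) x)"
        using S(1) p by (intro sum.mono_neutral_right) (auto simp: sign_pattern_def)
      also have "\<dots> = 2 * \<tau> * conv a (phi (fst p) (snd p)) x"
        using p(2) by (auto simp: sign_pattern_def)
      finally show ?thesis .
    qed
    then have D: "?D = (\<lambda>x. (2 * \<tau> * sqrt (real n)) * conv a (phi (fst p) (snd p)) x)"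
      by (auto simp: mult_ac)
    have "(L2_norm (conv a (phi (fst p) (snd p))))\<^sup>2 = (\<beta> (fst p) (snd p))\<^sup>2"
      using conv_inner_phi[OF phi_L2 pK] unit[OF p(1)] by (simp add: L2_norm_square)
    then have D2: "(L2_norm ?D)\<^sup>2 = 4 * real n * \<tau>\<^sup>2 * (\<beta> (fst p) (snd p))\<^sup>2"
      unfolding D L2_norm_square_cmult by (simp add: power_mult_distrib)
    then have "(L2_norm ?D)\<^sup>2 > 0"
      using n \<tau> beta_pos[OF pK] by simp
    then have "L2_norm ?D > 0"
      using L2_norm_nonneg[of ?D] by (auto simp: less_le)
    from two_point_bound[OF n phi_sum_L2 phi_sum_L2 this _ X, of V \<tau> p] D2 V[OF p(1)]
    show ?thesis
      using p(2) by (auto simp: sign_pattern_def)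
  qed
  \<comment> \<open>The supremum is bounded below by the average over all vertices. For each
    \<open>p\<close> the vertices form \<open>?P / 2\<close> pairs, which is the origin of the
    factor one half.\<close>
  let ?P = "real (card (Pow S))"
  have P: "?P > 0"
    using S(1) by (simp add: card_Pow)
  have "ennreal ?P * ennreal (real (card S) * \<tau>\<^sup>2 * exp (- V / 2) / 2) =
      (\<Sum>p\<in>S. \<Sum>A\<in>Pow (S - {p}). ennreal (\<tau>\<^sup>2 * exp (- V / 2)))"
  proof -
    have "(\<Sum>p\<in>S. \<Sum>A\<in>Pow (S - {p}). ennreal (\<tau>\<^sup>2 * exp (- V / 2))) =
        (\<Sum>p\<in>S. ennreal (?P / 2 * (\<tau>\<^sup>2 * exp (- V / 2))))"
    proof (rule sum.cong)
      fix p assume "p \<in> S"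
      then have "card S = Suc (card (S - {p}))"
        using card_Suc_Diff1[OF S(1)] by simp
      then have half: "real (card (Pow (S - {p}))) = ?P / 2"
        using S(1) by (simp add: card_Pow)
      show "(\<Sum>A\<in>Pow (S - {p}). ennreal (\<tau>\<^sup>2 * exp (- V / 2))) = ennreal (?P / 2 * (\<tau>\<^sup>2 * exp (- V / 2)))"
        unfolding sum_constant ennreal_of_nat_eq_real_of_nat half by (rule ennreal_mult[symmetric]) auto
    qed simp
    also have "\<dots> = ennreal (real (card S) * (?P / 2 * (\<tau>\<^sup>2 * exp (- V / 2))))"
      unfolding sum_constant ennreal_of_nat_eq_real_of_nat by (rule ennreal_mult[symmetric]) auto
    also have "real (card S) * (?P / 2 * (\<tau>\<^sup>2 * exp (- V / 2))) = ?P * (real (card S) * \<tau>\<^sup>2 * exp (- V / 2) / 2)"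
      by simp
    also have "ennreal \<dots> = ennreal ?P * ennreal (real (card S) * \<tau>\<^sup>2 * exp (- V / 2) / 2)"
      by (rule ennreal_mult) auto
    finally show ?thesis ..
  qed
  also have "\<dots> \<le> (\<Sum>p\<in>S. \<Sum>A\<in>Pow (S - {p}). ?r p A + ?r p (insert p A))"
    using pair by (intro sum_mono) auto
  also have "\<dots> = (\<Sum>p\<in>S. \<Sum>A\<in>Pow S. ?r p A)"
    using S(1) by (intro sum.cong sum_Pow_split[symmetric]) auto
  also have "\<dots> = (\<Sum>A\<in>Pow S. \<Sum>p\<in>S. ?r p A)"
    by (rule sum.swap)
  also have "\<dots> \<le> (\<Sum>A\<in>Pow S. SUP f\<in>F. risk (conv a) P W n g f)"
    using F by (intro sum_mono order_trans[OF risk] SUP_upper) auto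
  also have "\<dots> = ennreal ?P * (SUP f\<in>F. risk (conv a) P W n g f)"
    by (simp add: ennreal_of_nat_eq_real_of_nat)
  finally show ?thesis
    using P by (subst (asm) ennreal_mult_le_mult_iff) auto
qed

end

section \<open>Rates\<close>

lemma mabs_le: "(\<And>i. j $ i \<le> M) \<Longrightarrow> mabs (j :: nat ^ 'd::finite) \<le> CARD('d) * M"
  unfolding mabs_def using sum_bounded_above[of UNIV "\<lambda>i. j $ i" M] by simp

lemma mabs_ge: "(\<And>i. M \<le> j $ i) \<Longrightarrow> CARD('d) * M \<le> mabs (j :: nat ^ 'd::finite)"
  unfolding mabs_def using sum_bounded_below[of UNIV M "\<lambda>i. j $ i"] by simp

lemma mabs_pos: "j \<noteq> 0 \<Longrightarrow> 0 < mabs j"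
  by (auto simp: mabs_def vec_eq_iff sum_nonneg_eq_0_iff intro!: sum_pos2)

lemma K_zero: "K 0 = {0}"
  by (auto simp: K_def vec_eq_iff)

lemma zero_in_K: "0 \<in> K j"
  by (simp add: K_def)

context deconvolution
begin

text \<open>Both terms of the risk bound have order \<open>real n powr (- (2 * s / r))\<close>:
  \<open>\<delta>\<^sup>2\<close> by its choice, and the noise term because its exponent is
  \<open>2 * q / r + d / r - 1\<close> with \<open>d\<close> the dimension.\<close>

lemma risk_net_estimator_rate:
  assumes s: "s > 0" and q: "q \<ge> 0" and B: "B > 0"
    and beta_zero: "B \<le> \<beta> 0 0"
    and beta_lower: "\<And>j k. j \<noteq> 0 \<Longrightarrow> k \<in> K j \<Longrightarrow> B * real (mabs j) powr (- q) \<le> \<beta> j k"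
    and F: "F \<subseteq> L2" and nets: "delta_nets s F M \<Theta>"
  defines "r \<equiv> 2 * s + 2 * q + real CARD('d)"
  assumes est: "\<And>n. n \<ge> 1 \<Longrightarrow> net_estimator (conv a)
      (trig_poly (M (real n powr (- s / r))) ` \<Theta> (real n powr (- s / r))) (fhat n)"
  shows "\<exists>C. \<forall>n\<ge>1. (SUP f\<in>F. risk (conv a) P W n (fhat n) f) \<le> ennreal (C * real n powr (- (2 * s / r)))"
proof -
  let ?d = "real CARD('d)"
  have d: "?d \<ge> 1"
    by (simp add: Suc_le_eq)
  have r: "r > 0"
    using s q d by (simp add: r_def)
  obtain c1 c2 C where c: "c1 > 0" "c2 > 0" and net: "\<forall>\<delta>\<in>{0<..1}.
     finite (trig_poly (M \<delta>) ` \<Theta> \<delta>) \<and>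
     (\<forall>f\<in>F. \<exists>g\<in>trig_poly (M \<delta>) ` \<Theta> \<delta>. L2_norm (\<lambda>x. f x - g x) \<le> \<delta>) \<and>
     (\<forall>\<theta>\<in>\<Theta> \<delta>. \<forall>j k. (\<exists>i. j $ i > M \<delta>) \<longrightarrow> \<theta> j k = 0) \<and>
     c1 * \<delta> powr (- 1 / s) \<le> real (M \<delta>) \<and> real (M \<delta>) \<le> c2 * \<delta> powr (- 1 / s) \<and>
     ln (real (card (trig_poly (M \<delta>) ` \<Theta> \<delta>))) \<le> C * \<delta> powr (- ?d / s)"
    using nets unfolding delta_nets_def by (elim exE conjE) (rule that)
  \<comment> \<open>Chosen so that \<open>X powr q / B \<le> E * real n powr (q / r)\<close> for the
    \<open>X\<close> below. The absolute value of \<open>C\<close> in the final constant is taken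
    because the sign of \<open>C\<close> is unknown.\<close>
  define E where "E = (?d * c2) powr q / B"
  show ?thesis
  proof (intro exI[of _ "4 + 32 * E\<^sup>2 * (\<bar>C\<bar> + 2)"] allI impI SUP_least)
    fix n :: nat and f
    assume n: "n \<ge> 1" and f: "f \<in> F"
    define \<delta> where "\<delta> = real n powr (- s / r)"
    have n1: "real n \<ge> 1"
      using n by simp
    have \<delta>: "\<delta> \<in> {0<..1}"
      using n1 s r powr_mono[of "- s / r" 0 "real n"] by (auto simp: \<delta>_def)
    have \<delta>powr: "\<delta> powr (- x / s) = real n powr (x / r)" for x
      using s n1 by (simp add: \<delta>_def powr_powr)
    let ?N = "trig_poly (M \<delta>) ` \<Theta> \<delta>"
    define X where "X = ?d * real (M \<delta>)"
    have fin: "finite ?N" and cover: "\<exists>g\<in>?N. L2_norm (\<lambda>x. f x - g x) \<le> \<delta>"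
      and M_ge: "c1 * \<delta> powr (- 1 / s) \<le> real (M \<delta>)" and M_le: "real (M \<delta>) \<le> c2 * \<delta> powr (- 1 / s)"
      and card_le: "ln (real (card ?N)) \<le> C * \<delta> powr (- ?d / s)"
      using bspec[OF net \<delta>] f by simp_all
    \<comment> \<open>The lower bound on \<open>M \<delta>\<close> makes it a positive integer,
      hence \<open>X \<ge> 1\<close>. Then \<open>X powr (- q) \<le> 1\<close>, so the bound on
      \<open>\<beta>\<close> also covers the frequency zero.\<close>
    have "0 < c1 * \<delta> powr (- 1 / s)"
      using c(1) \<delta> by simp
    then have "real (M \<delta>) > 0"
      using M_ge by linarith
    then have "real (M \<delta>) \<ge> 1"
      by simp
    then have X: "X \<ge> 1"
      unfolding X_def using d by (metis mult_le_cancel_left1 mult_mono' mult_1 zero_le_one)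
    \<comment> \<open>\<open>X\<close> bounds \<open>mabs j\<close> on the net, so
      \<open>B * X powr (- q)\<close> is a lower bound for its singular values and
      \<open>?\<kappa>\<close> is the inverse square of that bound.\<close>
    let ?\<kappa> = "(X powr q / B)\<^sup>2"
    obtain g where g: "g \<in> ?N" "L2_norm (\<lambda>x. f x - g x) \<le> \<delta>"
      using cover by blast
    have N: "?N \<subseteq> range (phi_sum (low_freq (M \<delta>)))"
      by (auto simp: trig_poly_eq_phi_sum)
    have \<kappa>: "1 \<le> ?\<kappa> * (\<beta> (fst p) (snd p))\<^sup>2" if p: "p \<in> low_freq (M \<delta>)" for p
    proof -
      have pK: "snd p \<in> K (fst p)" and pM: "\<And>i. fst p $ i \<le> M \<delta>"
        using p by (auto simp: low_freq_def)
      have "B * X powr (- q) \<le> \<beta> (fst p) (snd p)"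
      proof (cases "fst p = 0")
        case True
        then have "snd p = 0"
          using pK by (simp add: K_zero)
        have "X powr (- q) \<le> X powr 0"
          using X q by (intro powr_mono) auto
        then have "B * X powr (- q) \<le> B"
          using X B by simp
        then show ?thesis
          using True \<open>snd p = 0\<close> beta_zero by simp
      next
        case False
        have "real (mabs (fst p)) \<le> X"
          unfolding X_def of_nat_mult[symmetric] using mabs_le[OF pM] by (rule of_nat_mono)
        then have "X powr (- q) \<le> real (mabs (fst p)) powr (- q)"
          using q mabs_pos[OF False] by (intro powr_mono2') auto
        then have "B * X powr (- q) \<le> B * real (mabs (fst p)) powr (- q)"
          using B by simp
        also have "\<dots> \<le> \<beta> (fst p) (snd p)"
          by (rule beta_lower[OF False pK])
        finally show ?thesis .
      qed
      then have "X powr q / B * (B * X powr (- q)) \<le> X powr q / B * \<beta> (fst p) (snd p)"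
        using B by (intro mult_left_mono) auto
      moreover have "X powr q / B * (B * X powr (- q)) = 1"
        using B X by (simp add: powr_add[symmetric])
      ultimately have "1 \<le> X powr q / B * \<beta> (fst p) (snd p)"
        by simp
      then have "1\<^sup>2 \<le> (X powr q / B * \<beta> (fst p) (snd p))\<^sup>2"
        by (intro power_mono) auto
      then show ?thesis
        by (simp only: power_mult_distrib one_power2)
    qed
    have "risk (conv a) P W n (fhat n) f \<le> ennreal (4 * \<delta>\<^sup>2 + 32 * ?\<kappa> / real n * (ln (real (card ?N)) + 2))"
    proof (rule risk_net_estimator_le[OF _ finite_low_freq low_freq_subset N _ g _ _ _ \<kappa> n])
      show "net_estimator (conv a) ?N (fhat n)"
        using est[OF n] by (simp add: \<delta>_def)
      show "0 < ?\<kappa>"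
        using X B by simp
    qed (use F f fin \<delta> in auto)
    also have "\<dots> \<le> ennreal ((4 + 32 * E\<^sup>2 * (\<bar>C\<bar> + 2)) * real n powr (- (2 * s / r)))"
    proof (rule ennreal_leI)
      have "X \<le> ?d * c2 * \<delta> powr (- 1 / s)"
        unfolding X_def mult.assoc using M_le by (intro mult_left_mono) auto
      then have "X powr q \<le> (?d * c2 * \<delta> powr (- 1 / s)) powr q"
        using X q by (intro powr_mono2) auto
      also have "\<dots> = (?d * c2) powr q * real n powr (q / r)"
        using c(2) n1 by (simp add: powr_mult powr_powr \<delta>powr[of 1, simplified] \<delta>powr)
      finally have "X powr q / B \<le> E * real n powr (q / r)"
        using B by (simp add: E_def divide_right_mono)
      then have "?\<kappa> \<le> (E * real n powr (q / r))\<^sup>2"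
        using B by (intro power_mono) auto
      also have "\<dots> = E\<^sup>2 * real n powr (2 * q / r)"
        using n1 by (simp add: power_mult_distrib powr_power mult.commute)
      finally have \<kappa>le: "?\<kappa> \<le> E\<^sup>2 * real n powr (2 * q / r)" .
      have "ln (real (card ?N)) + 2 \<le> \<bar>C\<bar> * real n powr (?d / r) + 2 * real n powr (?d / r)"
      proof (intro add_mono)
        have "ln (real (card ?N)) \<le> C * real n powr (?d / r)"
          using card_le \<delta>powr[of ?d] by simp
        also have "\<dots> \<le> \<bar>C\<bar> * real n powr (?d / r)"
          by (intro mult_right_mono) auto
        finally show "ln (real (card ?N)) \<le> \<bar>C\<bar> * real n powr (?d / r)" .
        have "real n powr 0 \<le> real n powr (?d / r)"
          using n1 r by (intro powr_mono) auto
        then show "2 \<le> 2 * real n powr (?d / r)"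
          using n1 by simp
      qed
      then have ln: "ln (real (card ?N)) + 2 \<le> (\<bar>C\<bar> + 2) * real n powr (?d / r)"
        by (simp add: distrib_right)
      have "0 < card ?N"
        unfolding card_gt_0_iff using fin g(1) by blast
      then have "0 \<le> ln (real (card ?N))"
        by (intro ln_ge_zero) simp
      then have "32 * ?\<kappa> / real n * (ln (real (card ?N)) + 2) \<le>
          32 * (E\<^sup>2 * real n powr (2 * q / r)) / real n * ((\<bar>C\<bar> + 2) * real n powr (?d / r))"
        using \<kappa>le ln n1 by (intro mult_mono divide_right_mono mult_left_mono) auto
      also have "\<dots> = 32 * E\<^sup>2 * (\<bar>C\<bar> + 2) * (real n powr (2 * q / r) * real n powr (?d / r) * real n powr (- 1))"
        using n1 by (simp add: powr_minus_divide)
      also have "real n powr (2 * q / r) * real n powr (?d / r) * real n powr (- 1) = real n powr (- (2 * s / r))"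
      proof -
        have "2 * q / r + ?d / r + - 1 = (2 * q + ?d - r) / r"
          using r by (simp add: add_divide_distrib diff_divide_distrib)
        also have "2 * q + ?d - r = - (2 * s)"
          by (simp add: r_def)
        finally have "2 * q / r + ?d / r + - 1 = - (2 * s / r)"
          by simp
        then show ?thesis
          unfolding powr_add[symmetric] by simp
      qed
      finally have "32 * ?\<kappa> / real n * (ln (real (card ?N)) + 2) \<le>
          32 * E\<^sup>2 * (\<bar>C\<bar> + 2) * real n powr (- (2 * s / r))" .
      moreover have "\<delta>\<^sup>2 = real n powr (- (2 * s / r))"
        using n1 by (simp add: \<delta>_def powr_power mult.commute)
      ultimately show "4 * \<delta>\<^sup>2 + 32 * ?\<kappa> / real n * (ln (real (card ?N)) + 2) \<le>
          (4 + 32 * E\<^sup>2 * (\<bar>C\<bar> + 2)) * real n powr (- (2 * s / r))"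
        by (simp add: distrib_right)
    qed
    finally show "risk (conv a) P W n (fhat n) f \<le>
        ennreal ((4 + 32 * E\<^sup>2 * (\<bar>C\<bar> + 2)) * real n powr (- (2 * s / r)))" .
  qed
qed

text \<open>The parameters of \<open>assouad\<close> are tuned to \<open>V = 1\<close>: the cube of
  signs has to lie in the ellipsoid, while one flip may change the standardised mean only by a
  bounded amount.\<close>

lemma minimax_risk_rate:
  assumes s: "s > 0" and q: "q \<ge> 0" and L: "L > 0" and B: "B > 0" and C1: "C1 > 0"
    and beta_upper: "\<And>j k. j \<noteq> 0 \<Longrightarrow> k \<in> K j \<Longrightarrow> \<beta> j k \<le> B * real (mabs j) powr (- q)"
    and w_bounds: "\<And>j k. j \<noteq> 0 \<Longrightarrow> k \<in> K j \<Longrightarrow> 0 \<le> w j k \<and> w j k \<le> C1 * real (mabs j) powr s"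
  defines "r \<equiv> 2 * s + 2 * q + real CARD('d)"
  shows "\<exists>c>0. \<forall>n\<ge>1. \<forall>g\<in>estimators.
    ennreal (c * real n powr (- (2 * s / r))) \<le> (SUP f\<in>fun_class w L. risk (conv a) P W n g f)"
proof -
  let ?d = "real CARD('d)"
  have d: "?d \<ge> 1"
    by (simp add: Suc_le_eq)
  have r: "r > 0"
    using s q d by (simp add: r_def)
  \<comment> \<open>On the frequencies used below \<open>c1 * real m powr (2 * s)\<close> bounds the
    squared weights \<open>w\<close>, and \<open>c2 * real m powr (- (2 * q))\<close> bounds four
    times the squared singular values.\<close>
  define c1 where "c1 = (C1 * (2 * ?d) powr s)\<^sup>2"
  define c2 where "c2 = 4 * (B * ?d powr (- q))\<^sup>2"
  have c: "c1 > 0" "c2 > 0"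
    using C1 B d by (auto simp: c1_def c2_def)
  \<comment> \<open>The first bound places the sign patterns in the ellipsoid, the second gives
    \<open>V = 1\<close>; then \<open>e\<close> below is the factor \<open>exp (- V / 2) / 2\<close>
    of \<open>assouad\<close>.\<close>
  define \<kappa> where "\<kappa> = min (L\<^sup>2 / c1) (1 / c2)"
  have \<kappa>: "\<kappa> > 0" "\<kappa> * c1 \<le> L\<^sup>2" "\<kappa> * c2 \<le> 1"
    using c L by (auto simp: \<kappa>_def min_def field_simps)
  define e where "e = exp (- 1 / 2 :: real) / 2"
  have e: "e > 0"
    by (simp add: e_def)
  show ?thesis
  proof (intro exI[of _ "\<kappa> * e * 2 powr (- (2 * s))"] conjI allI impI ballI)
    show "0 < \<kappa> * e * 2 powr (- (2 * s))"
      using \<kappa> e by simp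
    fix n :: nat and g :: "((real ^ 'd \<Rightarrow> real) \<Rightarrow> real) \<Rightarrow> (real ^ 'd \<Rightarrow> real)"
    assume n: "n \<ge> 1" and g: "g \<in> estimators"
    have n1: "real n \<ge> 1"
      using n by simp
    define t where "t = real n powr (1 / r)"
    have t: "t \<ge> 1"
      using n1 r powr_mono[of 0 "1 / r" "real n"] by (simp add: t_def)
    \<comment> \<open>Rounding up gives \<open>real n \<le> real m powr r\<close>, needed for the
      information bound; \<open>t \<ge> 1\<close> gives \<open>real m \<le> 2 * t\<close>, so the
      rate loses only the factor \<open>2 powr (- (2 * s))\<close>.\<close>
    define m where "m = nat \<lceil>t\<rceil>"
    have mt: "t \<le> real m" "real m \<le> 2 * t"
      using t unfolding m_def by linarith+
    have m1: "real m \<ge> 1"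
      using mt t by linarith
    \<comment> \<open>All coordinates lie in \<open>{m<..2 * m}\<close>: this gives
      \<open>m ^ CARD('d)\<close> frequencies with \<open>mabs\<close> of order \<open>m\<close>,
      and no coordinate vanishes, so these \<open>phi\<close> have norm one. With
      \<open>k = 0\<close> only cosines occur.\<close>
    define S :: "((nat ^ 'd) \<times> (nat ^ 'd)) set"
      where "S = (\<lambda>j. (j, 0)) ` {j. \<forall>i. j $ i \<in> {m<..2 * m}}"
    have S: "finite S" "S \<subseteq> jk_index"
      using finite_vec_box(1)[of "\<lambda>_ :: 'd. {m<..2 * m}"] by (auto simp: S_def jk_index_def zero_in_K)
    have "card S = m ^ CARD('d)"
    proof -
      have "card S = card {j :: nat ^ 'd. \<forall>i. j $ i \<in> {m<..2 * m}}"
        unfolding S_def by (rule card_image) (auto simp: inj_on_def)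
      then show ?thesis
        using finite_vec_box(2)[of "\<lambda>_ :: 'd. {m<..2 * m}"] by simp
    qed
    then have card: "real (card S) = real m powr ?d"
      using m1 by (simp add: powr_realpow)
    have freq: "fst p \<noteq> 0" "snd p \<in> K (fst p)" "?d * real m \<le> real (mabs (fst p))"
      "real (mabs (fst p)) \<le> 2 * ?d * real m" "\<And>i. fst p $ i \<noteq> 0" if "p \<in> S" for p
    proof -
      have p0: "\<And>i. m < fst p $ i" "\<And>i. fst p $ i \<le> 2 * m" "snd p = 0"
        using that by (auto simp: S_def)
      then have p: "\<And>i. m \<le> fst p $ i" "\<And>i. fst p $ i \<le> 2 * m" "\<And>i. fst p $ i \<noteq> 0" "snd p = 0"
        by (auto simp: less_imp_le dest: gr_implies_not0)
      then show "snd p \<in> K (fst p)" and nz: "\<And>i. fst p $ i \<noteq> 0"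
        by (auto simp: zero_in_K)
      then show "fst p \<noteq> 0"
        by (metis zero_index)
      show "?d * real m \<le> real (mabs (fst p))"
        using of_nat_mono[OF mabs_ge[OF p(1)]] by simp
      show "real (mabs (fst p)) \<le> 2 * ?d * real m"
        using of_nat_mono[where 'a = real, OF mabs_le[OF p(2)]] by (simp add: mult.assoc mult.left_commute)
    qed
    \<comment> \<open>The largest order the ellipsoid permits: \<open>card S\<close> times
      \<open>\<tau>\<^sup>2\<close> times \<open>real m powr (2 * s)\<close> is the constant
      \<open>\<kappa>\<close>.\<close>
    define \<tau> where "\<tau> = sqrt (\<kappa> * real m powr (- (2 * s + ?d)))"
    have \<tau>: "\<tau> > 0" and \<tau>2: "\<tau>\<^sup>2 = \<kappa> * real m powr (- (2 * s + ?d))"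
      using \<kappa>(1) m1 by (auto simp: \<tau>_def)
    have "ennreal (real (card S) * \<tau>\<^sup>2 * exp (- 1 / 2) / 2) \<le> (SUP f\<in>fun_class w L. risk (conv a) P W n g f)"
    proof (rule assouad[OF n S \<tau> _ _ _ g])
      fix p assume p: "p \<in> S"
      show "L2_inner (phi (fst p) (snd p)) (phi (fst p) (snd p)) = 1"
      proof -
        have "(\<Prod>i\<in>UNIV. if fst p $ i = 0 then 2 else 1 :: real) = 1"
          using freq(5)[OF p] by (intro prod.neutral) simp
        then show ?thesis
          using freq(2)[OF p] by (simp add: phi_inner)
      qed
      have "real (mabs (fst p)) powr (- q) \<le> (?d * real m) powr (- q)"
        using freq(3)[OF p] q d m1 by (intro powr_mono2') auto
      then have "\<beta> (fst p) (snd p) \<le> B * (?d * real m) powr (- q)"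
        using beta_upper[OF freq(1,2)[OF p]] B by (meson mult_left_mono less_imp_le order_trans)
      then have "(\<beta> (fst p) (snd p))\<^sup>2 \<le> (B * (?d * real m) powr (- q))\<^sup>2"
        using beta_pos[OF freq(2)[OF p]] by (intro power_mono) auto
      also have "\<dots> = (B * ?d powr (- q))\<^sup>2 * real m powr (- (2 * q))"
        using m1 d by (simp add: powr_mult power_mult_distrib powr_power mult.commute)
      finally have \<beta>: "(\<beta> (fst p) (snd p))\<^sup>2 \<le> (B * ?d powr (- q))\<^sup>2 * real m powr (- (2 * q))" .
      have nr: "real n \<le> real m powr r"
      proof -
        have "real n = t powr r"
          using n1 r by (simp add: t_def powr_powr)
        also have "\<dots> \<le> real m powr r"
          using mt t r by (intro powr_mono2) auto
        finally show ?thesis .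
      qed
      have "4 * real n * \<tau>\<^sup>2 * (\<beta> (fst p) (snd p))\<^sup>2 \<le>
          4 * real m powr r * \<tau>\<^sup>2 * ((B * ?d powr (- q))\<^sup>2 * real m powr (- (2 * q)))"
        using nr \<beta> by (intro mult_mono) auto
      also have "\<dots> = \<kappa> * c2 * (real m powr r * real m powr (- (2 * s + ?d)) * real m powr (- (2 * q)))"
        by (simp add: \<tau>2 c2_def)
      also have "real m powr r * real m powr (- (2 * s + ?d)) * real m powr (- (2 * q)) = 1"
        unfolding powr_add[symmetric] using m1 by (simp add: r_def)
      finally show "4 * real n * \<tau>\<^sup>2 * (\<beta> (fst p) (snd p))\<^sup>2 \<le> 1"
        using \<kappa>(3) by simp
    next
      fix A assume "A \<subseteq> S"
      show "phi_sum S (sign_pattern \<tau> A) \<in> fun_class w L"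
      proof (rule phi_sum_in_fun_class[OF S])
        have "(\<Sum>p\<in>S. (w (fst p) (snd p))\<^sup>2 * (sign_pattern \<tau> A p)\<^sup>2) \<le>
            (\<Sum>p\<in>S. c1 * real m powr (2 * s) * \<tau>\<^sup>2)"
        proof (rule sum_mono)
          fix p assume p: "p \<in> S"
          have "real (mabs (fst p)) powr s \<le> (2 * ?d * real m) powr s"
            using freq(4)[OF p] s by (intro powr_mono2) auto
          then have "w (fst p) (snd p) \<le> C1 * (2 * ?d * real m) powr s"
            using w_bounds[OF freq(1,2)[OF p]] C1 by (meson mult_left_mono less_imp_le order_trans)
          then have "(w (fst p) (snd p))\<^sup>2 \<le> (C1 * (2 * ?d * real m) powr s)\<^sup>2"
            using w_bounds[OF freq(1,2)[OF p]] by (intro power_mono) auto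
          also have "\<dots> = c1 * real m powr (2 * s)"
            using m1 d by (simp add: c1_def powr_mult power_mult_distrib powr_power mult.commute)
          finally show "(w (fst p) (snd p))\<^sup>2 * (sign_pattern \<tau> A p)\<^sup>2 \<le> c1 * real m powr (2 * s) * \<tau>\<^sup>2"
            using c(1) by (intro mult_mono) (auto simp: sign_pattern_def)
        qed
        also have "\<dots> = \<kappa> * c1 * (real m powr ?d * real m powr (2 * s) * real m powr (- (2 * s + ?d)))"
          by (simp add: card \<tau>2)
        also have "real m powr ?d * real m powr (2 * s) * real m powr (- (2 * s + ?d)) = 1"
          unfolding powr_add[symmetric] using m1 by simp
        finally show "(\<Sum>p\<in>S. (w (fst p) (snd p))\<^sup>2 * (sign_pattern \<tau> A p)\<^sup>2) \<le> L\<^sup>2"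
          using \<kappa>(2) by simp
      qed
    qed
    moreover have "ennreal (\<kappa> * e * 2 powr (- (2 * s)) * real n powr (- (2 * s / r))) \<le>
        ennreal (real (card S) * \<tau>\<^sup>2 * exp (- 1 / 2) / 2)"
    proof (rule ennreal_leI)
      have "2 powr (- (2 * s)) * real n powr (- (2 * s / r)) = (2 * t) powr (- (2 * s))"
        using n1 by (simp add: t_def powr_mult powr_powr)
      also have "\<dots> \<le> real m powr (- (2 * s))"
        using mt m1 s by (intro powr_mono2') auto
      also have "\<dots> = real m powr ?d * real m powr (- (2 * s + ?d))"
        unfolding powr_add[symmetric] by simp
      finally have "\<kappa> * e * (2 powr (- (2 * s)) * real n powr (- (2 * s / r))) \<le>
          \<kappa> * e * (real m powr ?d * real m powr (- (2 * s + ?d)))"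
        using \<kappa>(1) e by (intro mult_left_mono) auto
      then show "\<kappa> * e * 2 powr (- (2 * s)) * real n powr (- (2 * s / r)) \<le>
          real (card S) * \<tau>\<^sup>2 * exp (- 1 / 2) / 2"
        by (simp add: card \<tau>2 e_def mult_ac)
    qed
    ultimately show "ennreal (\<kappa> * e * 2 powr (- (2 * s)) * real n powr (- (2 * s / r))) \<le>
        (SUP f\<in>fun_class w L. risk (conv a) P W n g f)"
      by (rule order_trans[rotated])
  qed
qed

end

text \<open>Both rate lemmas are nonasymptotic, with one constant for all \<open>n \<ge> 1\<close>;
  multiplying by the inverse rate leaves that constant. The singular values \<open>\<beta>\<close>
  inherit positivity and polynomial bounds from \<open>b\<close> through the factors
  \<open>c\<close> and \<open>c'\<close>.\<close>

theorem corollary1: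
  fixes a :: "real ^ 'd::finite \<Rightarrow> real"
    and w b :: "nat ^ 'd \<Rightarrow> nat ^ 'd \<Rightarrow> real"
    and P :: "'w measure"
    and W :: "(real ^ 'd \<Rightarrow> real) \<Rightarrow> 'w \<Rightarrow> real"
    and L s q C0 C1 C2 C3 :: real
  assumes noise: "white_noise P W"
    and filter: "periodic1 a" "a \<in> L2" "L2_expansion a b"
    and singular: "singular_upto (conv a) b"
    and L: "L > 0"
    and s: "s > 0" and C01: "C0 > 0" "C1 > 0"
    and w_bounds: "\<And>j k. j \<noteq> 0 \<Longrightarrow> k \<in> K j \<Longrightarrow>
      C0 * real (mabs j) powr s \<le> w j k \<and> w j k \<le> C1 * real (mabs j) powr s"
    and q: "q \<ge> 0" and C23: "C2 > 0" "C3 > 0"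
    and b_bounds: "\<And>j k. j \<noteq> 0 \<Longrightarrow> k \<in> K j \<Longrightarrow>
      C2 * real (mabs j) powr (- q) \<le> b j k \<and> b j k \<le> C3 * real (mabs j) powr (- q)"
    and zero: "\<And>k. k \<in> K 0 \<Longrightarrow> w 0 k > 0 \<and> b 0 k > 0"
  shows "(\<forall>M \<Theta> fhat.
       delta_nets s (fun_class w L) M \<Theta> \<longrightarrow>
       (\<forall>n\<ge>1. let \<delta> = real n powr (- s / (2 * s + 2 * q + real CARD('d)))
               in net_estimator (conv a) (trig_poly (M \<delta>) ` \<Theta> \<delta>) (fhat n)) \<longrightarrow>
       limsup (\<lambda>n. ennreal (real n powr (2 * s / (2 * s + 2 * q + real CARD('d)))) *
         (SUP f\<in>fun_class w L. risk (conv a) P W n (fhat n) f)) < \<infinity>)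
    \<and> liminf (\<lambda>n. ennreal (real n powr (2 * s / (2 * s + 2 * q + real CARD('d)))) *
         (INF g\<in>estimators. SUP f\<in>fun_class w L. risk (conv a) P W n g f)) > 0"
proof -
  let ?r = "2 * s + 2 * q + real CARD('d)"
  let ?e = "2 * s / ?r"
  obtain \<beta> c c' where c: "c > 0" "c' > 0"
    and sing: "\<forall>j. \<forall>k\<in>K j.
       (conv a (phi j k), \<lambda>x. (\<beta> j k)\<^sup>2 * phi j k x) \<in> op_adjoint (op_graph (conv a)) \<and>
       c * b j k \<le> \<beta> j k \<and> \<beta> j k \<le> c' * b j k"
    using singular unfolding singular_upto_def by (elim exE conjE) (rule that)
  note \<beta> = sing[rule_format]
  have b_pos: "b j k > 0" if "k \<in> K j" for j k
  proof (cases "j = 0")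
    case False
    have "0 < C2 * real (mabs j) powr (- q)"
      using C23(1) mabs_pos[OF False] by simp
    then show ?thesis
      using b_bounds[OF False that] by linarith
  next
    case True
    then show ?thesis
      using zero[of k] that by simp
  qed
  have \<beta>_pos: "0 < \<beta> j k" if "k \<in> K j" for j k
    using \<beta>[OF that] mult_pos_pos[OF c(1) b_pos[OF that]] by linarith
  interpret deconvolution a \<beta> P W
    by unfold_locales (use filter \<beta> \<beta>_pos noise in auto)
  have scale: "ennreal (real n powr ?e) * ennreal (C * real n powr (- ?e)) = ennreal C"
    if "n \<ge> 1" for n :: nat and C :: real
  proof -
    have one: "real n powr ?e * real n powr (- ?e) = 1"
      using that by (simp only: powr_add[symmetric]) simp
    have "ennreal (real n powr ?e) * ennreal (C * real n powr (- ?e)) =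
        ennreal (real n powr ?e * (C * real n powr (- ?e)))"
      by (rule ennreal_mult'[symmetric]) simp
    also have "real n powr ?e * (C * real n powr (- ?e)) = C"
      unfolding mult.left_commute[of _ C] one by simp
    finally show ?thesis .
  qed
  show ?thesis
  proof (intro conjI allI impI)
    fix M \<Theta> fhat
    assume nets: "delta_nets s (fun_class w L) M \<Theta>"
      and est: "\<forall>n\<ge>1. let \<delta> = real n powr (- s / ?r)
         in net_estimator (conv a) (trig_poly (M \<delta>) ` \<Theta> \<delta>) (fhat n)"
    \<comment> \<open>The minimum merges the lower bound at frequency zero, where the power bound
      says nothing, with the one at all other frequencies.\<close>
    let ?B = "c * min C2 (b 0 0)"
    have "fun_class w L \<subseteq> L2"
      by (auto simp: fun_class_def L2_expansion_def)
    moreover have "?B > 0"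
      using c(1) C23(1) b_pos[OF zero_in_K] by simp
    moreover have "?B \<le> \<beta> 0 0"
    proof -
      have "c * min C2 (b 0 0) \<le> c * b 0 0"
        using c(1) by (intro mult_left_mono) auto
      then show ?thesis
        using \<beta>[OF zero_in_K, of 0] by linarith
    qed
    moreover have "?B * real (mabs j) powr (- q) \<le> \<beta> j k" if "j \<noteq> 0" "k \<in> K j" for j k
    proof -
      have "min C2 (b 0 0) * real (mabs j) powr (- q) \<le> C2 * real (mabs j) powr (- q)"
        by (intro mult_right_mono) auto
      also have "\<dots> \<le> b j k"
        using b_bounds[OF that] by simp
      finally have "c * (min C2 (b 0 0) * real (mabs j) powr (- q)) \<le> c * b j k"
        using c(1) by (intro mult_left_mono) auto
      then show ?thesis
        using \<beta>[OF that(2)] by (simp add: mult.assoc)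
    qed
    ultimately obtain C where C: "\<And>n. n \<ge> 1 \<Longrightarrow>
        (SUP f\<in>fun_class w L. risk (conv a) P W n (fhat n) f) \<le> ennreal (C * real n powr (- ?e))"
      using risk_net_estimator_rate[OF s q _ _ _ _ nets, of ?B fhat] est
      by (auto simp: Let_def)
    have "\<forall>\<^sub>F n in sequentially. ennreal (real n powr ?e) *
        (SUP f\<in>fun_class w L. risk (conv a) P W n (fhat n) f) \<le> ennreal C"
      using eventually_ge_at_top[of 1]
    proof eventually_elim
      case (elim n)
      then show ?case
        using mult_left_mono[OF C[OF elim], of "ennreal (real n powr ?e)"] scale[OF elim, of C] by simp
    qed
    then have "limsup (\<lambda>n. ennreal (real n powr ?e) *
        (SUP f\<in>fun_class w L. risk (conv a) P W n (fhat n) f)) \<le> ennreal C"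
      by (rule Limsup_bounded)
    then show "limsup (\<lambda>n. ennreal (real n powr ?e) *
        (SUP f\<in>fun_class w L. risk (conv a) P W n (fhat n) f)) < \<infinity>"
      by (rule le_less_trans) simp
  next
    have \<beta>_le: "\<beta> j k \<le> c' * C3 * real (mabs j) powr (- q)" if "j \<noteq> 0" "k \<in> K j" for j k
    proof -
      have "c' * b j k \<le> c' * (C3 * real (mabs j) powr (- q))"
        using b_bounds[OF that] c(2) by (intro mult_left_mono) auto
      then show ?thesis
        using \<beta>[OF that(2)] by (simp add: mult.assoc)
    qed
    have w_le: "0 \<le> w j k \<and> w j k \<le> C1 * real (mabs j) powr s" if "j \<noteq> 0" "k \<in> K j" for j k
    proof -
      have "0 \<le> C0 * real (mabs j) powr s"
        using C01(1) by simp
      then show ?thesis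
        using w_bounds[OF that] by linarith
    qed
    have "c' * C3 > 0"
      using c(2) C23(2) by simp
    then have "\<exists>\<epsilon>>0. \<forall>n\<ge>1. \<forall>g\<in>estimators.
        ennreal (\<epsilon> * real n powr (- ?e)) \<le> (SUP f\<in>fun_class w L. risk (conv a) P W n g f)"
      by (rule minimax_risk_rate[OF s q L _ C01(2)]) (fact \<beta>_le w_le)+
    then obtain \<epsilon> where \<epsilon>: "\<epsilon> > 0" "\<forall>n\<ge>1. \<forall>g\<in>estimators.
        ennreal (\<epsilon> * real n powr (- ?e)) \<le> (SUP f\<in>fun_class w L. risk (conv a) P W n g f)"
      by (elim exE conjE) (rule that)
    have "\<forall>\<^sub>F n in sequentially. ennreal \<epsilon> \<le> ennreal (real n powr ?e) *
        (INF g\<in>estimators. SUP f\<in>fun_class w L. risk (conv a) P W n g f)"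
      using eventually_ge_at_top[of 1]
    proof eventually_elim
      case (elim n)
      then have "ennreal (\<epsilon> * real n powr (- ?e)) \<le>
          (INF g\<in>estimators. SUP f\<in>fun_class w L. risk (conv a) P W n g f)"
        by (intro INF_greatest \<epsilon>(2)[rule_format])
      from mult_left_mono[OF this, of "ennreal (real n powr ?e)"] show ?case
        using scale[OF elim, of \<epsilon>] by simp
    qed
    then have "ennreal \<epsilon> \<le> liminf (\<lambda>n. ennreal (real n powr ?e) *
        (INF g\<in>estimators. SUP f\<in>fun_class w L. risk (conv a) P W n g f))"
      by (rule Liminf_bounded)
    moreover have "0 < ennreal \<epsilon>"
      unfolding ennreal_less_zero_iff by (rule \<epsilon>(1))
    ultimately show "liminf (\<lambda>n. ennreal (real n powr ?e) *
        (INF g\<in>estimators. SUP f\<in>fun_class w L. risk (conv a) P W n g f)) > 0"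
      by (rule order.strict_trans2[rotated])
  qed
qed

end
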